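(* Fix $\lambda>0$ and $z>0$. The last passage time $\sigma_z^\lambda$ is the only totally inaccessible stopping time within the filtration $\mathbb{F}^{\xi^{\lambda,z},c}$, in the following sense: for every $\mathbb{F}^{\xi^{\lambda,z},c}$-stopping time $T$, one has $\mathbb{P}(T=\sigma_z^\lambda)=0$ if and only if $T$ is predictable.
   Context: Let $B=(B_t)_{t\ge 0}$ be a standard Brownian motion started at $0$ on a complete probability space $(\Omega,\mathcal{F},\mathbb{P})$, with $\mathcal{N}_{\mathbb{P}}$ the collection of $\mathbb{P}$-null sets. For $\lambda>0$, $z>0$, put $B^\lambda_t=B_t+\lambda t$, $\sigma_z^\lambda=\sup\{t>0: B^\lambda_t=z\}$ (almost surely finite), and $\xi^{\lambda,z}_t=B^\lambda_{t\wedge\sigma_z^\lambda}$, $t\ge 0$. The completed natural filtration is $\mathbb{F}^{\xi^{\lambda,z},c}$ with $\mathcal{F}^{\xi^{\lambda,z},c}_t=\sigma(\xi^{\lambda,z}_s,\,s\le t)\vee\mathcal{N}_{\mathbb{P}}$; $\sigma_z^\lambda$ is a stopping time of this filtration. A stopping time $T$ is totally inaccessible if $\mathbb{P}(T=S<\infty)=0$ for every predictable stopping time $S$. *)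

theory Defs
  imports "HOL-Probability.Probability"
begin

text \<open>Processes are indexed by \<open>real\<close> and only their values at nonnegative times matter.
  Random times take values in \<open>ennreal\<close>, that is in $[0,\infty]$; filtrations are accordingly
  indexed by \<open>ennreal\<close>, so that the library's \<open>stopping_time\<close> applies (the condition at time
  \<open>\<infinity>\<close> is vacuous).\<close>

locale brownian_motion = prob_space M for M :: "'a measure" +
  fixes B :: "real \<Rightarrow> 'a \<Rightarrow> real"
  assumes random_variable_B: "\<And>t. t \<ge> 0 \<Longrightarrow> random_variable borel (B t)"
    and start_B: "AE \<omega> in M. B 0 \<omega> = 0"
    and indep_increments: "\<And>(t :: nat \<Rightarrow> real) n. t 0 \<ge> 0 \<Longrightarrow> (\<And>i. i < n \<Longrightarrow> t i \<le> t (Suc i)) \<Longrightarrow>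
          indep_vars (\<lambda>_. borel) (\<lambda>i \<omega>. B (t (Suc i)) \<omega> - B (t i) \<omega>) {..<n}"
    and normal_increments: "\<And>s t. 0 \<le> s \<Longrightarrow> s < t \<Longrightarrow>
          distributed M lborel (\<lambda>\<omega>. B t \<omega> - B s \<omega>) (normal_density 0 (sqrt (t - s)))"
    and continuous_paths: "AE \<omega> in M. continuous_on {0..} (\<lambda>t. B t \<omega>)"

definition drifted :: "(real \<Rightarrow> 'a \<Rightarrow> real) \<Rightarrow> real \<Rightarrow> real \<Rightarrow> 'a \<Rightarrow> real" where
  "drifted B \<mu> t \<omega> = B t \<omega> + \<mu> * t"

text \<open>The supremum of the empty set is 0 in \<open>ennreal\<close>.\<close>

definition last_passage :: "(real \<Rightarrow> 'a \<Rightarrow> real) \<Rightarrow> real \<Rightarrow> 'a \<Rightarrow> ennreal" where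
  "last_passage X z \<omega> = Sup {ennreal t | t. t > 0 \<and> X t \<omega> = z}"

definition stopped :: "(real \<Rightarrow> 'a \<Rightarrow> real) \<Rightarrow> ('a \<Rightarrow> ennreal) \<Rightarrow> real \<Rightarrow> 'a \<Rightarrow> real" where
  "stopped X T t \<omega> = X (enn2real (min (ennreal t) (T \<omega>))) \<omega>"

definition completed_natural_filtration ::
    "'a measure \<Rightarrow> (real \<Rightarrow> 'a \<Rightarrow> real) \<Rightarrow> ennreal \<Rightarrow> 'a measure" where
  "completed_natural_filtration M X t = sigma (space M)
     ({X s -` A \<inter> space M | s A. 0 \<le> s \<and> ennreal s \<le> t \<and> A \<in> sets borel} \<union> null_sets M)"

lemma filtration_completed_natural_filtration:
  "filtration (space M) (completed_natural_filtration M X)"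
proof -
  define G where "G t = {X s -` A \<inter> space M | s A. 0 \<le> s \<and> ennreal s \<le> t \<and> A \<in> sets borel} \<union> null_sets M"
    for t
  have G: "G t \<subseteq> Pow (space M)" for t
    unfolding G_def using sets.sets_into_space[of _ M] by (auto simp: null_sets_def)
  have eq: "completed_natural_filtration M X t = sigma (space M) (G t)" for t
    by (simp add: completed_natural_filtration_def G_def)
  show ?thesis
  proof
    show "space (completed_natural_filtration M X t) = space M" for t
      by (simp add: eq space_measure_of[OF G])
    fix s t :: ennreal assume "s \<le> t"
    then have "G s \<subseteq> G t"
      unfolding G_def by (blast intro: order_trans)
    then show "sets (completed_natural_filtration M X s) \<subseteq> sets (completed_natural_filtration M X t)"
      by (simp add: eq sets_measure_of[OF G] sigma_sets_mono')
  qed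
qed

text \<open>A predictable time is a stopping time that is almost surely announced by a sequence of
  stopping times, strictly from below on the event that it is positive.\<close>

definition predictable_time :: "'a measure \<Rightarrow> (ennreal \<Rightarrow> 'a measure) \<Rightarrow> ('a \<Rightarrow> ennreal) \<Rightarrow> bool" where
  "predictable_time M F T \<longleftrightarrow> stopping_time F T \<and>
     (\<exists>S :: nat \<Rightarrow> 'a \<Rightarrow> ennreal. (\<forall>n. stopping_time F (S n)) \<and>
        (AE \<omega> in M. incseq (\<lambda>n. S n \<omega>) \<and> (\<lambda>n. S n \<omega>) \<longlonglongrightarrow> T \<omega> \<and>
           (T \<omega> > 0 \<longrightarrow> (\<forall>n. S n \<omega> < T \<omega>))))"

definition totally_inaccessible :: "'a measure \<Rightarrow> (ennreal \<Rightarrow> 'a measure) \<Rightarrow> ('a \<Rightarrow> ennreal) \<Rightarrow> bool" where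
  "totally_inaccessible M F T \<longleftrightarrow> stopping_time F T \<and>
     (\<forall>S. predictable_time M F S \<longrightarrow> \<P>(\<omega> in M. T \<omega> = S \<omega> \<and> S \<omega> < \<infinity>) = 0)"

end

theory Submission
  imports Defs
begin

text \<open>Every bounded martingale of the completed Brownian filtration has a continuous version: this is
  explicit for products of functions of finitely many \<open>B s\<close>, and passes to \<open>L\<^sup>1\<close> limits by the maximal
  inequality. Applied to the martingale closed by \<open>exp (- \<tau>)\<close>, it yields a sequence announcing a
  Brownian optional time \<open>\<tau>\<close>. Such a \<open>\<tau>\<close> almost surely differs from \<open>\<sigma>\<close>, because after \<open>\<tau>\<close> the
  path immediately goes below its value at \<open>\<tau>\<close>. Before \<open>\<sigma>\<close> the filtration of \<open>\<xi>\<close> coincides with the Brownian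
  one, so a stopping time \<open>T\<close> of it agrees on \<open>T < \<sigma>\<close> with a Brownian optional time. If \<open>T\<close> is
  predictable, then on \<open>T = \<sigma>\<close> the supremum of the Brownian optional times attached to the announcing sequence
  equals \<open>\<sigma>\<close>, a null event. If conversely \<open>T\<close> and \<open>\<sigma>\<close> almost surely differ, one announces \<open>T\<close>
  by the Brownian sequence before \<open>\<sigma>\<close>, and by \<open>T - 1 / n\<close> after \<open>\<sigma>\<close>, when the whole future of \<open>\<xi>\<close> is known.\<close>

subsection \<open>Completed natural filtrations and the maximal inequality\<close>

text \<open>The obstacle is right limits: tracing a stopping time of the stopped filtration on the
  Brownian one controls only events \<open>\<tau> < t\<close>. Optional sampling and the immediate
  descent are therefore needed at optional times; both come from \<open>nn_integral_grid_le\<close>,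
  which replaces \<open>\<tau>\<close> by the next grid point, sums over deterministic times and
  passes to the limit by Fatou's lemma. Continuity of martingales is what makes Brownian optional
  times announceable: the conditional expectation of \<open>exp (- \<tau>)\<close> meets
  \<open>exp (- t)\<close> continuously at \<open>\<tau>\<close>, so the meeting can be seen coming.
  Products are explicit because integrating out the latest factor is the heat semigroup, jointly
  continuous in time and space. The stopped filtration learns of \<open>\<sigma>\<close> only at
  \<open>\<sigma>\<close> itself: \<open>\<sigma> \<le> t\<close> is almost surely the event that
  the stopped process sits at \<open>z\<close> at time \<open>t\<close>, as the drifted motion
  avoids \<open>z\<close> at a fixed time.\<close>

lemma completed_natural_filtration_generator_subset:
  "{X s -` A \<inter> space M | s A. 0 \<le> s \<and> ennreal s \<le> t \<and> A \<in> sets borel} \<union> null_sets M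
    \<subseteq> Pow (space M)"
  using sets.sets_into_space[of _ M] by (auto simp: null_sets_def)

lemma space_completed_natural_filtration [simp]:
  "space (completed_natural_filtration M X t) = space M"
  unfolding completed_natural_filtration_def
  by (rule space_measure_of[OF completed_natural_filtration_generator_subset])

lemma sets_completed_natural_filtration:
  "sets (completed_natural_filtration M X t) = sigma_sets (space M)
     ({X s -` A \<inter> space M | s A. 0 \<le> s \<and> ennreal s \<le> t \<and> A \<in> sets borel} \<union> null_sets M)"
  unfolding completed_natural_filtration_def
  by (rule sets_measure_of[OF completed_natural_filtration_generator_subset])

lemma completed_natural_filtration_mono:
  "s \<le> t \<Longrightarrow> sets (completed_natural_filtration M X s) \<subseteq> sets (completed_natural_filtration M X t)"
  using filtration.sets_F_mono[OF filtration_completed_natural_filtration] .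

lemma null_sets_completed_natural_filtration:
  "N \<in> null_sets M \<Longrightarrow> N \<in> sets (completed_natural_filtration M X t)"
  unfolding sets_completed_natural_filtration by blast

lemma measurable_completed_natural_filtration:
  assumes "0 \<le> s" "ennreal s \<le> t"
  shows "X s \<in> borel_measurable (completed_natural_filtration M X t)"
  by (rule measurableI) (use assms in \<open>auto simp: sets_completed_natural_filtration\<close>)

text \<open>Sigma-algebra induction over the generators; the empty set falls under
  \<open>null\<close>, so it needs no case of its own.\<close>

lemma completed_natural_filtration_induct [consumes 1, case_names process null compl union]:
  assumes "A \<in> sets (completed_natural_filtration M X t)"
    and process: "\<And>s U. 0 \<le> s \<Longrightarrow> ennreal s \<le> t \<Longrightarrow> U \<in> sets borel \<Longrightarrow> P (X s -` U \<inter> space M)"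
    and null: "\<And>N. N \<in> null_sets M \<Longrightarrow> P N"
    and compl: "\<And>A. A \<in> sets (completed_natural_filtration M X t) \<Longrightarrow> P A \<Longrightarrow> P (space M - A)"
    and union: "\<And>A :: nat \<Rightarrow> _. (\<And>i. A i \<in> sets (completed_natural_filtration M X t)) \<Longrightarrow>
      (\<And>i. P (A i)) \<Longrightarrow> P (\<Union>i. A i)"
  shows "P A"
  using assms(1) unfolding sets_completed_natural_filtration
proof (induction rule: sigma_sets.induct)
  case (Basic a)
  then show ?case using process null by auto
next
  case Empty
  then show ?case by (intro null) auto
next
  case (Compl a)
  then show ?case by (intro compl) (auto simp: sets_completed_natural_filtration)
next
  case (Union a)
  then show ?case by (intro union) (auto simp: sets_completed_natural_filtration)
qed

lemma completed_natural_filtration_subset: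
  assumes "\<And>s. 0 \<le> s \<Longrightarrow> ennreal s \<le> t \<Longrightarrow> X s \<in> borel_measurable M"
  shows "sets (completed_natural_filtration M X t) \<subseteq> sets M"
proof
  fix A assume "A \<in> sets (completed_natural_filtration M X t)"
  then show "A \<in> sets M"
    by (induction rule: completed_natural_filtration_induct)
       (auto intro: measurable_sets[OF assms])
qed

context complete_measure
begin

lemma AE_imp_null_set:
  assumes "AE x in M. x \<notin> A" "A \<subseteq> space M"
  shows "A \<in> null_sets M"
  using assms by (simp add: null_sets_iff_AE)

text \<open>By completeness both differences of \<open>A\<close> and \<open>A'\<close> are null
  sets, although \<open>A'\<close> is not assumed measurable, and every member of the filtration
  contains all null sets.\<close>

lemma completed_natural_filtration_AE_cong:
  assumes A: "A \<in> sets (completed_natural_filtration M X t)"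
    and eq: "AE x in M. x \<in> A \<longleftrightarrow> x \<in> A'" and A': "A' \<subseteq> space M"
  shows "A' \<in> sets (completed_natural_filtration M X t)"
proof -
  have sub: "A \<subseteq> space M" using sets.sets_into_space[OF A] by simp
  have "A - A' \<in> null_sets M" "A' - A \<in> null_sets M"
    using eq sub A' by (auto intro!: AE_imp_null_set elim!: eventually_mono)
  then have "(A - (A - A')) \<union> (A' - A) \<in> sets (completed_natural_filtration M X t)"
    by (intro sets.Un[OF sets.Diff[OF A]] null_sets_completed_natural_filtration)
  also have "(A - (A - A')) \<union> (A' - A) = A'" by auto
  finally show ?thesis .
qed

lemma borel_measurable_completed_natural_filtration_AE_cong:
  fixes f g :: "'a \<Rightarrow> 'b::topological_space"
  assumes f: "f \<in> borel_measurable (completed_natural_filtration M X t)"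
    and eq: "AE x in M. f x = g x"
  shows "g \<in> borel_measurable (completed_natural_filtration M X t)"
proof (rule measurableI)
  fix U :: "'b set" assume U: "U \<in> sets borel"
  show "g -` U \<inter> space (completed_natural_filtration M X t) \<in> sets (completed_natural_filtration M X t)"
    by (rule completed_natural_filtration_AE_cong[OF measurable_sets[OF f U]])
       (use eq in \<open>auto elim!: eventually_mono\<close>)
qed simp

lemma borel_measurable_AE_cong:
  fixes f g :: "'a \<Rightarrow> 'b::topological_space"
  assumes f: "f \<in> borel_measurable M" and eq: "AE x in M. f x = g x"
  shows "g \<in> borel_measurable M"
proof (rule measurableI)
  fix U :: "'b set" assume U: "U \<in> sets borel"
  show "g -` U \<inter> space M \<in> sets M"
    by (rule in_sets_AE[OF _ measurable_sets[OF f U]]) (use eq in \<open>auto elim!: eventually_mono\<close>)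
qed simp

end

locale complete_brownian_motion = brownian_motion M B + complete_measure M
  for M :: "'a measure" and B :: "real \<Rightarrow> 'a \<Rightarrow> real"
begin

abbreviation G :: "ennreal \<Rightarrow> 'a measure" where
  "G \<equiv> completed_natural_filtration M B"

lemma subalgebra_G: "subalgebra M (G t)"
  unfolding subalgebra_def
  using completed_natural_filtration_subset[of t B M] random_variable_B by auto

lemma sets_G_in_M: "A \<in> sets (G t) \<Longrightarrow> A \<in> sets M"
  using subalgebra_G by (auto simp: subalgebra_def)

lemma measurable_G_in_M: "f \<in> measurable (G t) N \<Longrightarrow> f \<in> measurable M N"
  using measurable_from_subalg[OF subalgebra_G] .

lemma measurable_G_mono: "f \<in> measurable (G s) N \<Longrightarrow> s \<le> t \<Longrightarrow> f \<in> measurable (G t) N"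
  using completed_natural_filtration_mono[of s t M B] by (auto simp: measurable_def)

sublocale G: sigma_finite_subalgebra M "G t" for t
proof -
  have "finite_measure_subalgebra M (G t)"
    by unfold_locales (rule subalgebra_G)
  then show "sigma_finite_subalgebra M (G t)"
    by (rule finite_measure_subalgebra_is_sigma_finite)
qed

lemma sets_G_mono: "s \<le> t \<Longrightarrow> A \<in> sets (G s) \<Longrightarrow> A \<in> sets (G t)"
  using completed_natural_filtration_mono[of s t M B] by auto

abbreviation cexp :: "real \<Rightarrow> ('a \<Rightarrow> real) \<Rightarrow> 'a \<Rightarrow> real" where
  "cexp t \<equiv> real_cond_exp M (G (ennreal t))"

text \<open>Conditional Jensen for the absolute value, from monotonicity applied to \<open>Y\<close>
  and to \<open>- Y\<close>; integrating over \<open>C\<close> then removes the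
  conditioning.\<close>

lemma set_integral_abs_cexp_le:
  assumes Y: "integrable M Y" and C: "C \<in> sets (G (ennreal t))"
  shows "(\<integral>w\<in>C. \<bar>cexp t Y w\<bar> \<partial>M) \<le> (\<integral>w\<in>C. \<bar>Y w\<bar> \<partial>M)"
proof -
  have CM: "C \<in> sets M" using sets_G_in_M[OF C] .
  have aY: "integrable M (\<lambda>w. \<bar>Y w\<bar>)" using Y by simp
  have "AE w in M. cexp t Y w \<le> cexp t (\<lambda>w. \<bar>Y w\<bar>) w"
    by (rule G.real_cond_exp_mono) (use Y in auto)
  moreover have "AE w in M. cexp t (\<lambda>w. (-1) * Y w) w \<le> cexp t (\<lambda>w. \<bar>Y w\<bar>) w"
    by (rule G.real_cond_exp_mono) (use Y in auto)
  moreover have "AE w in M. cexp t (\<lambda>w. (-1) * Y w) w = (-1) * cexp t Y w"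
    by (rule G.real_cond_exp_cmult[OF Y])
  ultimately have "AE w in M. \<bar>cexp t Y w\<bar> \<le> cexp t (\<lambda>w. \<bar>Y w\<bar>) w"
    by eventually_elim auto
  then have "(\<integral>w\<in>C. \<bar>cexp t Y w\<bar> \<partial>M) \<le> (\<integral>w\<in>C. cexp t (\<lambda>w. \<bar>Y w\<bar>) w \<partial>M)"
    unfolding set_lebesgue_integral_def
    using G.real_cond_exp_int(1)[OF Y, of "ennreal t"] G.real_cond_exp_int(1)[OF aY, of "ennreal t"] CM
    by (intro integral_mono_AE integrable_mult_indicator integrable_abs)
       (auto simp: indicator_def elim!: eventually_mono)
  also have "\<dots> = (\<integral>w\<in>C. \<bar>Y w\<bar> \<partial>M)"
    using G.real_cond_exp_intA[OF aY C] by simp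
  finally show ?thesis .
qed

text \<open>Doob's argument: the event is split by the first time of \<open>D\<close> at which the
  level is exceeded. Each piece is known at its own time, so there \<open>f t\<close> may be traded
  for \<open>Y\<close>.\<close>

lemma maximal_inequality_finite:
  assumes Y: "integrable M Y" and D: "finite D"
    and f: "\<And>t. t \<in> D \<Longrightarrow> f t \<in> borel_measurable (G (ennreal t))"
    and ce: "\<And>t. t \<in> D \<Longrightarrow> AE w in M. f t w = cexp t Y w"
    and c: "c > 0"
  shows "prob {w\<in>space M. \<exists>t\<in>D. \<bar>f t w\<bar> > c} \<le> expectation (\<lambda>w. \<bar>Y w\<bar>) / c"
proof -
  define C where "C t = {w\<in>space M. \<bar>f t w\<bar> > c \<and> (\<forall>s\<in>D. s < t \<longrightarrow> \<bar>f s w\<bar> \<le> c)}" for t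
  have CG: "C t \<in> sets (G (ennreal t))" if t: "t \<in> D" for t
  proof -
    have [measurable]: "f t \<in> borel_measurable (G (ennreal t))" using f t by auto
    have m: "f s \<in> borel_measurable (G (ennreal t))" if "s \<in> {s\<in>D. s < t}" for s
    proof (rule measurable_G_mono)
      show "f s \<in> borel_measurable (G (ennreal s))" using f that by blast
      show "ennreal s \<le> ennreal t" using that by (intro ennreal_leI) auto
    qed
    have "{w\<in>space (G (ennreal t)). \<bar>f t w\<bar> > c \<and> (\<forall>s\<in>{s\<in>D. s < t}. \<bar>f s w\<bar> \<le> c)} \<in> sets (G (ennreal t))"
    proof (intro sets.sets_Collect_conj sets.sets_Collect_finite_All)
      fix s assume "s \<in> {s\<in>D. s < t}"
      from m[OF this] show "{w\<in>space (G (ennreal t)). \<bar>f s w\<bar> \<le> c} \<in> sets (G (ennreal t))"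
        by measurable
    qed (use D in \<open>simp, measurable\<close>)
    also have "{w\<in>space (G (ennreal t)). \<bar>f t w\<bar> > c \<and> (\<forall>s\<in>{s\<in>D. s < t}. \<bar>f s w\<bar> \<le> c)} = C t"
      by (auto simp: C_def)
    finally show ?thesis .
  qed
  have CM: "C t \<in> sets M" if "t \<in> D" for t using CG[OF that] sets_G_in_M by auto
  have disj: "disjoint_family_on C D"
    unfolding disjoint_family_on_def C_def by (auto, metis linorder_neqE not_le)
  have U: "{w\<in>space M. \<exists>t\<in>D. \<bar>f t w\<bar> > c} = (\<Union>t\<in>D. C t)"
  proof (intro equalityI subsetI)
    fix w assume "w \<in> {w\<in>space M. \<exists>t\<in>D. \<bar>f t w\<bar> > c}"
    then have w: "w \<in> space M" and ne: "{t\<in>D. \<bar>f t w\<bar> > c} \<noteq> {}" by auto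
    define m where "m = Min {t\<in>D. \<bar>f t w\<bar> > c}"
    have m: "m \<in> {t\<in>D. \<bar>f t w\<bar> > c}" unfolding m_def using D ne by (intro Min_in) auto
    have "\<not> \<bar>f s w\<bar> > c" if "s \<in> D" "s < m" for s
      using that Min_le[of "{t\<in>D. \<bar>f t w\<bar> > c}" s] D unfolding m_def by fastforce
    then show "w \<in> (\<Union>t\<in>D. C t)" using m w by (auto simp: C_def not_less intro!: bexI[of _ m])
  qed (auto simp: C_def)
  have le: "c * prob (C t) \<le> (\<integral>w\<in>C t. \<bar>Y w\<bar> \<partial>M)" if t: "t \<in> D" for t
  proof -
    have "c * prob (C t) = (\<integral>w\<in>C t. c \<partial>M)"
      using CM[OF t] by (simp add: set_lebesgue_integral_def)
    also have "\<dots> \<le> (\<integral>w\<in>C t. \<bar>cexp t Y w\<bar> \<partial>M)"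
      unfolding set_lebesgue_integral_def
      using G.real_cond_exp_int(1)[OF Y, of "ennreal t"] CM[OF t] ce[OF t]
      by (intro integral_mono_AE integrable_mult_indicator integrable_abs)
         (auto simp: indicator_def C_def elim!: eventually_mono)
    also have "\<dots> \<le> (\<integral>w\<in>C t. \<bar>Y w\<bar> \<partial>M)"
      by (rule set_integral_abs_cexp_le[OF Y CG[OF t]])
    finally show ?thesis .
  qed
  have "prob (\<Union>t\<in>D. C t) = (\<Sum>t\<in>D. prob (C t))"
    by (rule finite_measure_finite_Union[OF D _ disj]) (use CM in auto)
  then have "c * prob (\<Union>t\<in>D. C t) = (\<Sum>t\<in>D. c * prob (C t))"
    by (simp add: sum_distrib_left)
  also have "\<dots> \<le> (\<Sum>t\<in>D. \<integral>w\<in>C t. \<bar>Y w\<bar> \<partial>M)"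
    by (intro sum_mono le)
  also have "\<dots> = (\<integral>w\<in>(\<Union>t\<in>D. C t). \<bar>Y w\<bar> \<partial>M)"
  proof (rule set_integral_finite_Union[symmetric])
    fix t assume "t \<in> D"
    then show "set_integrable M (C t) (\<lambda>w. \<bar>Y w\<bar>)"
      unfolding set_integrable_def by (intro integrable_mult_indicator integrable_abs CM Y)
  qed (use D disj CM in auto)
  also have "\<dots> \<le> expectation (\<lambda>w. \<bar>Y w\<bar>)"
    unfolding set_lebesgue_integral_def
    using Y CM D
    by (intro integral_mono integrable_mult_indicator integrable_abs) (auto simp: indicator_def)
  finally show ?thesis unfolding U using c by (simp add: field_simps)
qed

text \<open>Continuity from below along finite initial segments of an enumeration of
  \<open>D\<close>; the bound does not depend on the segment.\<close>

lemma maximal_inequality: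
  assumes Y: "integrable M Y" and D: "countable D"
    and f: "\<And>t. t \<in> D \<Longrightarrow> f t \<in> borel_measurable (G (ennreal t))"
    and ce: "\<And>t. t \<in> D \<Longrightarrow> AE w in M. f t w = cexp t Y w"
    and c: "c > 0"
  shows "prob {w\<in>space M. \<exists>t\<in>D. \<bar>f t w\<bar> > c} \<le> expectation (\<lambda>w. \<bar>Y w\<bar>) / c"
proof (cases "D = {}")
  case True
  then show ?thesis using c by (simp add: divide_nonneg_pos)
next
  case False
  define E where "E n = from_nat_into D ` {..n}" for n :: nat
  define A where "A n = {w\<in>space M. \<exists>t\<in>E n. \<bar>f t w\<bar> > c}" for n
  have ED: "E n \<subseteq> D" for n using from_nat_into[OF False] by (auto simp: E_def)
  have fM: "f t \<in> borel_measurable M" if "t \<in> D" for t using measurable_G_in_M[OF f[OF that]] .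
  have AM: "A n \<in> sets M" for n
  proof -
    have "A n = (\<Union>t\<in>E n. {w\<in>space M. \<bar>f t w\<bar> > c})" by (auto simp: A_def)
    also have "\<dots> \<in> sets M"
      using ED[of n] fM by (intro sets.finite_UN) (auto simp: E_def intro!: borel_measurable_less)
    finally show ?thesis .
  qed
  have "(\<lambda>n. prob (A n)) \<longlonglongrightarrow> prob (\<Union>n. A n)"
  proof (rule finite_Lim_measure_incseq)
    show "range A \<subseteq> sets M" using AM by blast
    show "incseq A"
    proof (rule incseq_SucI)
      fix n have "E n \<subseteq> E (Suc n)" by (auto simp: E_def)
      then show "A n \<subseteq> A (Suc n)" unfolding A_def by blast
    qed
  qed
  moreover have "(\<Union>n. A n) = {w\<in>space M. \<exists>t\<in>D. \<bar>f t w\<bar> > c}"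
  proof -
    have "(\<Union>n. E n) = range (from_nat_into D)" unfolding E_def by auto
    then have "(\<Union>n. E n) = D" using range_from_nat_into[OF False D] by simp
    then show ?thesis unfolding A_def by blast
  qed
  moreover have "prob (A n) \<le> expectation (\<lambda>w. \<bar>Y w\<bar>) / c" for n
    unfolding A_def
    using ED[of n] c by (intro maximal_inequality_finite Y f ce) (auto simp: E_def)
  ultimately show ?thesis by (intro LIMSEQ_le_const2) auto
qed

subsection \<open>Independence of future increments\<close>

text \<open>A pi-system generating \<open>G t\<close>. Continuity of the factors keeps the heat
  semigroup applicable later, the almost sure limit admits open half-lines and null sets, and the
  product form gives stability under intersection.\<close>

definition cylinders :: "ennreal \<Rightarrow> 'a set set" where
  "cylinders t = {A\<in>sets M. \<exists>J (g :: nat \<Rightarrow> real \<Rightarrow> real \<Rightarrow> real). finite J \<and> J \<subseteq> {s. 0 \<le> s \<and> ennreal s \<le> t} \<and>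
     (\<forall>k s. continuous_on UNIV (g k s)) \<and> (\<forall>k s x. g k s x \<in> {0..1}) \<and>
     (AE w in M. (\<lambda>k. \<Prod>s\<in>J. g k s (B s w)) \<longlonglongrightarrow> indicator A w)}"

lemma cylindersI:
  fixes g :: "nat \<Rightarrow> real \<Rightarrow> real \<Rightarrow> real"
  assumes "A \<in> sets M" "finite J" "J \<subseteq> {s. 0 \<le> s \<and> ennreal s \<le> t}"
    "\<And>k s. continuous_on UNIV (g k s)" "\<And>k s x. g k s x \<in> {0..1}"
    "AE w in M. (\<lambda>k. \<Prod>s\<in>J. g k s (B s w)) \<longlonglongrightarrow> indicator A w"
  shows "A \<in> cylinders t"
  unfolding cylinders_def
  by (intro CollectI conjI exI[of _ J] exI[of _ g] allI) (use assms in auto)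

lemma cylinders_subset: "cylinders t \<subseteq> Pow (space M)"
  using sets.sets_into_space by (auto simp: cylinders_def)

lemma Int_stable_cylinders: "Int_stable (cylinders t)"
proof (rule Int_stableI)
  fix A1 A2 assume "A1 \<in> cylinders t" "A2 \<in> cylinders t"
  then obtain J1 J2 and g1 g2 :: "nat \<Rightarrow> real \<Rightarrow> real \<Rightarrow> real"
    where 1: "A1 \<in> sets M" "finite J1" "J1 \<subseteq> {s. 0 \<le> s \<and> ennreal s \<le> t}"
      "\<And>k s. continuous_on UNIV (g1 k s)" "\<And>k s x. g1 k s x \<in> {0..1}"
      "AE w in M. (\<lambda>k. \<Prod>s\<in>J1. g1 k s (B s w)) \<longlonglongrightarrow> indicator A1 w"
    and 2: "A2 \<in> sets M" "finite J2" "J2 \<subseteq> {s. 0 \<le> s \<and> ennreal s \<le> t}"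
      "\<And>k s. continuous_on UNIV (g2 k s)" "\<And>k s x. g2 k s x \<in> {0..1}"
      "AE w in M. (\<lambda>k. \<Prod>s\<in>J2. g2 k s (B s w)) \<longlonglongrightarrow> indicator A2 w"
    unfolding cylinders_def by blast
  define g where "g k s x = (if s \<in> J1 then g1 k s x else 1) * (if s \<in> J2 then g2 k s x else 1)" for k s x
  have prod_g: "(\<Prod>s\<in>J1 \<union> J2. g k s (B s w)) = (\<Prod>s\<in>J1. g1 k s (B s w)) * (\<Prod>s\<in>J2. g2 k s (B s w))" for k w
  proof -
    have "(\<Prod>s\<in>J1 \<union> J2. g k s (B s w)) =
        (\<Prod>s\<in>J1 \<union> J2. if s \<in> J1 then g1 k s (B s w) else 1) * (\<Prod>s\<in>J1 \<union> J2. if s \<in> J2 then g2 k s (B s w) else 1)"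
      by (simp add: g_def prod.distrib)
    moreover have "(\<Prod>s\<in>J1 \<union> J2. if s \<in> J1 then g1 k s (B s w) else 1) = (\<Prod>s\<in>J1. g1 k s (B s w))"
      by (rule prod.mono_neutral_cong_right) (use 1 2 in auto)
    moreover have "(\<Prod>s\<in>J1 \<union> J2. if s \<in> J2 then g2 k s (B s w) else 1) = (\<Prod>s\<in>J2. g2 k s (B s w))"
      by (rule prod.mono_neutral_cong_right) (use 1 2 in auto)
    ultimately show ?thesis by simp
  qed
  show "A1 \<inter> A2 \<in> cylinders t"
  proof (rule cylindersI[where J="J1 \<union> J2" and g=g])
    show "continuous_on UNIV (g k s)" for k s
      unfolding g_def using 1(4) 2(4)
      by (cases "s \<in> J1"; cases "s \<in> J2") (auto intro!: continuous_on_mult)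
    show "g k s x \<in> {0..1}" for k s x
      using 1(5)[of k s x] 2(5)[of k s x] by (auto simp: g_def intro: mult_le_one)
    show "AE w in M. (\<lambda>k. \<Prod>s\<in>J1 \<union> J2. g k s (B s w)) \<longlonglongrightarrow> indicator (A1 \<inter> A2) w"
      using 1(6) 2(6)
    proof eventually_elim
      case (elim w)
      from tendsto_mult[OF this] show ?case by (simp add: prod_g indicator_inter_arith)
    qed
  qed (use 1 2 in auto)
qed

text \<open>Ramps of slope \<open>k\<close> starting at \<open>a\<close> increase to the indicator
  of the open half-line.\<close>

lemma greaterThan_in_cylinders:
  assumes s: "0 \<le> s" "ennreal s \<le> t"
  shows "{w\<in>space M. a < B s w} \<in> cylinders t"
proof (rule cylindersI[where J="{s}" and g="\<lambda>k s x. min 1 (max 0 (real k * (x - a)))"])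
  have [measurable]: "B s \<in> borel_measurable M" using random_variable_B[OF s(1)] .
  show "{w\<in>space M. a < B s w} \<in> sets M" by measurable
  have "(\<lambda>k. min 1 (max 0 (real k * (x - a)))) \<longlonglongrightarrow> (if a < x then 1 else 0)" for x
  proof (cases "a < x")
    case True
    have "\<forall>\<^sub>F k in sequentially. min 1 (max 0 (real k * (x - a))) = 1"
    proof -
      obtain K where K: "1 / (x - a) \<le> real K" using real_arch_simple by blast
      show ?thesis
      proof (rule eventually_sequentiallyI)
        fix k assume "K \<le> k"
        then have "1 / (x - a) \<le> real k" using K by linarith
        then have "1 \<le> real k * (x - a)" using True by (simp add: field_simps)
        then show "min 1 (max 0 (real k * (x - a))) = 1" by simp
      qed
    qed
    then show ?thesis using True by (simp add: tendsto_eventually)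
  next
    case False
    then have "min 1 (max 0 (real k * (x - a))) = 0" for k
      using mult_nonneg_nonpos[of "real k" "x - a"] by simp
    then show ?thesis using False by simp
  qed
  note lim = this
  show "AE w in M. (\<lambda>k. \<Prod>s\<in>{s}. min 1 (max 0 (real k * (B s w - a)))) \<longlonglongrightarrow> indicator {w \<in> space M. a < B s w} w"
  proof (rule AE_I2)
    fix w assume "w \<in> space M"
    then have eq: "indicator {w \<in> space M. a < B s w} w = (if a < B s w then 1 else (0::real))"
      by simp
    show "(\<lambda>k. \<Prod>s\<in>{s}. min 1 (max 0 (real k * (B s w - a)))) \<longlonglongrightarrow> indicator {w \<in> space M. a < B s w} w"
      unfolding eq using lim[of "B s w"]
      by (simp only: prod.insert prod.empty finite.emptyI empty_iff not_False_eq_True mult_1_right)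
  qed
qed (use s in \<open>auto intro!: continuous_intros\<close>)

lemma null_sets_in_cylinders:
  assumes "N \<in> null_sets M"
  shows "N \<in> cylinders t"
\<comment> \<open>A zero factor at time 0 is supplied because the empty product would be 1.\<close>
proof (rule cylindersI[where J="{0}" and g="\<lambda>k s x. 0"])
  show "AE w in M. (\<lambda>k. \<Prod>s\<in>{0::real}. 0::real) \<longlonglongrightarrow> indicator N w"
    using AE_not_in[OF assms] by eventually_elim simp
qed (use assms in auto)

lemma sets_G_eq_sigma_cylinders: "sets (G t) \<subseteq> sigma_sets (space M) (cylinders t)"
proof
  let ?S = "sigma (space M) (cylinders t)"
  have S: "sets ?S = sigma_sets (space M) (cylinders t)" "space ?S = space M"
    using cylinders_subset by (auto intro: sets_measure_of space_measure_of)
  have meas: "B s \<in> borel_measurable ?S" if "0 \<le> s" "ennreal s \<le> t" for s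
    unfolding borel_measurable_iff_greater S
    using greaterThan_in_cylinders[OF that] by auto
  fix A assume "A \<in> sets (G t)"
  then have "A \<in> sets ?S"
  proof (induction rule: completed_natural_filtration_induct)
    case (process s U)
    from measurable_sets[OF meas[OF process(1,2)] process(3)] show ?case by (simp add: S)
  next
    case (null N)
    then show ?case using null_sets_in_cylinders[of N] by (auto simp: S)
  next
    case (compl A)
    then show ?case using sets.compl_sets[of A ?S] by (simp add: S)
  next
    case (union A)
    then show ?case by blast
  qed
  then show "A \<in> sigma_sets (space M) (cylinders t)" by (simp add: S)
qed

text \<open>Every \<open>B s\<close> with \<open>s\<close> in \<open>J\<close> is almost surely a
  sum of increments over a partition of \<open>[0, t]\<close>, while \<open>B u - B t\<close> is the
  one increment beyond it; independence of the increments separates them.\<close>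

lemma expectation_prod_increment:
  fixes g :: "real \<Rightarrow> real \<Rightarrow> real"
  assumes J: "finite J" "J \<subseteq> {0..t}" and tu: "0 \<le> t" "t \<le> u"
    and g: "\<And>s. g s \<in> borel_measurable borel" "\<And>s x. g s x \<in> {0..1}" and V: "V \<in> sets borel"
  shows "expectation (\<lambda>w. (\<Prod>s\<in>J. g s (B s w)) * indicator V (B u w - B t w)) =
    expectation (\<lambda>w. \<Prod>s\<in>J. g s (B s w)) * prob {w\<in>space M. B u w - B t w \<in> V}"
proof -
  define l where "l = sorted_list_of_set (insert 0 (insert t J))"
  define n where "n = length l"
  have set_l: "set l = insert 0 (insert t J)" and sorted: "sorted l" and dist: "distinct l"
    using J(1) unfolding l_def
    by (simp_all only: set_sorted_list_of_set sorted_sorted_list_of_set distinct_sorted_list_of_set finite_insert)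
  have n: "n > 0" unfolding n_def using set_l by (cases l) auto
  have l0: "l ! 0 = 0"
  proof -
    obtain i where "i < n" "l ! i = 0" using set_l unfolding n_def by (metis in_set_conv_nth insertI1)
    then have "l ! 0 \<le> 0" using sorted_nth_mono[OF sorted, of 0 i] by (simp add: n_def)
    moreover have "l ! 0 \<in> set l" using n by (auto simp: n_def)
    ultimately show ?thesis using set_l J(2) tu by auto
  qed
  have ln: "l ! (n - 1) = t"
  proof -
    obtain i where "i < n" "l ! i = t" using set_l unfolding n_def by (metis in_set_conv_nth insertCI)
    then have "t \<le> l ! (n - 1)" using sorted_nth_mono[OF sorted, of i "n - 1"] by (simp add: n_def)
    moreover have "l ! (n - 1) \<in> set l" using n by (auto simp: n_def)
    ultimately show ?thesis using set_l J(2) tu by auto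
  qed
  \<comment> \<open>Index \<open>n\<close> stands for the extra time \<open>u\<close>, so that
    increment \<open>n - 1\<close> is \<open>B u - B t\<close>.\<close>
  define v where "v i = (if i < n then l ! i else u)" for i
  define X where "X i w = B (v (Suc i)) w - B (v i) w" for i w
  have v0: "v 0 = 0" using l0 n by (simp add: v_def)
  have vmono: "v i \<le> v (Suc i)" if "i < n" for i
  proof (cases "Suc i < n")
    case True
    then show ?thesis using sorted_nth_mono[OF sorted, of i "Suc i"] by (simp add: v_def n_def)
  next
    case False
    then have "i = n - 1" using that by simp
    then show ?thesis using ln tu n by (simp add: v_def)
  qed
  have ind: "indep_vars (\<lambda>_. borel) X {..<n}"
    unfolding X_def by (rule indep_increments) (use v0 vmono in auto)
  have Xlast: "X (n - 1) w = B u w - B t w" for w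
    using n ln by (simp add: X_def v_def)
  have sumX: "(\<Sum>j<i. X j w) = B (v i) w - B 0 w" for i w
    unfolding X_def using sum_lessThan_telescope[of "\<lambda>i. B (v i) w" i] v0 by simp
  have "\<forall>s\<in>J. \<exists>i<n. l ! i = s"
    using set_l unfolding n_def by (metis in_set_conv_nth insertCI)
  then obtain idx where idx: "\<And>s. s \<in> J \<Longrightarrow> idx s < n" "\<And>s. s \<in> J \<Longrightarrow> l ! idx s = s" by metis
  \<comment> \<open>\<open>F\<close> rebuilds the product from the first \<open>n - 1\<close>
    increments, with \<open>B 0\<close> still subtracted; \<open>start_B\<close> removes it at the
    end.\<close>
  define F where "F x = (\<Prod>s\<in>J. g s (\<Sum>j<idx s. x j))" for x :: "nat \<Rightarrow> real"
  have Fm: "F \<in> borel_measurable (Pi\<^sub>M {..<n - 1} (\<lambda>_. borel))"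
    unfolding F_def
  proof (intro borel_measurable_prod)
    fix s assume "s \<in> J"
    then have "idx s \<le> n - 1" using idx(1)[of s] by simp
    then have "(\<lambda>x. \<Sum>j<idx s. x j) \<in> borel_measurable (Pi\<^sub>M {..<n - 1} (\<lambda>_. borel :: real measure))"
      by (intro borel_measurable_sum measurable_component_singleton) auto
    from measurable_compose[OF this g(1)[of s]]
    show "(\<lambda>x. g s (\<Sum>j<idx s. x j)) \<in> borel_measurable (Pi\<^sub>M {..<n - 1} (\<lambda>_. borel))" .
  qed
  have "indep_var borel (F \<circ> (\<lambda>w. restrict (\<lambda>i. X i w) {..<n - 1})) borel
      ((\<lambda>x. indicator V (x (n - 1)) :: real) \<circ> (\<lambda>w. restrict (\<lambda>i. X i w) {n - 1}))"
    by (rule indep_var_compose[OF indep_var_restrict[OF ind] Fm]) (use n V in auto)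
  moreover have "F \<circ> (\<lambda>w. restrict (\<lambda>i. X i w) {..<n - 1}) = (\<lambda>w. \<Prod>s\<in>J. g s (B s w - B 0 w))"
  proof
    fix w
    have "(\<Sum>j<idx s. restrict (\<lambda>i. X i w) {..<n - 1} j) = B s w - B 0 w" if "s \<in> J" for s
    proof -
      have "(\<Sum>j<idx s. restrict (\<lambda>i. X i w) {..<n - 1} j) = (\<Sum>j<idx s. X j w)"
        using idx(1)[OF that] by (intro sum.cong) auto
      then show ?thesis using idx[OF that] by (simp add: sumX v_def)
    qed
    then show "(F \<circ> (\<lambda>w. restrict (\<lambda>i. X i w) {..<n - 1})) w = (\<Prod>s\<in>J. g s (B s w - B 0 w))"
      unfolding F_def o_def by (intro prod.cong) auto
  qed
  moreover have "(\<lambda>x. indicator V (x (n - 1)) :: real) \<circ> (\<lambda>w. restrict (\<lambda>i. X i w) {n - 1}) =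
      (\<lambda>w. indicator V (B u w - B t w))"
    using Xlast by (simp add: o_def)
  ultimately have iv: "indep_var borel (\<lambda>w. \<Prod>s\<in>J. g s (B s w - B 0 w)) borel (\<lambda>w. indicator V (B u w - B t w) :: real)"
    by simp
  have [measurable]: "B u \<in> borel_measurable M" "B t \<in> borel_measurable M" "B 0 \<in> borel_measurable M"
    using random_variable_B tu by auto
  have Bs: "B s \<in> borel_measurable M" if "s \<in> J" for s using random_variable_B J that by auto
  have m1: "(\<lambda>w. \<Prod>s\<in>J. g s (B s w - B 0 w)) \<in> borel_measurable M"
    by (intro borel_measurable_prod measurable_compose[OF _ g(1)]) (use Bs in measurable)
  have m2: "(\<lambda>w. \<Prod>s\<in>J. g s (B s w)) \<in> borel_measurable M"
    by (intro borel_measurable_prod measurable_compose[OF _ g(1)]) (use Bs in measurable)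
  have m3: "(\<lambda>w. indicator V (B u w - B t w) :: real) \<in> borel_measurable M"
    using V by measurable
  have b: "norm (\<Prod>s\<in>J. g s (f s)) \<le> 1" for f
    unfolding prod_norm[symmetric] using g(2) by (intro prod_le_1) auto
  have i1: "integrable M (\<lambda>w. \<Prod>s\<in>J. g s (B s w - B 0 w))"
    by (rule integrable_const_bound[where B=1]) (use m1 b in auto)
  have i3: "integrable M (\<lambda>w. indicator V (B u w - B t w) :: real)"
    by (rule integrable_const_bound[where B=1]) (use m3 in auto)
  have ae: "AE w in M. (\<Prod>s\<in>J. g s (B s w - B 0 w)) = (\<Prod>s\<in>J. g s (B s w))"
    using start_B by eventually_elim simp
  have "expectation (\<lambda>w. (\<Prod>s\<in>J. g s (B s w)) * indicator V (B u w - B t w)) =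
      expectation (\<lambda>w. (\<Prod>s\<in>J. g s (B s w - B 0 w)) * indicator V (B u w - B t w))"
    using ae m1 m2 m3 by (intro integral_cong_AE) (auto elim!: eventually_mono)
  also have "\<dots> = expectation (\<lambda>w. \<Prod>s\<in>J. g s (B s w - B 0 w)) * expectation (\<lambda>w. indicator V (B u w - B t w))"
    by (rule indep_var_lebesgue_integral[OF iv i1 i3])
  also have "expectation (\<lambda>w. \<Prod>s\<in>J. g s (B s w - B 0 w)) = expectation (\<lambda>w. \<Prod>s\<in>J. g s (B s w))"
    using ae m1 m2 by (intro integral_cong_AE) auto
  also have "expectation (\<lambda>w. indicator V (B u w - B t w)) = expectation (indicator {w\<in>space M. B u w - B t w \<in> V})"
    by (intro Bochner_Integration.integral_cong) (auto simp: indicator_def)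
  also have "\<dots> = prob {w\<in>space M. B u w - B t w \<in> V}"
    by simp (rule arg_cong[where f=prob], auto)
  finally show ?thesis .
qed

lemma indep_set_cylinders_increment:
  assumes tu: "0 \<le> t" "t \<le> u"
  shows "indep_set (cylinders (ennreal t)) {(\<lambda>w. B u w - B t w) -` V \<inter> space M | V. V \<in> sets borel}"
proof (rule indep_setI)
  have [measurable]: "B u \<in> borel_measurable M" "B t \<in> borel_measurable M"
    using random_variable_B tu by auto
  show "cylinders (ennreal t) \<subseteq> events" by (auto simp: cylinders_def)
  show "{(\<lambda>w. B u w - B t w) -` V \<inter> space M | V. V \<in> sets borel} \<subseteq> events"
    by (auto intro!: measurable_sets[of _ M borel])
  fix A C assume A: "A \<in> cylinders (ennreal t)" and "C \<in> {(\<lambda>w. B u w - B t w) -` V \<inter> space M | V. V \<in> sets borel}"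
  then obtain V where V: "V \<in> sets borel" and "C = (\<lambda>w. B u w - B t w) -` V \<inter> space M" by auto
  then have C: "C = {w\<in>space M. B u w - B t w \<in> V}" by auto
  have CM: "C \<in> sets M" unfolding C using V by measurable
  obtain J and g :: "nat \<Rightarrow> real \<Rightarrow> real \<Rightarrow> real"
    where AM: "A \<in> sets M" and J: "finite J" "J \<subseteq> {s. 0 \<le> s \<and> ennreal s \<le> ennreal t}"
      and g: "\<And>k s. continuous_on UNIV (g k s)" "\<And>k s x. g k s x \<in> {0..1}"
      and lim: "AE w in M. (\<lambda>k. \<Prod>s\<in>J. g k s (B s w)) \<longlonglongrightarrow> indicator A w"
    using A unfolding cylinders_def by blast
  have gm: "g k s \<in> borel_measurable borel" for k s using g(1) by (rule borel_measurable_continuous_onI)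
  have J': "J \<subseteq> {0..t}" using J tu by (auto simp: ennreal_le_iff)
  have Bs: "B s \<in> borel_measurable M" if "s \<in> J" for s using random_variable_B J that by auto
  have m2: "(\<lambda>w. \<Prod>s\<in>J. g k s (B s w)) \<in> borel_measurable M" for k
    by (intro borel_measurable_prod measurable_compose[OF _ gm] Bs)
  have m3: "(\<lambda>w. indicator V (B u w - B t w) :: real) \<in> borel_measurable M"
    using V by measurable
  have b: "norm (\<Prod>s\<in>J. g k s (f s)) \<le> 1" for f k
    unfolding prod_norm[symmetric] using g(2) by (intro prod_le_1) auto
  have "(\<lambda>k. expectation (\<lambda>w. \<Prod>s\<in>J. g k s (B s w))) \<longlonglongrightarrow> expectation (indicator A)"
    by (rule integral_dominated_convergence[where w="\<lambda>_. 1"]) (use m2 AM lim b in auto)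
  then have l1: "(\<lambda>k. expectation (\<lambda>w. \<Prod>s\<in>J. g k s (B s w)) * prob C) \<longlonglongrightarrow> prob A * prob C"
    using AM by (intro tendsto_mult) auto
  have "(\<lambda>k. expectation (\<lambda>w. (\<Prod>s\<in>J. g k s (B s w)) * indicator V (B u w - B t w)))
     \<longlonglongrightarrow> expectation (\<lambda>w. indicator A w * indicator V (B u w - B t w))"
  proof (rule integral_dominated_convergence[where w="\<lambda>_. 1"])
    show "AE w in M. (\<lambda>k. (\<Prod>s\<in>J. g k s (B s w)) * indicator V (B u w - B t w)) \<longlonglongrightarrow> indicator A w * indicator V (B u w - B t w)"
      using lim by eventually_elim (rule tendsto_mult_right)
    show "AE w in M. norm ((\<Prod>s\<in>J. g k s (B s w)) * indicator V (B u w - B t w)) \<le> 1" for k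
      using b[of k] by (auto simp: indicator_def)
  qed (use m2 m3 AM in auto)
  also have "(\<lambda>w. indicator A w * indicator V (B u w - B t w)) = (\<lambda>w. indicator A w * indicator {w. B u w - B t w \<in> V} w :: real)"
    by (auto simp: indicator_def)
  also have "expectation \<dots> = expectation (indicator (A \<inter> C))"
    using sets.sets_into_space[OF AM]
    by (intro Bochner_Integration.integral_cong) (auto simp: indicator_def C)
  also have "\<dots> = prob (A \<inter> C)" using AM CM by simp
  finally show "prob (A \<inter> C) = prob A * prob C"
    using l1 expectation_prod_increment[OF J(1) J' tu gm g(2) V, folded C] LIMSEQ_unique by auto
qed

text \<open>Pi-system argument from \<open>cylinders\<close>. The increment passes through
  \<open>f\<close> into a space \<open>K\<close> so that it can be given the value type of
  \<open>X\<close>.\<close>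

lemma indep_var_increment:
  assumes tu: "0 \<le> t" "t \<le> u" and X: "X \<in> measurable (G (ennreal t)) N"
    and f[measurable]: "f \<in> measurable borel K"
  shows "indep_var N X K (\<lambda>w. f (B u w - B t w))"
proof -
  let ?W = "{(\<lambda>w. B u w - B t w) -` V \<inter> space M | V. V \<in> sets (borel :: real measure)}"
  have [measurable]: "B u \<in> borel_measurable M" "B t \<in> borel_measurable M"
    using random_variable_B tu by auto
  have "indep_set (sigma_sets (space M) (cylinders (ennreal t))) (sigma_sets (space M) ?W)"
  proof (rule indep_set_sigma_sets[OF indep_set_cylinders_increment[OF tu] Int_stable_cylinders])
    show "Int_stable ?W"
    proof (rule Int_stableI)
      fix a b assume "a \<in> ?W" "b \<in> ?W"
      then obtain V1 V2 where "V1 \<in> sets borel" "V2 \<in> sets borel"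
        "a = (\<lambda>w. B u w - B t w) -` V1 \<inter> space M" "b = (\<lambda>w. B u w - B t w) -` V2 \<inter> space M" by auto
      then show "a \<inter> b \<in> ?W" by (intro CollectI exI[of _ "V1 \<inter> V2"]) auto
    qed
  qed
  moreover have "sigma_sets (space M) {X -` A \<inter> space M | A. A \<in> sets N} \<subseteq> sigma_sets (space M) (cylinders (ennreal t))"
  proof (rule sigma_sets_mono)
    show "{X -` A \<inter> space M | A. A \<in> sets N} \<subseteq> sigma_sets (space M) (cylinders (ennreal t))"
      using measurable_sets[OF X] sets_G_eq_sigma_cylinders by fastforce
  qed
  moreover have "sigma_sets (space M) {(\<lambda>w. f (B u w - B t w)) -` A \<inter> space M | A. A \<in> sets K} \<subseteq> sigma_sets (space M) ?W"
  proof (rule sigma_sets_mono, safe)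
    fix A assume "A \<in> sets K"
    then have "f -` A \<in> sets borel" using measurable_sets[OF f, of A] by simp
    moreover have "(\<lambda>w. f (B u w - B t w)) -` A \<inter> space M = (\<lambda>w. B u w - B t w) -` (f -` A) \<inter> space M" by auto
    ultimately show "(\<lambda>w. f (B u w - B t w)) -` A \<inter> space M \<in> sigma_sets (space M) ?W" by blast
  qed
  ultimately have "indep_set (sigma_sets (space M) {X -` A \<inter> space M | A. A \<in> sets N})
      (sigma_sets (space M) {(\<lambda>w. f (B u w - B t w)) -` A \<inter> space M | A. A \<in> sets K})"
    unfolding indep_set_def by (elim indep_sets_mono_sets) (auto split: bool.split)
  then show ?thesis
    unfolding indep_var_eq using measurable_G_in_M[OF X] by simp
qed

lemma prob_Int_increment:
  assumes tu: "0 \<le> t" "t \<le> u" and A: "A \<in> sets (G (ennreal t))" and V: "V \<in> sets borel"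
  shows "prob (A \<inter> {w\<in>space M. B u w - B t w \<in> V}) = prob A * prob {w\<in>space M. B u w - B t w \<in> V}"
proof -
  have "(\<lambda>w. indicator A w :: real) \<in> measurable (G (ennreal t)) borel" using A by measurable
  from indep_varD[OF indep_var_increment[OF tu this measurable_ident], of "{1}" V] V
  have "prob ((\<lambda>x. (indicator A x :: real, B u x - B t x)) -` ({1} \<times> V) \<inter> space M) =
    prob ((indicator A :: _ \<Rightarrow> real) -` {1} \<inter> space M) * prob ((\<lambda>w. B u w - B t w) -` V \<inter> space M)" by simp
  moreover have "(\<lambda>x. (indicator A x :: real, B u x - B t x)) -` ({1} \<times> V) \<inter> space M = A \<inter> {w\<in>space M. B u w - B t w \<in> V}"
    using sets.sets_into_space[OF A] by (auto simp: indicator_def split: if_splits)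
  moreover have "(indicator A :: _ \<Rightarrow> real) -` {1} \<inter> space M = A"
    using sets.sets_into_space[OF A] by (auto simp: indicator_def split: if_splits)
  moreover have "(\<lambda>w. B u w - B t w) -` V \<inter> space M = {w\<in>space M. B u w - B t w \<in> V}" by auto
  ultimately show ?thesis by simp
qed

end

subsection \<open>Continuous versions of Brownian martingales\<close>

text \<open>The approximation is strictly from the right: this also works at 0, and identities known
  only at rational times after a random time extend to that time.\<close>

lemma Rats_sequence_above_continuous:
  fixes h :: "real \<Rightarrow> 'b::topological_space"
  assumes h: "continuous_on {0..} h" and t: "0 \<le> t"
  obtains q where "\<And>k. q k \<in> \<rat>" "\<And>k. t < q k" "q \<longlonglongrightarrow> t" "(\<lambda>k. h (q k)) \<longlonglongrightarrow> h t"
proof -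
  have "\<exists>q\<in>\<rat>. t < q \<and> q < t + 1 / real (Suc k)" for k
    by (rule Rats_dense_in_real) simp
  then obtain q where qk: "\<And>k. q k \<in> \<rat>" "\<And>k. t < q k" "\<And>k. q k < t + 1 / real (Suc k)" by metis
  have "(\<lambda>k. t + 1 / real (Suc k)) \<longlonglongrightarrow> t + 0"
    by (intro tendsto_add tendsto_const LIMSEQ_Suc[OF lim_1_over_n])
  then have "q \<longlonglongrightarrow> t"
    using qk by (intro real_tendsto_sandwich[OF _ _ tendsto_const, of t q]) (auto intro!: always_eventually less_imp_le simp del: of_nat_Suc)
  moreover then have "(\<lambda>k. h (q k)) \<longlonglongrightarrow> h t"
    using order_trans[OF t less_imp_le[OF qk(2)]] t
    by (intro continuous_on_tendsto_compose[OF h]) auto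
  ultimately show thesis using qk that by blast
qed

lemma countable_Rats_Int: "countable (\<rat> \<inter> A :: real set)"
  using countable_rat by (rule countable_subset[rotated]) auto

lemma continuous_on_atLeast_Rats_closed:
  fixes h :: "real \<Rightarrow> 'b::metric_space"
  assumes h: "continuous_on {0..} h" and C: "closed C"
    and q: "\<And>q. q \<in> \<rat> \<Longrightarrow> 0 \<le> q \<Longrightarrow> h q \<in> C" and t: "0 \<le> t"
  shows "h t \<in> C"
proof -
  from Rats_sequence_above_continuous[OF h t] obtain q
    where qk: "\<And>k. q k \<in> \<rat>" "\<And>k. t < q k" and "(\<lambda>k. h (q k)) \<longlonglongrightarrow> h t" by metis
  moreover have "h (q k) \<in> C" for k
    using qk(1,2)[of k] t by (intro q) auto
  ultimately show ?thesis using closed_sequentially[OF C, of "\<lambda>k. h (q k)"] by blast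
qed

context complete_brownian_motion
begin

text \<open>Continuity is demanded of every path, without exceptional set, so that hitting times can
  be treated pathwise; the link with the conditional expectation is almost sure at each fixed
  time.\<close>

definition cont_version :: "('a \<Rightarrow> real) \<Rightarrow> (real \<Rightarrow> 'a \<Rightarrow> real) \<Rightarrow> bool" where
  "cont_version Y N \<longleftrightarrow> (\<forall>w. continuous_on {0..} (\<lambda>t. N t w)) \<and>
     (\<forall>t\<ge>0. N t \<in> borel_measurable (G (ennreal t))) \<and> (\<forall>t\<ge>0. AE w in M. N t w = cexp t Y w)"

definition has_cont_version :: "('a \<Rightarrow> real) \<Rightarrow> bool" where
  "has_cont_version Y \<longleftrightarrow> integrable M Y \<and> (\<exists>N. cont_version Y N)"

lemma cont_versionD:
  assumes "cont_version Y N"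
  shows "continuous_on {0..} (\<lambda>t. N t w)" "0 \<le> t \<Longrightarrow> N t \<in> borel_measurable (G (ennreal t))"
    "0 \<le> t \<Longrightarrow> AE w in M. N t w = cexp t Y w"
  using assms by (auto simp: cont_version_def)

lemma has_cont_version_cong_AE:
  assumes Y: "has_cont_version Y" and eq: "AE w in M. Y w = Y' w"
  shows "has_cont_version Y'"
proof -
  from Y obtain N where i: "integrable M Y" and N: "cont_version Y N"
    by (auto simp: has_cont_version_def)
  have m: "Y' \<in> borel_measurable M" by (rule borel_measurable_AE_cong[OF _ eq]) (use i in auto)
  have "integrable M Y'" by (rule integrable_cong_AE_imp[OF i m eq])
  moreover have "AE w in M. N t w = cexp t Y' w" if "0 \<le> t" for t
    using G.real_cond_exp_cong[OF eq borel_measurable_integrable[OF i] m, of "ennreal t"]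
      cont_versionD(3)[OF N that]
    by eventually_elim simp
  ultimately show ?thesis
    using N unfolding has_cont_version_def cont_version_def by blast
qed

lemma has_cont_version_const: "has_cont_version (\<lambda>_. c)"
proof -
  have "AE w in M. c = cexp t (\<lambda>_. c) w" for t
  proof -
    have "AE w in M. cexp t (\<lambda>_. c) w = c" by (rule G.real_cond_exp_F_meas) auto
    then show ?thesis by eventually_elim simp
  qed
  then have "cont_version (\<lambda>_. c) (\<lambda>_ _. c)"
    unfolding cont_version_def by auto
  then show ?thesis unfolding has_cont_version_def by auto
qed

lemma has_cont_version_add:
  assumes "has_cont_version Y1" "has_cont_version Y2"
  shows "has_cont_version (\<lambda>w. Y1 w + Y2 w)"
proof -
  from assms obtain N1 N2 where i: "integrable M Y1" "integrable M Y2"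
    and N: "cont_version Y1 N1" "cont_version Y2 N2"
    by (auto simp: has_cont_version_def)
  have "AE w in M. N1 t w + N2 t w = cexp t (\<lambda>w. Y1 w + Y2 w) w" if "0 \<le> t" for t
    using G.real_cond_exp_add[OF i, of "ennreal t"] cont_versionD(3)[OF N(1) that]
      cont_versionD(3)[OF N(2) that]
    by eventually_elim simp
  then have "cont_version (\<lambda>w. Y1 w + Y2 w) (\<lambda>t w. N1 t w + N2 t w)"
    using N unfolding cont_version_def
    by (auto intro!: continuous_on_add borel_measurable_add)
  then show ?thesis unfolding has_cont_version_def using i by auto
qed

lemma has_cont_version_cmult:
  assumes "has_cont_version Y"
  shows "has_cont_version (\<lambda>w. c * Y w)"
proof -
  from assms obtain N where i: "integrable M Y" and N: "cont_version Y N"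
    by (auto simp: has_cont_version_def)
  have "AE w in M. c * N t w = cexp t (\<lambda>w. c * Y w) w" if "0 \<le> t" for t
    using G.real_cond_exp_cmult[OF i, of "ennreal t" c] cont_versionD(3)[OF N that]
    by eventually_elim simp
  then have "cont_version (\<lambda>w. c * Y w) (\<lambda>t w. c * N t w)"
    using N unfolding cont_version_def by (auto intro!: continuous_intros)
  then show ?thesis unfolding has_cont_version_def using i by auto
qed

lemma has_cont_version_sum:
  "(\<And>i. i \<in> I \<Longrightarrow> has_cont_version (Y i)) \<Longrightarrow> has_cont_version (\<lambda>w. \<Sum>i\<in>I. Y i w)"
  by (induction I rule: infinite_finite_induct)
     (auto intro: has_cont_version_const has_cont_version_add)

lemma expectation_abs_cexp_le:
  assumes "integrable M Y"
  shows "expectation (\<lambda>w. \<bar>cexp t Y w\<bar>) \<le> expectation (\<lambda>w. \<bar>Y w\<bar>)"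
  using set_integral_abs_cexp_le[OF assms sets.top, of t]
  by (simp add: set_integral_space assms G.real_cond_exp_int(1))

text \<open>Along a subsequence with error \<open>(1/4) ^ n\<close>, the maximal inequality makes
  increments beyond \<open>(1/2) ^ n\<close> have summable probability. By Borel-Cantelli the
  versions converge uniformly on the half-line, which preserves continuity.\<close>

lemma has_cont_version_L1_limit:
  assumes Y: "\<And>n. has_cont_version (Y n)" and Yi: "integrable M Y'"
    and lim: "(\<lambda>n. expectation (\<lambda>w. \<bar>Y n w - Y' w\<bar>)) \<longlonglongrightarrow> 0"
  shows "has_cont_version Y'"
proof -
  have "\<exists>m. expectation (\<lambda>w. \<bar>Y m w - Y' w\<bar>) < (1/4) ^ n" for n
    using order_tendstoD(2)[OF lim, of "(1/4) ^ n"] eventually_happens'[OF sequentially_bot] by auto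
  then obtain r where r: "\<And>n. expectation (\<lambda>w. \<bar>Y (r n) w - Y' w\<bar>) < (1/4) ^ n" by metis
  define Z where "Z n = Y (r n)" for n
  have Zi: "integrable M (Z n)" for n using Y by (auto simp: Z_def has_cont_version_def)
  have Zd: "expectation (\<lambda>w. \<bar>Z n w - Y' w\<bar>) \<le> (1/4) ^ n" for n
    using r[of n] by (simp add: Z_def)
  have "\<forall>n. \<exists>N. cont_version (Z n) N" using Y by (auto simp: Z_def has_cont_version_def)
  then obtain N where N: "\<And>n. cont_version (Z n) (N n)" by metis
  note Nc = cont_versionD(1)[OF N] and Nm = cont_versionD(2)[OF N] and Ne = cont_versionD(3)[OF N]
  have Nd: "AE w in M. N (Suc n) t w - N n t w = cexp t (\<lambda>w. Z (Suc n) w - Z n w) w" if "0 \<le> t" for n t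
    using G.real_cond_exp_diff[OF Zi[of "Suc n"] Zi[of n], of "ennreal t"] Ne[OF that, of n] Ne[OF that, of "Suc n"]
    by eventually_elim simp
  let ?Q = "\<rat> \<inter> {0::real..}"
  define E where "E n = {w\<in>space M. \<exists>q\<in>?Q. \<bar>N (Suc n) q w - N n q w\<bar> > (1/2) ^ n}" for n
  have Q: "countable ?Q" by (rule countable_Rats_Int)
  have EM: "E n \<in> sets M" for n
  proof -
    have "E n = (\<Union>q\<in>?Q. {w\<in>space M. \<bar>N (Suc n) q w - N n q w\<bar> > (1/2) ^ n})" by (auto simp: E_def)
    also have "\<dots> \<in> sets M"
    proof (rule sets.countable_UN''[OF Q])
      fix q :: real assume "q \<in> ?Q"
      then have [measurable]: "N m q \<in> borel_measurable M" for m using Nm[of q m] measurable_G_in_M by auto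
      show "{w\<in>space M. \<bar>N (Suc n) q w - N n q w\<bar> > (1/2) ^ n} \<in> sets M" by measurable
    qed
    finally show ?thesis .
  qed
  have Ep: "prob (E n) \<le> 2 * (1/2) ^ n" for n
  proof -
    have "prob (E n) \<le> expectation (\<lambda>w. \<bar>Z (Suc n) w - Z n w\<bar>) / (1/2) ^ n"
      unfolding E_def
    proof (rule maximal_inequality[OF _ Q])
      show "integrable M (\<lambda>w. Z (Suc n) w - Z n w)" using Zi by auto
      fix t assume t: "t \<in> ?Q"
      have [measurable]: "N m t \<in> borel_measurable (G (ennreal t))" for m using Nm t by auto
      show "(\<lambda>w. N (Suc n) t w - N n t w) \<in> borel_measurable (G (ennreal t))" by measurable
      show "AE w in M. N (Suc n) t w - N n t w = cexp t (\<lambda>w. Z (Suc n) w - Z n w) w"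
        by (rule Nd) (use t in auto)
    qed auto
    also have "expectation (\<lambda>w. \<bar>Z (Suc n) w - Z n w\<bar>) \<le> expectation (\<lambda>w. \<bar>Z (Suc n) w - Y' w\<bar> + \<bar>Z n w - Y' w\<bar>)"
      using Zi Yi by (intro integral_mono) auto
    also have "\<dots> = expectation (\<lambda>w. \<bar>Z (Suc n) w - Y' w\<bar>) + expectation (\<lambda>w. \<bar>Z n w - Y' w\<bar>)"
      using Zi Yi by (intro Bochner_Integration.integral_add) auto
    also have "\<dots> \<le> (1/4) ^ Suc n + (1/4) ^ n"
      by (intro add_mono Zd)
    also have "\<dots> \<le> 2 * (1/4) ^ n" by simp
    also have "2 * (1/4) ^ n / (1/2) ^ n = 2 * ((1/2) ^ n :: real)"
      by (simp add: field_simps flip: power_mult_distrib)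
    finally show ?thesis by (simp add: divide_right_mono)
  qed
  have "AE w in M. eventually (\<lambda>n. w \<in> space M - E n) sequentially"
  proof (rule borel_cantelli_AE1)
    show "summable (\<lambda>n. prob (E n))"
      by (rule summable_comparison_test'[of "\<lambda>n. 2 * (1/2) ^ n" 0]) (use Ep in \<open>auto intro!: summable_mult summable_geometric\<close>)
  qed (use EM in \<open>auto simp: emeasure_eq_measure\<close>)
  define W where "W = {w. \<forall>\<^sub>F n in sequentially. \<forall>t\<ge>0. \<bar>N (Suc n) t w - N n t w\<bar> \<le> (1/2) ^ n}"
  have AEW: "AE w in M. w \<in> W"
    using \<open>AE w in M. eventually (\<lambda>n. w \<in> space M - E n) sequentially\<close>
  proof eventually_elim
    case (elim w)
    show ?case unfolding W_def mem_Collect_eq using elim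
    proof eventually_elim
      case (elim n)
      show ?case
      proof (intro allI impI)
        fix t :: real assume t: "0 \<le> t"
        have "N (Suc n) t w - N n t w \<in> {- ((1/2) ^ n)..(1/2) ^ n}"
        proof (rule continuous_on_atLeast_Rats_closed[where h="\<lambda>t. N (Suc n) t w - N n t w", OF _ _ _ t])
          show "continuous_on {0..} (\<lambda>t. N (Suc n) t w - N n t w)"
            by (intro continuous_intros Nc)
          fix q :: real assume "q \<in> \<rat>" "0 \<le> q"
          then have "\<bar>N (Suc n) q w - N n q w\<bar> \<le> (1/2) ^ n" using elim by (force simp: E_def not_less)
          then show "N (Suc n) q w - N n q w \<in> {- ((1/2) ^ n)..(1/2) ^ n}" by (auto simp: abs_le_iff)
        qed auto
        then show "\<bar>N (Suc n) t w - N n t w\<bar> \<le> (1/2) ^ n" by (auto simp: abs_le_iff)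
      qed
    qed
  qed
  define L where "L t w = N 0 t w + (\<Sum>i. N (Suc i) t w - N i t w)" for t w
  have uL: "uniform_limit {0..} (\<lambda>n t. N n t w) (\<lambda>t. L t w) sequentially" if "w \<in> W" for w
  proof -
    have "uniform_limit {0..} (\<lambda>n t. \<Sum>i<n. N (Suc i) t w - N i t w) (\<lambda>t. \<Sum>i. N (Suc i) t w - N i t w) sequentially"
      by (rule Weierstrass_m_test_ev[where M="\<lambda>n. (1/2) ^ n"])
         (use that in \<open>auto simp: W_def atLeast_def intro!: summable_geometric elim!: eventually_mono\<close>)
    then have "uniform_limit {0..} (\<lambda>n t. N 0 t w + (\<Sum>i<n. N (Suc i) t w - N i t w)) (\<lambda>t. L t w) sequentially"
      unfolding L_def by (intro uniform_limit_add uniform_limit_const)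
    moreover have "N 0 t w + (\<Sum>i<n. N (Suc i) t w - N i t w) = N n t w" for n t
      using sum_lessThan_telescope[of "\<lambda>i. N i t w" n] by simp
    ultimately show ?thesis by simp
  qed
  \<comment> \<open>Outside the full set \<open>W\<close> the zero path keeps continuity for every
    \<open>w\<close>; adaptedness survives because null sets belong to each
    \<open>G t\<close>.\<close>
  define N' where "N' t w = (if w \<in> W then L t w else 0)" for t w
  have tendsto: "(\<lambda>n. N n t w) \<longlonglongrightarrow> N' t w" if "w \<in> W" "0 \<le> t" for t w
    using tendsto_uniform_limitI[OF uL[OF that(1)], of t] that by (simp add: N'_def)
  have "cont_version Y' N'"
    unfolding cont_version_def
  proof (intro conjI allI impI)
    fix w show "continuous_on {0..} (\<lambda>t. N' t w)"
    proof (cases "w \<in> W")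
      case True
      have "continuous_on {0..} (\<lambda>t. L t w)"
        by (rule uniform_limit_theorem[OF _ uL[OF True]]) (use Nc in auto)
      then show ?thesis using True by (simp add: N'_def)
    qed (simp add: N'_def)
  next
    fix t :: real assume t: "0 \<le> t"
    have [measurable]: "N n t \<in> borel_measurable (G (ennreal t))" for n by (rule Nm[OF t])
    show "N' t \<in> borel_measurable (G (ennreal t))"
    proof (rule borel_measurable_completed_natural_filtration_AE_cong)
      show "(\<lambda>w. lim (\<lambda>n. N n t w)) \<in> borel_measurable (G (ennreal t))" by measurable
      show "AE w in M. lim (\<lambda>n. N n t w) = N' t w"
        using AEW by eventually_elim (simp add: limI tendsto t)
    qed
    \<comment> \<open>The limit is identified by contractivity: the conditional expectations of
      \<open>Z n - Y'\<close> tend to 0 in mean, hence almost surely along a subsequence.\<close>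
    let ?D = "\<lambda>n w. cexp t (\<lambda>w. Z n w - Y' w) w"
    have Di: "integrable M (?D n)" for n using Zi Yi by (intro G.real_cond_exp_int(1)) auto
    have "(\<lambda>n. expectation (\<lambda>w. norm (?D n w))) \<longlonglongrightarrow> 0"
    proof (rule tendsto_sandwich[where f="\<lambda>_. 0" and h="\<lambda>n. (1/4) ^ n"])
      show "\<forall>\<^sub>F n in sequentially. expectation (\<lambda>w. norm (?D n w)) \<le> (1/4) ^ n"
      proof (rule always_eventually, rule)
        fix n
        have "expectation (\<lambda>w. \<bar>?D n w\<bar>) \<le> expectation (\<lambda>w. \<bar>Z n w - Y' w\<bar>)"
          by (rule expectation_abs_cexp_le) (use Zi Yi in auto)
        then show "expectation (\<lambda>w. norm (?D n w)) \<le> (1/4) ^ n" using Zd[of n] by simp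
      qed
    qed (auto intro!: LIMSEQ_realpow_zero)
    then obtain \<rho> :: "nat \<Rightarrow> nat" where \<rho>: "strict_mono \<rho>" "AE w in M. (\<lambda>n. ?D (\<rho> n) w) \<longlonglongrightarrow> 0"
      using tendsto_L1_AE_subseq[of M ?D, OF Di] by blast
    have "AE w in M. \<forall>n. ?D n w = N n t w - cexp t Y' w"
      unfolding AE_all_countable
    proof
      fix n show "AE w in M. ?D n w = N n t w - cexp t Y' w"
        using G.real_cond_exp_diff[OF Zi[of n] Yi, of "ennreal t"] Ne[OF t, of n] by eventually_elim simp
    qed
    with AEW \<rho>(2) show "AE w in M. N' t w = cexp t Y' w"
    proof eventually_elim
      case (elim w)
      have "(\<lambda>n. N (\<rho> n) t w) \<longlonglongrightarrow> N' t w"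
        using LIMSEQ_subseq_LIMSEQ[OF tendsto[OF elim(1) t] \<rho>(1)] by (simp add: o_def)
      moreover have "(\<lambda>n. N (\<rho> n) t w) \<longlonglongrightarrow> cexp t Y' w"
        using elim(2,3) by (simp add: LIM_zero_iff)
      ultimately show ?case by (rule LIMSEQ_unique)
    qed
  qed
  then show ?thesis using Yi by (auto simp: has_cont_version_def)
qed

text \<open>Dominated convergence turns bounded almost sure convergence into convergence in
  mean.\<close>

lemma has_cont_version_bounded_limit:
  assumes Y: "\<And>n. has_cont_version (Y n)" and b: "\<And>n w. w \<in> space M \<Longrightarrow> \<bar>Y n w\<bar> \<le> c"
    and lim: "AE w in M. (\<lambda>n. Y n w) \<longlonglongrightarrow> Y' w"
  shows "has_cont_version Y'"
proof -
  have Yi: "integrable M (Y n)" for n using Y by (auto simp: has_cont_version_def)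
  have [measurable]: "Y n \<in> borel_measurable M" for n using Yi by auto
  have [measurable]: "Y' \<in> borel_measurable M"
    by (rule borel_measurable_AE_cong[where f="\<lambda>w. lim (\<lambda>n. Y n w)"])
       (use lim in \<open>auto simp: limI elim!: eventually_mono\<close>)
  show ?thesis
  proof (rule has_cont_version_L1_limit[OF Y])
    have ae: "AE w in M. \<bar>Y' w\<bar> \<le> c"
      using lim AE_space
    proof eventually_elim
      case (elim w)
      then have "(\<lambda>n. \<bar>Y n w\<bar>) \<longlonglongrightarrow> \<bar>Y' w\<bar>" by (intro tendsto_rabs)
      then show ?case by (rule LIMSEQ_le_const2) (use b elim in auto)
    qed
    then show "integrable M Y'" by (intro integrable_const_bound[where B=c]) auto
    have "(\<lambda>n. expectation (\<lambda>w. \<bar>Y n w - Y' w\<bar>)) \<longlonglongrightarrow> expectation (\<lambda>_. 0)"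
    proof (rule integral_dominated_convergence[where w="\<lambda>_. 2 * c"])
      show "AE w in M. (\<lambda>n. \<bar>Y n w - Y' w\<bar>) \<longlonglongrightarrow> 0"
        using lim by eventually_elim (simp add: LIM_zero tendsto_rabs_zero)
      show "AE w in M. norm \<bar>Y n w - Y' w\<bar> \<le> 2 * c" for n
        using ae AE_space
      proof eventually_elim
        case (elim w)
        then show ?case using b[of w n] by simp
      qed
    qed auto
    then show "(\<lambda>n. expectation (\<lambda>w. \<bar>Y n w - Y' w\<bar>)) \<longlonglongrightarrow> 0" by simp
  qed
qed

end

section \<open>The heat semigroup and products of functions of finitely many values\<close>

lemma abs_mult_le_1: "a \<in> {0..1} \<Longrightarrow> b \<in> {0..1} \<Longrightarrow> \<bar>a * b\<bar> \<le> 1" for a b :: real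
  by (auto simp: abs_mult intro: mult_le_one)

context complete_brownian_motion
begin

text \<open>A modification on a null set, needed because \<open>cont_version\<close> asks for
  continuity of every path.\<close>

definition continuous_B :: "real \<Rightarrow> 'a \<Rightarrow> real" where
  "continuous_B t w = (if continuous_on {0..} (\<lambda>s. B s w) then B t w else 0)"

lemma continuous_on_continuous_B: "continuous_on {0..} (\<lambda>t. continuous_B t w)"
  by (cases "continuous_on {0..} (\<lambda>s. B s w)") (simp_all add: continuous_B_def)

lemma AE_continuous_B: "AE w in M. \<forall>t. continuous_B t w = B t w"
  using continuous_paths by eventually_elim (simp add: continuous_B_def)

lemma measurable_continuous_B:
  assumes "0 \<le> t" "ennreal t \<le> u"
  shows "continuous_B t \<in> borel_measurable (G u)"
  using AE_continuous_B
  by (intro borel_measurable_completed_natural_filtration_AE_cong[OF measurable_completed_natural_filtration[of t u B M, OF assms]])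
     (auto elim!: eventually_mono)

text \<open>The heat semigroup, as \<open>B 1 - B 0\<close> is standard normal. Scaling one fixed
  variable by \<open>sqrt s\<close> makes time 0 regular and gives joint continuity in
  \<open>(s, x)\<close> by dominated convergence.\<close>

definition heat :: "real \<Rightarrow> (real \<Rightarrow> real) \<Rightarrow> real \<Rightarrow> real" where
  "heat s g x = expectation (\<lambda>w. g (x + sqrt s * (B 1 w - B 0 w)))"

lemma heat_0: "heat 0 g x = g x"
  by (simp add: heat_def prob_space)

lemma integrable_heat:
  fixes g :: "real \<Rightarrow> real"
  assumes g: "continuous_on UNIV g" "\<And>x. g x \<in> {0..1}"
  shows "integrable M (\<lambda>w. g (x + c * (B 1 w - B 0 w)))"
proof (rule integrable_const_bound[where B=1])
  have [measurable]: "g \<in> borel_measurable borel" "B 1 \<in> borel_measurable M" "B 0 \<in> borel_measurable M"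
    using g(1) random_variable_B by (auto intro: borel_measurable_continuous_onI)
  show "(\<lambda>w. g (x + c * (B 1 w - B 0 w))) \<in> borel_measurable M" by measurable
  show "AE w in M. norm (g (x + c * (B 1 w - B 0 w))) \<le> 1" using g(2) by (intro AE_I2) auto
qed

lemma heat_bounds:
  assumes g: "continuous_on UNIV g" "\<And>x. g x \<in> {0..1}"
  shows "heat s g x \<in> {0..1}"
proof -
  have "heat s g x \<le> expectation (\<lambda>_. 1)"
    unfolding heat_def using g(2) by (intro integral_mono integrable_heat[OF g]) auto
  moreover have "0 \<le> heat s g x" unfolding heat_def using g(2) by (intro Bochner_Integration.integral_nonneg) auto
  ultimately show ?thesis by (simp add: prob_space)
qed

lemma continuous_on_heat:
  assumes g: "continuous_on UNIV g" "\<And>x. g x \<in> {0..1}"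
  shows "continuous_on UNIV (\<lambda>(s, x). heat s g x)"
proof (rule continuous_on_sequentiallyI)
  fix u :: "nat \<Rightarrow> real \<times> real" and a assume u: "u \<longlonglongrightarrow> a"
  obtain s x where a: "a = (s, x)" by (cases a)
  have s: "(\<lambda>n. fst (u n)) \<longlonglongrightarrow> s" and x: "(\<lambda>n. snd (u n)) \<longlonglongrightarrow> x"
    using tendsto_fst[OF u] tendsto_snd[OF u] by (auto simp: a)
  have gc: "isCont g y" for y using g(1) by (simp add: continuous_on_eq_continuous_at)
  have "(\<lambda>n. heat (fst (u n)) g (snd (u n))) \<longlonglongrightarrow> heat s g x"
    unfolding heat_def
  proof (rule integral_dominated_convergence[where w="\<lambda>_. 1"])
    show "AE w in M. (\<lambda>n. g (snd (u n) + sqrt (fst (u n)) * (B 1 w - B 0 w))) \<longlonglongrightarrow> g (x + sqrt s * (B 1 w - B 0 w))"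
      by (intro AE_I2 isCont_tendsto_compose[OF gc] tendsto_intros s x)
    show "AE w in M. norm (g (snd (u n) + sqrt (fst (u n)) * (B 1 w - B 0 w))) \<le> 1" for n
      using g(2) by (intro AE_I2) auto
  qed (auto intro: borel_measurable_integrable[OF integrable_heat[OF g]])
  then show "(\<lambda>n. case u n of (s, x) \<Rightarrow> heat s g x) \<longlonglongrightarrow> (case a of (s, x) \<Rightarrow> heat s g x)"
    by (simp add: a case_prod_unfold)
qed

lemma continuous_on_heat_compose:
  assumes g: "continuous_on UNIV g" "\<And>x. g x \<in> {0..1}"
    and "continuous_on S a" "continuous_on S c"
  shows "continuous_on S (\<lambda>t. heat (a t) g (c t))"
  using continuous_on_compose2[OF continuous_on_heat[OF g] continuous_on_Pair[OF assms(3,4)]] by simp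

lemma borel_measurable_heat:
  assumes g: "continuous_on UNIV g" "\<And>x. g x \<in> {0..1}"
  shows "heat s g \<in> borel_measurable borel"
  by (intro borel_measurable_continuous_onI continuous_on_heat_compose[OF g] continuous_intros)

lemma distr_increment_eq:
  assumes "0 \<le> t" "t < u"
  shows "distr M borel (\<lambda>w. B u w - B t w) = distr M borel (\<lambda>w. sqrt (u - t) * (B 1 w - B 0 w))"
proof -
  have "distributed M lborel (\<lambda>w. B 1 w - B 0 w) (normal_density 0 (sqrt (1 - 0)))"
    by (rule normal_increments) auto
  from normal_density_affine[OF this, of "sqrt (u - t)" 0]
  have "distributed M lborel (\<lambda>w. sqrt (u - t) * (B 1 w - B 0 w)) (normal_density 0 (sqrt (u - t)))"
    using assms by simp
  from distributed_distr_eq_density[OF this]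
    distributed_distr_eq_density[OF normal_increments[OF assms]]
  have "distr M lborel (\<lambda>w. B u w - B t w) = distr M lborel (\<lambda>w. sqrt (u - t) * (B 1 w - B 0 w))"
    by simp
  moreover have "distr M borel f = distr M lborel f" for f :: "'a \<Rightarrow> real"
    by (rule distr_cong) auto
  ultimately show ?thesis by simp
qed

text \<open>The freezing argument behind the Markov property: the pair of \<open>k\<close> and
  \<open>B t\<close> is independent of the increment, so the joint law is a product and Fubini
  integrates the increment out.\<close>

lemma expectation_mult_heat:
  assumes t: "0 \<le> t" "t \<le> u" and k: "k \<in> borel_measurable (G (ennreal t))" "\<And>w. k w \<in> {0..1}"
    and g: "continuous_on UNIV g" "\<And>x. g x \<in> {0..1}"
  shows "expectation (\<lambda>w. k w * g (B u w)) = expectation (\<lambda>w. k w * heat (u - t) g (B t w))"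
proof (cases "t = u")
  case True
  then show ?thesis by (simp add: heat_0)
next
  case False
  then have tu: "t < u" using t by simp
  \<comment> \<open>The constant second component gives \<open>W\<close> the value type of
    \<open>X\<close>, since \<open>indep_var\<close> pairs variables of one type.\<close>
  define W :: "'a \<Rightarrow> real \<times> real" where "W w = (B u w - B t w, 0)" for w
  define X where "X w = (k w, B t w)" for w
  \<comment> \<open>The clamp is the identity on the values of \<open>k\<close> and keeps
    \<open>\<phi>\<close> bounded on the whole product space.\<close>
  define \<phi> where "\<phi> p = max 0 (min 1 (fst (fst p))) * g (snd (fst p) + fst (snd p))" for p :: "(real \<times> real) \<times> (real \<times> real)"
  have [measurable]: "g \<in> borel_measurable borel" using g(1) by (rule borel_measurable_continuous_onI)
  have [measurable]: "heat (u - t) g \<in> borel_measurable borel" by (rule borel_measurable_heat[OF g])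
  have Bt: "B t \<in> borel_measurable (G (ennreal t))"
    using t by (intro measurable_completed_natural_filtration) auto
  have X: "X \<in> measurable (G (ennreal t)) (borel \<Otimes>\<^sub>M borel)"
    unfolding X_def using k(1) Bt by measurable
  have XM[measurable]: "X \<in> measurable M (borel \<Otimes>\<^sub>M borel)" by (rule measurable_G_in_M[OF X])
  have WM[measurable]: "W \<in> measurable M (borel \<Otimes>\<^sub>M borel)"
    using random_variable_B[OF t(1)] random_variable_B[OF order_trans[OF t]] unfolding W_def by measurable
  have B01[measurable]: "B 1 \<in> borel_measurable M" "B 0 \<in> borel_measurable M"
    using random_variable_B by auto
  have \<phi>m[measurable]: "\<phi> \<in> borel_measurable ((borel \<Otimes>\<^sub>M borel) \<Otimes>\<^sub>M (borel \<Otimes>\<^sub>M borel))"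
    unfolding \<phi>_def by measurable
  have \<phi>b: "norm (\<phi> p) \<le> 1" for p
    using g(2)[of "snd (fst p) + fst (snd p)"] by (auto simp: \<phi>_def abs_mult max_def min_def intro: mult_le_one)
  have iv: "indep_var (borel \<Otimes>\<^sub>M borel) X (borel \<Otimes>\<^sub>M borel) W"
    unfolding W_def by (rule indep_var_increment[OF t X]) measurable
  let ?PX = "distr M (borel \<Otimes>\<^sub>M borel) X" and ?PW = "distr M (borel \<Otimes>\<^sub>M borel) W"
  interpret PX: prob_space ?PX by (rule prob_space_distr[OF XM])
  interpret PW: prob_space ?PW by (rule prob_space_distr[OF WM])
  interpret P: pair_prob_space ?PX ?PW ..
  have eq: "?PX \<Otimes>\<^sub>M ?PW = distr M ((borel \<Otimes>\<^sub>M borel) \<Otimes>\<^sub>M (borel \<Otimes>\<^sub>M borel)) (\<lambda>w. (X w, W w))"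
    using iv unfolding indep_var_distribution_eq by simp
  have "expectation (\<lambda>w. k w * g (B u w)) = expectation (\<lambda>w. \<phi> (X w, W w))"
    using k(2) by (intro Bochner_Integration.integral_cong) (auto simp: \<phi>_def X_def W_def)
  also have "\<dots> = integral\<^sup>L (distr M ((borel \<Otimes>\<^sub>M borel) \<Otimes>\<^sub>M (borel \<Otimes>\<^sub>M borel)) (\<lambda>w. (X w, W w))) \<phi>"
    by (rule integral_distr[symmetric]) measurable
  also have "\<dots> = integral\<^sup>L (?PX \<Otimes>\<^sub>M ?PW) \<phi>" by (simp add: eq)
  also have "\<dots> = (\<integral>x. (\<integral>w. \<phi> (x, w) \<partial>?PW) \<partial>?PX)"
  proof (rule P.integral_fst'[symmetric])
    show "integrable (?PX \<Otimes>\<^sub>M ?PW) \<phi>"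
      by (rule P.integrable_const_bound[where B=1]) (use \<phi>b in \<open>auto simp: eq\<close>)
  qed
  also have "\<dots> = (\<integral>x. max 0 (min 1 (fst x)) * heat (u - t) g (snd x) \<partial>?PX)"
  proof (rule Bochner_Integration.integral_cong[OF refl])
    fix x :: "real \<times> real"
    define \<kappa> y where "\<kappa> = max 0 (min 1 (fst x))" and "y = snd x"
    let ?g = "\<lambda>w. \<kappa> * g (y + w)"
    have gm: "?g \<in> borel_measurable borel"
      by (intro borel_measurable_continuous_onI continuous_intros continuous_on_compose2[OF g(1)]) auto
    have m: "(\<lambda>w. \<phi> (x, w)) \<in> borel_measurable (borel \<Otimes>\<^sub>M borel)"
      unfolding \<phi>_def fst_conv snd_conv \<kappa>_def[symmetric] y_def[symmetric] by measurable
    have "(\<integral>w. \<phi> (x, w) \<partial>?PW) = expectation (\<lambda>w. ?g (B u w - B t w))"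
      by (subst integral_distr[OF WM m]) (simp add: \<phi>_def W_def \<kappa>_def y_def)
    also have "\<dots> = integral\<^sup>L (distr M borel (\<lambda>w. B u w - B t w)) ?g"
      using random_variable_B[OF t(1)] random_variable_B[OF order_trans[OF t]]
      by (intro integral_distr[symmetric] gm) measurable
    also have "\<dots> = integral\<^sup>L (distr M borel (\<lambda>w. sqrt (u - t) * (B 1 w - B 0 w))) ?g"
      by (simp only: distr_increment_eq[OF t(1) tu])
    also have "\<dots> = expectation (\<lambda>w. ?g (sqrt (u - t) * (B 1 w - B 0 w)))"
      by (rule integral_distr[OF _ gm]) measurable
    also have "\<dots> = max 0 (min 1 (fst x)) * heat (u - t) g (snd x)"
      by (simp add: heat_def \<kappa>_def y_def)
    finally show "(\<integral>w. \<phi> (x, w) \<partial>?PW) = max 0 (min 1 (fst x)) * heat (u - t) g (snd x)" .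
  qed
  also have "\<dots> = expectation (\<lambda>w. max 0 (min 1 (fst (X w))) * heat (u - t) g (snd (X w)))"
    by (rule integral_distr) measurable
  also have "\<dots> = expectation (\<lambda>w. k w * heat (u - t) g (B t w))"
    using k(2) by (intro Bochner_Integration.integral_cong) (auto simp: X_def)
  finally show ?thesis .
qed

text \<open>The freezing identity with \<open>indicator A w * h w\<close> in the place of
  \<open>k\<close> tests the candidate against every \<open>A\<close> known at time
  \<open>t\<close>.\<close>

lemma cexp_mult_heat:
  assumes t: "0 \<le> t" "t \<le> u" and h: "h \<in> borel_measurable (G (ennreal t))" "\<And>w. h w \<in> {0..1}"
    and g: "continuous_on UNIV g" "\<And>x. g x \<in> {0..1}"
  shows "AE w in M. cexp t (\<lambda>w. h w * g (B u w)) w = h w * heat (u - t) g (B t w)"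
proof (rule G.real_cond_exp_charact)
  have [measurable]: "g \<in> borel_measurable borel" using g(1) by (rule borel_measurable_continuous_onI)
  have [measurable]: "heat (u - t) g \<in> borel_measurable borel" by (rule borel_measurable_heat[OF g])
  have [measurable]: "B t \<in> borel_measurable (G (ennreal t))"
    using t by (intro measurable_completed_natural_filtration) auto
  note h(1)[measurable]
  have [measurable]: "h \<in> borel_measurable M" "B t \<in> borel_measurable M" "B u \<in> borel_measurable M"
    using measurable_G_in_M[OF h(1)] random_variable_B t by auto
  show "(\<lambda>w. h w * heat (u - t) g (B t w)) \<in> borel_measurable (G (ennreal t))" by measurable
  show "integrable M (\<lambda>w. h w * g (B u w))"
  proof (rule integrable_const_bound[where B=1])
    show "AE w in M. norm (h w * g (B u w)) \<le> 1"
      unfolding real_norm_def by (intro AE_I2 abs_mult_le_1 h(2) g(2))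
  qed measurable
  show "integrable M (\<lambda>w. h w * heat (u - t) g (B t w))"
  proof (rule integrable_const_bound[where B=1])
    show "AE w in M. norm (h w * heat (u - t) g (B t w)) \<le> 1"
      unfolding real_norm_def by (intro AE_I2 abs_mult_le_1 h(2) heat_bounds[OF g])
  qed measurable
  fix A assume A: "A \<in> sets (G (ennreal t))"
  have "expectation (\<lambda>w. (indicator A w * h w) * g (B u w)) = expectation (\<lambda>w. (indicator A w * h w) * heat (u - t) g (B t w))"
  proof (rule expectation_mult_heat[OF t _ _ g])
    show "(\<lambda>w. indicator A w * h w) \<in> borel_measurable (G (ennreal t))" using A by measurable
    show "indicator A w * h w \<in> {0..1}" for w using h(2)[of w] by (auto simp: indicator_def)
  qed
  then show "(\<integral>w\<in>A. h w * g (B u w) \<partial>M) = (\<integral>w\<in>A. h w * heat (u - t) g (B t w) \<partial>M)"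
    by (simp add: set_lebesgue_integral_def mult.assoc)
qed

lemma prod_B_bounds:
  fixes g :: "real \<Rightarrow> real \<Rightarrow> real"
  assumes "\<And>s x. g s x \<in> {0..1}"
  shows "(\<Prod>s\<in>J. g s (f s)) \<in> {0..1}"
  using assms by (auto intro!: prod_nonneg prod_le_1)

text \<open>On \<open>[a, u]\<close>, where \<open>a\<close> is the last but one time, the martingale is the heat semigroup applied
  to the last factor; before \<open>a\<close> it is the martingale of a product with one factor less.\<close>

lemma has_cont_version_prod_pos:
  fixes g :: "real \<Rightarrow> real \<Rightarrow> real"
  assumes "finite J" "J \<subseteq> {0<..}" "\<And>s. continuous_on UNIV (g s)" "\<And>s x. g s x \<in> {0..1}"
  shows "has_cont_version (\<lambda>w. \<Prod>s\<in>insert 0 J. g s (B s w))"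
  using assms
proof (induction J arbitrary: g rule: finite_linorder_max_induct)
  case empty
  have "has_cont_version (\<lambda>w. g 0 0)" by (rule has_cont_version_const)
  then show ?case
    by (rule has_cont_version_cong_AE) (use start_B in \<open>auto elim!: eventually_mono\<close>)
next
  case (insert u J)
  \<comment> \<open>The last but one time. Time 0 always takes part, so the maximum exists even for
    empty \<open>J\<close>; hence the form \<open>insert 0 J\<close> of the statement.\<close>
  define a where "a = Max (insert 0 J)"
  have a_in: "a \<in> insert 0 J" unfolding a_def using insert.hyps(1) by (intro Max_in) auto
  have le_a: "s \<le> a" if "s \<in> insert 0 J" for s
    unfolding a_def using insert.hyps(1) that by (intro Max_ge) auto
  have a0: "0 \<le> a" and au: "a < u" using le_a a_in insert by auto
  have J0: "\<And>s. s \<in> insert 0 J \<Longrightarrow> 0 \<le> s" using insert.prems(1) by fastforce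
  note gc = insert.prems(2) and gb = insert.prems(3)
  define pr where "pr w = (\<Prod>s\<in>insert 0 J. g s (B s w))" for w
  have gm: "g s \<in> borel_measurable borel" for s using gc by (rule borel_measurable_continuous_onI)
  have prm: "pr \<in> borel_measurable (G (ennreal t))" if "a \<le> t" for t
    unfolding pr_def
  proof (intro borel_measurable_prod measurable_compose[OF _ gm] measurable_completed_natural_filtration)
    fix s assume "s \<in> insert 0 J"
    then show "0 \<le> s" "ennreal s \<le> ennreal t" using J0 le_a[of s] that by (auto intro!: ennreal_leI)
  qed
  have prb: "pr w \<in> {0..1}" for w unfolding pr_def by (rule prod_B_bounds[OF gb])
  define Y where "Y w = pr w * g u (B u w)" for w
  have uJ: "u \<notin> insert 0 J" using le_a[of u] au by auto
  have Y_eq: "(\<lambda>w. \<Prod>s\<in>insert 0 (insert u J). g s (B s w)) = Y"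
  proof
    fix w
    have "insert 0 (insert u J) = insert u (insert 0 J)" by auto
    then show "(\<Prod>s\<in>insert 0 (insert u J). g s (B s w)) = Y w"
      unfolding Y_def pr_def using uJ insert.hyps(1) by (simp add: mult.commute)
  qed
  define Y' where "Y' w = pr w * heat (u - a) (g u) (B a w)" for w
  \<comment> \<open>Conditioning at time \<open>a\<close> turns the factor at \<open>u\<close> into
    a function of \<open>B a\<close>, which is absorbed into the factor at \<open>a\<close>: the
    product loses its latest time.\<close>
  define g' where "g' = g(a := \<lambda>x. g a x * heat (u - a) (g u) x)"
  have heat_cont: "continuous_on UNIV (heat (u - a) (g u))"
    by (intro continuous_on_heat_compose[OF gc gb] continuous_intros)
  have heat_b: "heat s (g u) x \<in> {0..1}" for s x by (rule heat_bounds[OF gc gb])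
  have "has_cont_version (\<lambda>w. \<Prod>s\<in>insert 0 J. g' s (B s w))"
  proof (rule insert.IH)
    show "J \<subseteq> {0<..}" using insert.prems by auto
    show "continuous_on UNIV (g' s)" for s
      using gc heat_cont by (cases "s = a") (auto simp: g'_def intro!: continuous_on_mult)
    show "g' s x \<in> {0..1}" for s x
      using gb[of s x] heat_b[of "u - a" x] by (auto simp: g'_def intro: mult_le_one)
  qed
  also have "(\<lambda>w. \<Prod>s\<in>insert 0 J. g' s (B s w)) = Y'"
  proof
    fix w
    have fin: "finite (insert 0 J)" using insert.hyps(1) by simp
    have "(\<Prod>s\<in>insert 0 J - {a}. g' s (B s w)) = (\<Prod>s\<in>insert 0 J - {a}. g s (B s w))"
      by (rule prod.cong) (auto simp: g'_def)
    then show "(\<Prod>s\<in>insert 0 J. g' s (B s w)) = Y' w"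
      unfolding Y'_def pr_def prod.remove[OF fin a_in] by (simp add: g'_def)
  qed
  finally obtain N' where Y'i: "integrable M Y'" and N': "cont_version Y' N'"
    by (auto simp: has_cont_version_def)
  \<comment> \<open>Clamping time to \<open>[a, u]\<close> makes the second summand of
    \<open>N\<close> vanish up to \<open>a\<close> and stay constant after \<open>u\<close>, so the
    pieces glue continuously.\<close>
  define \<tau> where "\<tau> t = min (max t a) u" for t :: real
  define N where "N t w = N' (min t a) w +
    pr w * (heat (u - \<tau> t) (g u) (continuous_B (\<tau> t) w) - heat (u - a) (g u) (continuous_B a w))" for t w
  have \<tau>_cont: "continuous_on S \<tau>" for S unfolding \<tau>_def by (intro continuous_intros)
  have \<tau>0: "0 \<le> \<tau> t" for t using a0 au by (auto simp: \<tau>_def)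
  have Yc: "AE w in M. cexp t Y w = pr w * heat (u - t) (g u) (B t w)" if "a \<le> t" "t \<le> u" for t
    unfolding Y_def using a0 that by (intro cexp_mult_heat prm prb gc gb) auto
  have hm: "(\<lambda>w. heat s (g u) (continuous_B v w)) \<in> borel_measurable (G (ennreal t))"
    if "0 \<le> v" "v \<le> t" for s t v
    using that
    by (intro measurable_compose[OF _ borel_measurable_heat[OF gc gb]] measurable_continuous_B ennreal_leI) auto
  have Ym: "Y \<in> borel_measurable (G (ennreal t))" if "u \<le> t" for t
    unfolding Y_def using that a0 au
    by (intro borel_measurable_times prm measurable_compose[OF _ gm] measurable_completed_natural_filtration ennreal_leI) auto
  have Yi: "integrable M Y"
  proof (rule integrable_const_bound[where B=1])
    show "Y \<in> borel_measurable M" using measurable_G_in_M[OF Ym[OF order_refl]] .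
    show "AE w in M. norm (Y w) \<le> 1"
      unfolding real_norm_def Y_def by (intro AE_I2 abs_mult_le_1 prb gb)
  qed
  have Y'm: "Y' \<in> borel_measurable (G (ennreal a))"
    unfolding Y'_def using a0
    by (intro borel_measurable_times prm measurable_compose[OF _ borel_measurable_heat[OF gc gb]]
        measurable_completed_natural_filtration) auto
  have "cont_version Y N"
    unfolding cont_version_def
  proof (intro conjI allI impI)
    fix w
    have "continuous_on {0..} (\<lambda>t. N' (min t a) w)"
      by (rule continuous_on_compose2[OF cont_versionD(1)[OF N', of w]])
         (use a0 in \<open>auto intro!: continuous_intros\<close>)
    moreover have "continuous_on {0..} (\<lambda>t. continuous_B (\<tau> t) w)"
      by (rule continuous_on_compose2[OF continuous_on_continuous_B[of w] \<tau>_cont]) (use \<tau>0 in auto)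
    ultimately show "continuous_on {0..} (\<lambda>t. N t w)"
      unfolding N_def by (intro continuous_intros continuous_on_heat_compose[OF gc gb] \<tau>_cont)
  next
    fix t :: real assume t: "0 \<le> t"
    have N'm: "N' (min t a) \<in> borel_measurable (G (ennreal t))"
      by (rule measurable_G_mono[OF cont_versionD(2)[OF N', of "min t a"]]) (use t a0 in \<open>auto intro!: ennreal_leI\<close>)
    show "N t \<in> borel_measurable (G (ennreal t))"
    \<comment> \<open>\<open>pr\<close> is known only from time \<open>a\<close> on; up to then its
      coefficient is identically 0.\<close>
    proof (cases "t \<le> a")
      case True
      then have "N t = N' (min t a)" using au by (auto simp: N_def \<tau>_def)
      then show ?thesis using N'm by simp
    next
      case False
      then have "\<tau> t \<le> t" "a \<le> t" by (auto simp: \<tau>_def)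
      then show ?thesis
        unfolding N_def using N'm a0 \<tau>0
        by (intro borel_measurable_add borel_measurable_times borel_measurable_diff prm hm) auto
    qed
    have N'a: "AE w in M. N' a w = Y' w"
      using cont_versionD(3)[OF N' a0] G.real_cond_exp_F_meas[OF Y'i Y'm] by eventually_elim simp
    show "AE w in M. N t w = cexp t Y w"
    proof (cases "t \<le> a")
      case True
      then have "N t w = N' t w" for w using au by (auto simp: N_def \<tau>_def min_def max_def)
      moreover have "AE w in M. N' t w = cexp t Y' w" by (rule cont_versionD(3)[OF N' t])
      \<comment> \<open>The tower property passes through time \<open>a\<close>, where the
        conditional expectation of \<open>Y\<close> is \<open>Y'\<close>.\<close>
      moreover have "AE w in M. cexp t (cexp a Y) w = cexp t Y w"
      proof (rule G.real_cond_exp_nested_subalg[OF _ _ Yi])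
        show "subalgebra M (G (ennreal a))" by (rule subalgebra_G)
        show "subalgebra (G (ennreal a)) (G (ennreal t))"
          using True completed_natural_filtration_mono[OF ennreal_leI[OF True], of M B] by (auto simp: subalgebra_def)
      qed
      moreover have "AE w in M. cexp t (cexp a Y) w = cexp t Y' w"
        using Yc[OF order_refl less_imp_le[OF au]] Y'i by (intro G.real_cond_exp_cong) (auto simp: Y'_def)
      ultimately show ?thesis by (auto elim!: eventually_elim2)
    next
      case False
      then have ta: "min t a = a" "a \<le> t" by auto
      have N_eq: "AE w in M. N t w = pr w * heat (u - \<tau> t) (g u) (B (\<tau> t) w)"
        using N'a AE_continuous_B
      proof eventually_elim
        case (elim w)
        then show ?case by (simp add: N_def ta Y'_def algebra_simps)
      qed
      show ?thesis
      proof (cases "t \<le> u")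
        case True
        then have "\<tau> t = t" using ta by (auto simp: \<tau>_def)
        then show ?thesis using N_eq Yc[OF ta(2) True] by (auto elim: eventually_elim2)
      next
        case False
        then have "\<tau> t = u" using ta by (auto simp: \<tau>_def)
        moreover have "AE w in M. cexp t Y w = Y w"
          by (rule G.real_cond_exp_F_meas[OF Yi Ym]) (use False in auto)
        ultimately show ?thesis using N_eq by (auto simp: heat_0 Y_def elim: eventually_elim2)
      qed
    qed
  qed
  then show ?case unfolding Y_eq using Yi by (auto simp: has_cont_version_def)
qed

lemma has_cont_version_prod:
  fixes g :: "real \<Rightarrow> real \<Rightarrow> real"
  assumes J: "finite J" "J \<subseteq> {0..}" and g: "\<And>s. continuous_on UNIV (g s)" "\<And>s x. g s x \<in> {0..1}"
  shows "has_cont_version (\<lambda>w. \<Prod>s\<in>J. g s (B s w))"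
proof (cases "0 \<in> J")
  case True
  then have "J = insert 0 (J - {0})" by auto
  moreover have "has_cont_version (\<lambda>w. \<Prod>s\<in>insert 0 (J - {0}). g s (B s w))"
    using J by (intro has_cont_version_prod_pos g) auto
  ultimately show ?thesis by simp
next
  case False
  let ?g = "g(0 := \<lambda>_. 1)"
  have "has_cont_version (\<lambda>w. \<Prod>s\<in>insert 0 J. ?g s (B s w))"
  proof (rule has_cont_version_prod_pos)
    show "J \<subseteq> {0<..}" using J False by (auto simp: less_le)
  qed (use J g in auto)
  moreover have "(\<Prod>s\<in>insert 0 J. ?g s (B s w)) = (\<Prod>s\<in>J. g s (B s w))" for w
  proof -
    have "(\<Prod>s\<in>J. ?g s (B s w)) = (\<Prod>s\<in>J. g s (B s w))" using False by (intro prod.cong) auto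
    then show ?thesis using False J by simp
  qed
  ultimately show ?thesis by simp
qed

section \<open>From products to all bounded measurable variables\<close>

lemma has_cont_version_cylinder:
  assumes "A \<in> cylinders t"
  shows "has_cont_version (indicator A)"
proof -
  obtain J and g :: "nat \<Rightarrow> real \<Rightarrow> real \<Rightarrow> real"
    where J: "finite J" "J \<subseteq> {s. 0 \<le> s \<and> ennreal s \<le> t}"
      and g: "\<And>k s. continuous_on UNIV (g k s)" "\<And>k s x. g k s x \<in> {0..1}"
      and lim: "AE w in M. (\<lambda>k. \<Prod>s\<in>J. g k s (B s w)) \<longlonglongrightarrow> indicator A w"
    using assms unfolding cylinders_def by blast
  show ?thesis
  proof (rule has_cont_version_bounded_limit[OF _ _ lim])
    show "has_cont_version (\<lambda>w. \<Prod>s\<in>J. g k s (B s w))" for k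
      using J by (intro has_cont_version_prod g) auto
    show "\<bar>\<Prod>s\<in>J. g k s (B s w)\<bar> \<le> 1" for k w
      using prod_B_bounds[of "g k" "\<lambda>s. B s w" J, OF g(2)] by auto
  qed
qed

text \<open>Dynkin's argument: complements follow by linearity, disjoint unions as bounded limits of
  finite sums.\<close>

lemma has_cont_version_indicator:
  assumes "A \<in> sets (G t)"
  shows "has_cont_version (indicator A)"
proof -
  have sub: "sigma_sets (space M) (cylinders t) \<subseteq> sets M"
    by (rule sets.sigma_sets_subset) (auto simp: cylinders_def)
  have "A \<in> sigma_sets (space M) (cylinders t)"
    using assms sets_G_eq_sigma_cylinders by auto
  then show ?thesis
  proof (induct rule: sigma_sets_induct_disjoint[OF Int_stable_cylinders cylinders_subset, consumes 1, case_names basic empty compl union])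
    case (basic A)
    then show ?case by (rule has_cont_version_cylinder)
  next
    case empty
    show ?case by (rule has_cont_version_cong_AE[OF has_cont_version_const[of 0]]) simp
  next
    case (compl A)
    have "has_cont_version (\<lambda>w. 1 + (-1) * indicator A w)"
      by (intro has_cont_version_add has_cont_version_const has_cont_version_cmult compl(2))
    then show ?case
      by (rule has_cont_version_cong_AE) (auto simp: indicator_def)
  next
    case (union A)
    show ?case
    proof (rule has_cont_version_bounded_limit)
      fix n
      show "has_cont_version (\<lambda>w. \<Sum>i<n. indicator (A i) w)"
        by (intro has_cont_version_sum union(3))
      have *: "(\<Sum>i<n. indicator (A i) w) = (indicator (\<Union>i<n. A i) w :: real)" for w
        using union(1)
        by (intro indicator_UN_disjoint[symmetric]) (auto simp: disjoint_family_on_def)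
      show "\<bar>\<Sum>i<n. indicator (A i) w :: real\<bar> \<le> 1" for w
        unfolding * by (auto simp: indicator_def)
    next
      show "AE w in M. (\<lambda>n. \<Sum>i<n. indicator (A i) w) \<longlonglongrightarrow> (indicator (\<Union>i. A i) w :: real)"
      proof (rule AE_I2)
        fix w
        have "(\<lambda>i. indicator (A i) w :: real) sums indicator (\<Union>i. A i) w"
          by (rule indicator_sums) (use union(1) in \<open>auto simp: disjoint_family_on_def\<close>)
        then show "(\<lambda>n. \<Sum>i<n. indicator (A i) w) \<longlonglongrightarrow> (indicator (\<Union>i. A i) w :: real)"
          by (simp add: sums_def)
      qed
    qed
  qed
qed

text \<open>Layer approximation: the mean of the indicators of the levels \<open>k / Suc n\<close>
  is \<open>Y\<close> rounded down to a multiple of \<open>1 / Suc n\<close>.\<close>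

lemma has_cont_version_bounded:
  assumes Y: "Y \<in> borel_measurable (G t)" "\<And>w. Y w \<in> {0..1}"
  shows "has_cont_version Y"
proof (rule has_cont_version_bounded_limit)
  fix n :: nat
  let ?Y = "\<lambda>w. 1 / real (Suc n) * (\<Sum>k\<in>{1..Suc n}. indicator {w\<in>space (G t). real k / real (Suc n) \<le> Y w} w)"
  show "has_cont_version ?Y"
    using Y(1)
    by (intro has_cont_version_cmult has_cont_version_sum has_cont_version_indicator[where t=t]) measurable
  show "\<bar>?Y w\<bar> \<le> 1" for w
  proof -
    have "(\<Sum>k\<in>{1..Suc n}. indicator {w\<in>space (G t). real k / real (Suc n) \<le> Y w} w) \<le> (\<Sum>k\<in>{1..Suc n}. 1 :: real)"
      by (intro sum_mono) (auto simp: indicator_def)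
    moreover have "0 \<le> (\<Sum>k\<in>{1..Suc n}. indicator {w\<in>space (G t). real k / real (Suc n) \<le> Y w} w :: real)"
      by (intro sum_nonneg) (auto simp: indicator_def)
    ultimately show ?thesis by (simp add: abs_mult del: sum.cl_ivl_Suc)
  qed
next
  show "AE w in M. (\<lambda>n. 1 / real (Suc n) * (\<Sum>k\<in>{1..Suc n}. indicator {w\<in>space (G t). real k / real (Suc n) \<le> Y w} w)) \<longlonglongrightarrow> Y w"
  proof (rule AE_I2)
    fix w assume w: "w \<in> space M"
    have eq: "1 / real (Suc n) * (\<Sum>k\<in>{1..Suc n}. indicator {w\<in>space (G t). real k / real (Suc n) \<le> Y w} w)
      = real_of_int \<lfloor>real (Suc n) * Y w\<rfloor> / real (Suc n)" for n
    proof -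
      let ?m = "nat \<lfloor>real (Suc n) * Y w\<rfloor>"
      have Y0: "0 \<le> Y w" "Y w \<le> 1" using Y(2)[of w] by auto
      have m: "real ?m = real_of_int \<lfloor>real (Suc n) * Y w\<rfloor>" using Y0 by simp
      have "real (Suc n) * Y w \<le> real (Suc n)" using Y0 by (simp add: mult_left_le del: of_nat_Suc)
      then have mn: "?m \<le> Suc n" by linarith
      have iff: "real k / real (Suc n) \<le> Y w \<longleftrightarrow> k \<le> ?m" for k
      proof -
        have "real k / real (Suc n) \<le> Y w \<longleftrightarrow> real k \<le> real (Suc n) * Y w"
          by (simp add: divide_le_eq mult.commute del: of_nat_Suc)
        also have "\<dots> \<longleftrightarrow> int k \<le> \<lfloor>real (Suc n) * Y w\<rfloor>" by (simp add: le_floor_iff del: of_nat_Suc)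
        also have "\<dots> \<longleftrightarrow> k \<le> ?m" using Y0 by (simp add: le_nat_iff del: of_nat_Suc)
        finally show ?thesis .
      qed
      have "(\<Sum>k\<in>{1..Suc n}. indicator {w\<in>space (G t). real k / real (Suc n) \<le> Y w} w)
        = (\<Sum>k\<in>{1..Suc n}. if k \<le> ?m then 1 else (0::real))"
        using w by (intro sum.cong) (auto simp: indicator_def iff simp del: of_nat_Suc)
      also have "\<dots> = (\<Sum>k\<in>{1..?m}. 1)"
        by (rule sum.mono_neutral_cong_right) (use mn in auto)
      also have "\<dots> = real_of_int \<lfloor>real (Suc n) * Y w\<rfloor>" using m by simp
      finally show ?thesis by simp
    qed
    show "(\<lambda>n. 1 / real (Suc n) * (\<Sum>k\<in>{1..Suc n}. indicator {w\<in>space (G t). real k / real (Suc n) \<le> Y w} w)) \<longlonglongrightarrow> Y w"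
      unfolding eq
    proof (rule tendsto_sandwich)
      have "Y w - 1 / real (Suc n) \<le> real_of_int \<lfloor>real (Suc n) * Y w\<rfloor> / real (Suc n)" for n
      proof -
        have "real (Suc n) * Y w - 1 \<le> real_of_int \<lfloor>real (Suc n) * Y w\<rfloor>" by linarith
        from divide_right_mono[OF this, of "real (Suc n)"] show ?thesis
          by (simp add: diff_divide_distrib del: of_nat_Suc)
      qed
      then show "\<forall>\<^sub>F n in sequentially. Y w - 1 / real (Suc n) \<le> real_of_int \<lfloor>real (Suc n) * Y w\<rfloor> / real (Suc n)"
        by (intro always_eventually) auto
      have "real_of_int \<lfloor>real (Suc n) * Y w\<rfloor> / real (Suc n) \<le> Y w" for n
      proof -
        have "real_of_int \<lfloor>real (Suc n) * Y w\<rfloor> \<le> real (Suc n) * Y w" by linarith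
        from divide_right_mono[OF this, of "real (Suc n)"] show ?thesis by (simp del: of_nat_Suc)
      qed
      then show "\<forall>\<^sub>F n in sequentially. real_of_int \<lfloor>real (Suc n) * Y w\<rfloor> / real (Suc n) \<le> Y w"
        by (intro always_eventually) auto
      have "(\<lambda>n. Y w - 1 / real (Suc n)) \<longlonglongrightarrow> Y w - 0"
        by (intro tendsto_diff tendsto_const LIMSEQ_Suc[OF lim_1_over_n])
      then show "(\<lambda>n. Y w - 1 / real (Suc n)) \<longlonglongrightarrow> Y w" by simp
    qed auto
  qed
qed

end

subsection \<open>Optional times of the Brownian filtration are announced\<close>

lemma ennreal_dense_Rats:
  fixes x y :: ennreal
  assumes "x < y"
  obtains q where "q \<in> \<rat>" "0 \<le> q" "x < ennreal q" "ennreal q < y"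
proof -
  obtain w where w: "x < w" "w < y" using dense[OF assms] by auto
  obtain t where t: "0 \<le> t" "w = ennreal t" using w(2) by (cases w) auto
  obtain r where r: "0 \<le> r" "x = ennreal r" "r < t"
    using w(1) t by (cases x) (auto simp: ennreal_less_iff)
  obtain q where q: "q \<in> \<rat>" "r < q" "q < t" using Rats_dense_in_real[OF r(3)] by auto
  then have "ennreal q < w" using r t by (simp add: ennreal_less_iff)
  then show thesis using q r w by (intro that[of q]) (auto simp: ennreal_less_iff)
qed

text \<open>The next multiple of \<open>1 / Suc n\<close> strictly after \<open>x\<close>.
  Strictness fits optional times: that \<open>\<tau>\<close> lies below a grid point is known at
  that point.\<close>

definition grid :: "nat \<Rightarrow> real \<Rightarrow> real" where
  "grid n x = (real_of_int \<lfloor>real (Suc n) * x\<rfloor> + 1) / real (Suc n)"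

lemma grid_greater: "x < grid n x"
proof -
  have "real (Suc n) * x < real_of_int \<lfloor>real (Suc n) * x\<rfloor> + 1" by linarith
  then show ?thesis unfolding grid_def by (simp add: less_divide_eq mult.commute del: of_nat_Suc)
qed

lemma grid_le: "grid n x \<le> x + 1 / real (Suc n)"
proof -
  have "real_of_int \<lfloor>real (Suc n) * x\<rfloor> + 1 \<le> real (Suc n) * x + 1" by linarith
  from divide_right_mono[OF this, of "real (Suc n)"] show ?thesis
    unfolding grid_def by (simp add: add_divide_distrib del: of_nat_Suc)
qed

lemma grid_tendsto: "(\<lambda>n. grid n x) \<longlonglongrightarrow> x"
proof (rule tendsto_sandwich)
  show "\<forall>\<^sub>F n in sequentially. x \<le> grid n x" using grid_greater by (intro always_eventually) (auto intro: less_imp_le)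
  show "\<forall>\<^sub>F n in sequentially. grid n x \<le> x + 1 / real (Suc n)" using grid_le by (intro always_eventually) auto
  have "(\<lambda>n. x + 1 / real (Suc n)) \<longlonglongrightarrow> x + 0"
    by (intro tendsto_add tendsto_const LIMSEQ_Suc[OF lim_1_over_n])
  then show "(\<lambda>n. x + 1 / real (Suc n)) \<longlonglongrightarrow> x" by simp
qed auto

lemma borel_measurable_ennrealI_less:
  fixes f :: "'b \<Rightarrow> ennreal"
  assumes less: "\<And>t. 0 \<le> t \<Longrightarrow> {x\<in>space N. f x < ennreal t} \<in> sets N"
  shows "f \<in> borel_measurable N"
proof (rule borel_measurableI_less)
  fix y show "{x\<in>space N. f x < y} \<in> sets N"
  proof (cases y)
    case (real r)
    then show ?thesis using less by simp
  next
    case top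
    have "{x\<in>space N. f x < \<top>} = (\<Union>n. {x\<in>space N. f x < ennreal (real n)})"
    proof (intro equalityI subsetI)
      fix x assume "x \<in> {x\<in>space N. f x < \<top>}"
      then show "x \<in> (\<Union>n. {x\<in>space N. f x < ennreal (real n)})"
        using ennreal_Ex_less_of_nat[of "f x"] by (auto simp: ennreal_of_nat_eq_real_of_nat)
    qed (auto intro: less_le_trans)
    then show ?thesis unfolding top using less by auto
  qed
qed

context complete_brownian_motion
begin

text \<open>A stopping time of the right-limit filtration. The strict inequality is what an infimum
  over rational times provides, see \<open>stopping_time_imp_optional_time\<close>.\<close>

definition optional_time :: "('a \<Rightarrow> ennreal) \<Rightarrow> bool" where
  "optional_time \<tau> \<longleftrightarrow> (\<forall>t::real. {w\<in>space M. \<tau> w < ennreal t} \<in> sets (G (ennreal t)))"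

lemma optional_timeD: "optional_time \<tau> \<Longrightarrow> {w\<in>space M. \<tau> w < ennreal t} \<in> sets (G (ennreal t))"
  by (auto simp: optional_time_def)

lemma optional_timeD':
  "optional_time \<tau> \<Longrightarrow> ennreal t \<le> u \<Longrightarrow> {w\<in>space M. \<tau> w < ennreal t} \<in> sets (G u)"
  by (rule sets_G_mono[OF _ optional_timeD])

lemma measurable_optional_time:
  assumes "optional_time \<tau>"
  shows "\<tau> \<in> borel_measurable (G \<top>)"
  by (rule borel_measurable_ennrealI_less) (use optional_timeD'[OF assms] in simp)

lemma optional_timeI_le:
  assumes le: "\<And>t. 0 \<le> t \<Longrightarrow> {w\<in>space M. \<tau> w \<le> ennreal t} \<in> sets (G (ennreal t))"
  shows "optional_time \<tau>"
  unfolding optional_time_def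
proof
  fix t :: real
  have "{w\<in>space M. \<tau> w < ennreal t} = (\<Union>q\<in>\<rat> \<inter> {0..<t}. {w\<in>space M. \<tau> w \<le> ennreal q})"
  proof (intro equalityI subsetI)
    fix w assume "w \<in> {w\<in>space M. \<tau> w < ennreal t}"
    then have "w \<in> space M" "\<tau> w < ennreal t" by auto
    from ennreal_dense_Rats[OF this(2)] obtain q where "q \<in> \<rat>" "0 \<le> q" "\<tau> w < ennreal q" "ennreal q < ennreal t" .
    then show "w \<in> (\<Union>q\<in>\<rat> \<inter> {0..<t}. {w\<in>space M. \<tau> w \<le> ennreal q})"
      using \<open>w \<in> space M\<close> by (auto simp: ennreal_less_iff intro!: bexI[of _ q])
  qed (auto simp: ennreal_less_iff intro: le_less_trans)
  also have "\<dots> \<in> sets (G (ennreal t))"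
  proof (rule sets.countable_UN'')
    show "countable (\<rat> \<inter> {0..<t})" by (rule countable_Rats_Int)
    fix q assume "q \<in> \<rat> \<inter> {0..<t}"
    then show "{w\<in>space M. \<tau> w \<le> ennreal q} \<in> sets (G (ennreal t))"
      by (intro sets_G_mono[OF _ le]) (auto intro: ennreal_leI)
  qed
  finally show "{w\<in>space M. \<tau> w < ennreal t} \<in> sets (G (ennreal t))" .
qed

text \<open>A common inequality form of optional sampling and the strong Markov property: the
  hypothesis is summed over the countably many values of the grid time after \<open>\<tau>\<close>,
  then Fatou's lemma lets the mesh tend to 0. It serves both the martingale that announces
  \<open>\<tau>\<close> and the events \<open>no_drop\<close>.\<close>

lemma nn_integral_grid_le:
  fixes f :: "real \<Rightarrow> 'a \<Rightarrow> ennreal"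
  assumes \<tau>: "optional_time \<tau>"
    and f: "\<And>t. 0 \<le> t \<Longrightarrow> f t \<in> borel_measurable M" and Y[measurable]: "Y \<in> borel_measurable M"
    and le: "\<And>t A. 0 \<le> t \<Longrightarrow> A \<in> sets (G (ennreal t)) \<Longrightarrow> (\<integral>\<^sup>+w\<in>A. f t w \<partial>M) \<le> (\<integral>\<^sup>+w\<in>A. Y w \<partial>M)"
  shows "(\<integral>\<^sup>+w\<in>{w\<in>space M. \<tau> w < \<top>}. liminf (\<lambda>n. f (grid n (enn2real (\<tau> w))) w) \<partial>M)
    \<le> (\<integral>\<^sup>+w\<in>{w\<in>space M. \<tau> w < \<top>}. Y w \<partial>M)"
proof -
  \<comment> \<open>The cells exclude their right end \<open>u n j\<close>, so each is known there;
    an infinite \<open>\<tau>\<close> lies in none of them.\<close>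
  define C where "C n j = {w\<in>space M. ennreal (real j / real (Suc n)) \<le> \<tau> w \<and> \<tau> w < ennreal ((real j + 1) / real (Suc n))}" for n j :: nat
  define u where "u n j = (real j + 1) / real (Suc n)" for n j :: nat
  define h where "h n w = (\<Sum>j. f (u n j) w * indicator (C n j) w)" for n w
  have u0: "0 \<le> u n j" for n j by (simp add: u_def)
  have CG: "C n j \<in> sets (G (ennreal (u n j)))" for n j
  proof -
    have "C n j = {w\<in>space M. \<tau> w < ennreal (u n j)} - {w\<in>space M. \<tau> w < ennreal (real j / real (Suc n))}"
      by (auto simp: C_def u_def not_less)
    also have "\<dots> \<in> sets (G (ennreal (u n j)))"
      by (intro sets.Diff optional_timeD'[OF \<tau>]) (auto simp: u_def intro!: ennreal_leI divide_right_mono)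
    finally show ?thesis .
  qed
  have CM[measurable]: "C n j \<in> sets M" for n j using sets_G_in_M[OF CG] .
  have fM[measurable]: "f (u n j) \<in> borel_measurable M" for n j using f[OF u0] .
  have hM[measurable]: "h n \<in> borel_measurable M" for n unfolding h_def by measurable
  have \<tau>M[measurable]: "\<tau> \<in> borel_measurable M" by (rule measurable_G_in_M[OF measurable_optional_time[OF \<tau>]])
  have single: "w \<in> C n j \<longleftrightarrow> j = nat \<lfloor>real (Suc n) * enn2real (\<tau> w)\<rfloor>"
    if w: "w \<in> space M" "\<tau> w < \<top>" for w n j
  proof -
    obtain r where r: "0 \<le> r" "\<tau> w = ennreal r" using w(2) by (cases "\<tau> w") auto
    have "w \<in> C n j \<longleftrightarrow> real j / real (Suc n) \<le> r \<and> r < (real j + 1) / real (Suc n)"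
      using w(1) r(1) by (simp add: C_def r(2) ennreal_le_iff ennreal_less_iff del: of_nat_Suc)
    also have "\<dots> \<longleftrightarrow> real j \<le> real (Suc n) * r \<and> real (Suc n) * r < real j + 1"
      by (simp add: divide_le_eq less_divide_eq mult.commute del: of_nat_Suc)
    also have "\<dots> \<longleftrightarrow> int j = \<lfloor>real (Suc n) * r\<rfloor>" by linarith
    also have "\<dots> \<longleftrightarrow> j = nat \<lfloor>real (Suc n) * r\<rfloor>" using r(1) by auto
    finally show ?thesis using r by simp
  qed
  have sums: "(\<lambda>j. a j * indicator (C n j) w) sums a (nat \<lfloor>real (Suc n) * enn2real (\<tau> w)\<rfloor>)"
    if "w \<in> space M" "\<tau> w < \<top>" for a :: "nat \<Rightarrow> ennreal" and n w
  proof -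
    have "(\<lambda>j. a j * indicator (C n j) w) = (\<lambda>j. if j = nat \<lfloor>real (Suc n) * enn2real (\<tau> w)\<rfloor> then a j else 0)"
      by (rule ext) (simp add: indicator_def single[OF that])
    then show ?thesis using sums_single[of "nat \<lfloor>real (Suc n) * enn2real (\<tau> w)\<rfloor>" a] by simp
  qed
  have h_eq: "h n w = f (grid n (enn2real (\<tau> w))) w" if "w \<in> space M" "\<tau> w < \<top>" for n w
  proof -
    have "h n w = f (u n (nat \<lfloor>real (Suc n) * enn2real (\<tau> w)\<rfloor>)) w"
      unfolding h_def by (rule sums_unique[symmetric, OF sums[OF that]])
    then show ?thesis by (simp add: u_def grid_def del: of_nat_Suc)
  qed
  have h_le: "(\<integral>\<^sup>+w. h n w \<partial>M) \<le> (\<integral>\<^sup>+w\<in>{w\<in>space M. \<tau> w < \<top>}. Y w \<partial>M)" for n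
  proof -
    have "(\<integral>\<^sup>+w. h n w \<partial>M) = (\<Sum>j. \<integral>\<^sup>+w. f (u n j) w * indicator (C n j) w \<partial>M)"
      unfolding h_def by (rule nn_integral_suminf) measurable
    also have "\<dots> \<le> (\<Sum>j. \<integral>\<^sup>+w. Y w * indicator (C n j) w \<partial>M)"
      by (intro suminf_le le u0 CG summableI)
    also have "\<dots> = (\<integral>\<^sup>+w. (\<Sum>j. Y w * indicator (C n j) w) \<partial>M)"
      by (rule nn_integral_suminf[symmetric]) measurable
    also have "\<dots> = (\<integral>\<^sup>+w\<in>{w\<in>space M. \<tau> w < \<top>}. Y w \<partial>M)"
    proof (rule nn_integral_cong)
      fix w assume w: "w \<in> space M"
      show "(\<Sum>j. Y w * indicator (C n j) w) = Y w * indicator {w\<in>space M. \<tau> w < \<top>} w"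
      proof (cases "\<tau> w < \<top>")
        case True
        then show ?thesis using sums_unique[OF sums[OF w True, of "\<lambda>_. Y w" n]] w by simp
      next
        case False
        then have "indicator (C n j) w = (0::ennreal)" for j
          by (auto simp: C_def indicator_def less_top[symmetric])
        then show ?thesis using False by simp
      qed
    qed
    finally show ?thesis .
  qed
  have "(\<integral>\<^sup>+w\<in>{w\<in>space M. \<tau> w < \<top>}. liminf (\<lambda>n. f (grid n (enn2real (\<tau> w))) w) \<partial>M) \<le> (\<integral>\<^sup>+w. liminf (\<lambda>n. h n w) \<partial>M)"
    by (intro nn_integral_mono) (auto simp: indicator_def h_eq)
  also have "\<dots> \<le> liminf (\<lambda>n. \<integral>\<^sup>+w. h n w \<partial>M)"
    by (rule nn_integral_liminf) measurable
  also have "\<dots> \<le> (\<integral>\<^sup>+w\<in>{w\<in>space M. \<tau> w < \<top>}. Y w \<partial>M)"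
    using h_le by (intro Liminf_le) auto
  finally show ?thesis .
qed

text \<open>With \<open>N\<close> a continuous version of the martingale closed by \<open>exp (- \<tau>)\<close>, the difference
  \<open>exp (- t) - N t\<close> vanishes at \<open>\<tau>\<close>; the times at which it first drops to \<open>1 / Suc n\<close> announce the
  time \<open>\<rho>\<close> of its first zero. Optional sampling gives \<open>E (exp (- \<rho>)) \<le> E (exp (- \<tau>))\<close>, which together with
  \<open>\<rho> \<le> \<tau>\<close> forces \<open>\<rho> = \<tau>\<close>.\<close>

lemma optional_time_announced:
  assumes \<tau>: "optional_time \<tau>"
  shows "\<exists>S. (\<forall>n t. 0 \<le> t \<longrightarrow> {w\<in>space M. S n w \<le> ennreal t} \<in> sets (G (ennreal t))) \<and>
    (AE w in M. incseq (\<lambda>n. S n w) \<and> (\<lambda>n. S n w) \<longlonglongrightarrow> \<tau> w \<and> (\<tau> w > 0 \<longrightarrow> (\<forall>n. S n w < \<tau> w)))"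
proof -
  \<comment> \<open>A strictly decreasing map into \<open>[0, 1]\<close>; the value 0 at infinity
    lets infinite times take part.\<close>
  define e where "e x = (if x = \<top> then 0 else exp (- enn2real x))" for x :: ennreal
  have em[measurable]: "e \<in> borel_measurable borel" unfolding e_def by measurable
  have eb: "e x \<in> {0..1}" for x by (simp add: e_def)
  have e_real: "e (ennreal r) = exp (- r)" if "0 \<le> r" for r using that by (simp add: e_def)
  have e_anti: "e y \<le> e x" if "x \<le> y" for x y
    using that by (cases x; cases y) (auto simp: e_def top_unique ennreal_le_iff)
  have e_inj: "x = y" if "e x = e y" for x y
    using that by (cases x; cases y) (auto simp: e_def)
  define Y where "Y w = e (\<tau> w)" for w
  have \<tau>m[measurable]: "\<tau> \<in> borel_measurable M" by (rule measurable_G_in_M[OF measurable_optional_time[OF \<tau>]])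
  have YG: "Y \<in> borel_measurable (G \<top>)"
    unfolding Y_def by (rule measurable_compose[OF measurable_optional_time[OF \<tau>] em])
  have Ym[measurable]: "Y \<in> borel_measurable M" by (rule measurable_G_in_M[OF YG])
  have Yb: "Y w \<in> {0..1}" for w using eb by (simp add: Y_def)
  from has_cont_version_bounded[OF YG Yb] obtain N where Yi: "integrable M Y" and N: "cont_version Y N"
    by (auto simp: has_cont_version_def)
  note Nc = cont_versionD(1)[OF N] and Nm = cont_versionD(2)[OF N] and Ne = cont_versionD(3)[OF N]
  define X where "X t w = exp (- t) - N t w" for t w
  have Xc: "continuous_on {0..} (\<lambda>t. X t w)" for w unfolding X_def by (intro continuous_intros Nc)
  have N0: "AE w in M. 0 \<le> N t w" if "0 \<le> t" for t
    using Ne[OF that] G.real_cond_exp_ge_c[of Y 0 "ennreal t", OF Yi] Yb by auto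
  have "AE w in M. \<forall>q\<in>\<rat> \<inter> {0..}. 0 \<le> N q w"
    by (rule AE_ball_countable') (use N0 in \<open>auto intro: countable_Rats_Int\<close>)
  then have N_nonneg: "AE w in M. \<forall>t\<ge>0. 0 \<le> N t w"
  proof eventually_elim
    case (elim w)
    show ?case
    proof (intro allI impI)
      fix t :: real assume "0 \<le> t"
      from continuous_on_atLeast_Rats_closed[OF Nc closed_atLeast _ this, of w 0] elim
      show "0 \<le> N t w" by auto
    qed
  qed

  \<comment> \<open>On \<open>\<tau> < q\<close> the variable \<open>Y\<close> depends only on
    \<open>min (\<tau> w) (ennreal q)\<close>, hence is known at time \<open>q\<close> and equals
    its conditional expectation.\<close>
  have N_after: "AE w in M. \<tau> w < ennreal q \<longrightarrow> N q w = Y w" if q: "0 \<le> q" for q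
  proof -
    let ?A = "{w\<in>space M. \<tau> w < ennreal q}"
    have A[measurable]: "?A \<in> sets (G (ennreal q))" by (rule optional_timeD[OF \<tau>])
    have min: "(\<lambda>w. min (\<tau> w) (ennreal q)) \<in> borel_measurable (G (ennreal q))"
    proof (rule borel_measurableI_less)
      fix y
      show "{w \<in> space (G (ennreal q)). min (\<tau> w) (ennreal q) < y} \<in> sets (G (ennreal q))"
      proof (cases "y \<le> ennreal q")
        case True
        then obtain r where y: "y = ennreal r" by (cases y) (auto simp: top_unique)
        from True have "{w \<in> space (G (ennreal q)). min (\<tau> w) (ennreal q) < y} = {w\<in>space M. \<tau> w < y}"
          by (auto simp: min_less_iff_disj)
        then show ?thesis using optional_timeD'[OF \<tau> True[unfolded y]] by (simp add: y)
      next
        case False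
        then have "{w \<in> space (G (ennreal q)). min (\<tau> w) (ennreal q) < y} = space (G (ennreal q))"
          by (auto simp: min_less_iff_disj)
        then show ?thesis by (simp only: sets.top)
      qed
    qed
    have "(\<lambda>w. indicator ?A w * e (min (\<tau> w) (ennreal q))) \<in> borel_measurable (G (ennreal q))"
      using measurable_compose[OF min em] A by measurable
    also have "(\<lambda>w. indicator ?A w * e (min (\<tau> w) (ennreal q))) = (\<lambda>w. indicator ?A w * Y w)"
      by (rule ext) (auto simp: Y_def indicator_def min_def)
    finally have m: "(\<lambda>w. indicator ?A w * Y w) \<in> borel_measurable (G (ennreal q))" .
    have i: "integrable M (\<lambda>w. indicator ?A w * Y w)"
      using integrable_mult_indicator[OF sets_G_in_M[OF A] Yi] by simp
    have "AE w in M. cexp q (\<lambda>w. indicator ?A w * Y w) w = indicator ?A w * cexp q Y w"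
      by (rule G.real_cond_exp_mult) (use i A in auto)
    moreover have "AE w in M. cexp q (\<lambda>w. indicator ?A w * Y w) w = indicator ?A w * Y w"
      by (rule G.real_cond_exp_F_meas[OF i m])
    ultimately show ?thesis using Ne[OF q] AE_space
      by eventually_elim auto
  qed
  have "AE w in M. \<forall>q\<in>\<rat> \<inter> {0..}. \<tau> w < ennreal q \<longrightarrow> N q w = Y w"
    by (rule AE_ball_countable') (use N_after in \<open>auto intro: countable_Rats_Int\<close>)
  then have N_at: "AE w in M. \<forall>r\<ge>0. \<tau> w = ennreal r \<longrightarrow> X r w = 0"
  proof eventually_elim
    case (elim w)
    show ?case
    proof (intro allI impI)
      fix r :: real assume r: "0 \<le> r" "\<tau> w = ennreal r"
      from Rats_sequence_above_continuous[OF Nc r(1), of w] obtain q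
        where q: "\<And>k. q k \<in> \<rat>" "\<And>k. r < q k" "q \<longlonglongrightarrow> r" and "(\<lambda>k. N (q k) w) \<longlonglongrightarrow> N r w" by metis
      moreover have q0: "0 \<le> q k" for k using q(2)[of k] r by simp
      moreover have "N (q k) w = Y w" for k
        using elim q(1,2)[of k] q0[of k] r by (simp add: ennreal_less_iff)
      ultimately have "N r w = Y w" by (simp add: LIMSEQ_const_iff)
      then show "X r w = 0" using r by (simp add: X_def Y_def e_real)
    qed
  qed

  \<comment> \<open>A level that is never reached gives infinity, the infimum of the empty
    set.\<close>
  define hit where "hit c w = Inf {ennreal t | t. 0 \<le> t \<and> X t w \<le> c}" for c w
  have hit_le: "hit c w \<le> ennreal t" if "0 \<le> t" "X t w \<le> c" for c w t
    unfolding hit_def using that by (intro Inf_lower) auto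
  have hit_attained: "\<exists>s\<ge>0. hit c w = ennreal s \<and> X s w \<le> c" if fin: "hit c w < \<top>" for c w
  proof -
    define K where "K = {t. 0 \<le> t \<and> X t w \<le> c}"
    have "closed ({0..} \<inter> (\<lambda>t. X t w) -` {..c})"
      by (rule continuous_closed_preimage[OF Xc]) auto
    then have K: "closed K" by (simp add: K_def Int_def)
    have ne: "K \<noteq> {}"
    proof
      assume "K = {}"
      then have "hit c w = Inf {}"
        unfolding hit_def by (intro arg_cong[where f=Inf]) (auto simp: K_def)
      then show False using fin by simp
    qed
    have bb: "bdd_below K" by (auto simp: K_def intro!: bdd_belowI[of _ 0])
    have I: "Inf K \<in> K" by (rule closed_contains_Inf[OF ne bb K])
    have "ennreal (Inf K) \<le> hit c w"
      unfolding hit_def using bb by (intro Inf_greatest) (auto simp: K_def intro!: ennreal_leI cInf_lower)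
    moreover have "hit c w \<le> ennreal (Inf K)" using I by (intro hit_le) (auto simp: K_def)
    ultimately show ?thesis using I by (intro exI[of _ "Inf K"]) (auto simp: K_def)
  qed
  \<comment> \<open>Continuity replaces a real time by countably many times with slack
    \<open>1 / Suc m\<close>. The endpoint \<open>t\<close> is listed separately, since a hit
    exactly at \<open>t\<close> is approximated from the right only by times not yet
    observable.\<close>
  have hit_iff: "hit c w \<le> ennreal t \<longleftrightarrow> (\<forall>m. \<exists>q\<in>insert t (\<rat> \<inter> {0..t}). X q w < c + 1 / real (Suc m))" (is "_ \<longleftrightarrow> ?R")
    if t: "0 \<le> t" for c t w
  proof
    assume le: "hit c w \<le> ennreal t"
    then have "hit c w < \<top>" using le_less_trans ennreal_less_top by blast
    from hit_attained[OF this] obtain s where s: "0 \<le> s" "hit c w = ennreal s" "X s w \<le> c" by auto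
    have st: "s \<le> t" using le s t by (simp add: ennreal_le_iff)
    show ?R
    proof
      fix m
      have lt: "X s w < c + 1 / real (Suc m)" using s(3) by (rule le_less_trans) simp
      show "\<exists>q\<in>insert t (\<rat> \<inter> {0..t}). X q w < c + 1 / real (Suc m)"
      proof (cases "s = t")
        case False
        from Rats_sequence_above_continuous[OF Xc s(1), of w] obtain q
          where q: "\<And>k. q k \<in> \<rat>" "\<And>k. s < q k" "q \<longlonglongrightarrow> s" and "(\<lambda>k. X (q k) w) \<longlonglongrightarrow> X s w" by metis
        have q0: "0 \<le> q k" for k using q(2)[of k] s by simp
        from \<open>(\<lambda>k. X (q k) w) \<longlonglongrightarrow> X s w\<close> have "\<forall>\<^sub>F k in sequentially. X (q k) w < c + 1 / real (Suc m)" using lt by (rule order_tendstoD(2))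
        moreover have "\<forall>\<^sub>F k in sequentially. q k < t" using q(3) by (rule order_tendstoD(2)) (use st False in simp)
        ultimately have "\<forall>\<^sub>F k in sequentially. X (q k) w < c + 1 / real (Suc m) \<and> q k < t" by (rule eventually_conj)
        then obtain k where "X (q k) w < c + 1 / real (Suc m)" "q k < t"
          using eventually_happens'[OF sequentially_bot] by blast
        then show ?thesis using q(1)[of k] q0[of k] by (intro bexI[of _ "q k"]) auto
      qed (use lt in auto)
    qed
  next
    assume R: ?R
    have "\<exists>s\<in>{0..t}. \<forall>y\<in>{0..t}. X s w \<le> X y w"
      by (rule continuous_attains_inf) (use t in \<open>auto intro: continuous_on_subset[OF Xc]\<close>)
    then obtain s where s: "s \<in> {0..t}" "\<And>y. y \<in> {0..t} \<Longrightarrow> X s w \<le> X y w" by auto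
    have "X s w \<le> c + 1 / real (Suc m)" for m
    proof -
      obtain q where "q \<in> insert t (\<rat> \<inter> {0..t})" "X q w < c + 1 / real (Suc m)" using R by blast
      moreover then have "X s w \<le> X q w" using t by (intro s(2)) auto
      ultimately show ?thesis by linarith
    qed
    moreover have "(\<lambda>m. c + 1 / real (Suc m)) \<longlonglongrightarrow> c + 0"
      by (intro tendsto_add tendsto_const LIMSEQ_Suc[OF lim_1_over_n])
    ultimately have "X s w \<le> c + 0" by (intro LIMSEQ_le_const) auto
    then have "hit c w \<le> ennreal s" using s by (intro hit_le) auto
    also have "\<dots> \<le> ennreal t" using s by (intro ennreal_leI) auto
    finally show "hit c w \<le> ennreal t" .
  qed
  have hit_stopping: "{w\<in>space M. hit c w \<le> ennreal t} \<in> sets (G (ennreal t))" if t: "0 \<le> t" for c t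
  proof -
    have "{w\<in>space M. hit c w \<le> ennreal t} =
        (\<Inter>m. \<Union>q\<in>insert t (\<rat> \<inter> {0..t}). {w\<in>space (G (ennreal t)). X q w < c + 1 / real (Suc m)})"
      unfolding hit_iff[OF t] by auto
    also have "\<dots> \<in> sets (G (ennreal t))"
    proof (intro sets.countable_INT sets.countable_UN'' image_subsetI)
      show "countable (insert t (\<rat> \<inter> {0..t}))"
        by (auto intro: countable_Rats_Int)
      fix m q assume q: "q \<in> insert t (\<rat> \<inter> {0..t})"
      then have "N q \<in> borel_measurable (G (ennreal t))"
        using t by (intro measurable_G_mono[OF Nm[of q]]) (auto intro: ennreal_leI)
      then have "X q \<in> borel_measurable (G (ennreal t))" unfolding X_def by measurable
      then show "{w\<in>space (G (ennreal t)). X q w < c + 1 / real (Suc m)} \<in> sets (G (ennreal t))"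
        by measurable
    qed simp
    finally show ?thesis .
  qed
  define S where "S n = hit (1 / real (Suc n))" for n :: nat
  define \<rho> where "\<rho> = hit 0"
  have hit_anti: "hit c w \<le> hit d w" if "d \<le> c" for c d w
    unfolding hit_def using that by (intro Inf_superset_mono) auto
  have S_le: "S n w \<le> \<rho> w" for n w unfolding S_def \<rho>_def by (rule hit_anti) simp
  have S_inc: "incseq (\<lambda>n. S n w)" for w
    unfolding S_def by (intro incseq_SucI hit_anti) (simp add: frac_le)
  have \<rho>: "optional_time \<rho>" unfolding \<rho>_def by (rule optional_timeI_le[OF hit_stopping])
  have \<rho>m[measurable]: "\<rho> \<in> borel_measurable M" by (rule measurable_G_in_M[OF measurable_optional_time[OF \<rho>]])
  have \<rho>_le: "AE w in M. \<rho> w \<le> \<tau> w"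
    using N_at
  proof eventually_elim
    case (elim w)
    then show ?case by (cases "\<tau> w") (auto simp: \<rho>_def intro!: hit_le)
  qed
  have int_N: "(\<integral>\<^sup>+w\<in>A. ennreal (N t w) \<partial>M) \<le> (\<integral>\<^sup>+w\<in>A. ennreal (Y w) \<partial>M)"
    if t: "0 \<le> t" and A: "A \<in> sets (G (ennreal t))" for t A
  proof -
    have AM[measurable]: "A \<in> sets M" using sets_G_in_M[OF A] .
    have Nti: "integrable M (N t)"
      by (rule integrable_cong_AE_imp[OF G.real_cond_exp_int(1)[OF Yi, of "ennreal t"] measurable_G_in_M[OF Nm[OF t]]])
         (use Ne[OF t] in \<open>auto elim!: eventually_mono\<close>)
    have "(\<integral>\<^sup>+w\<in>A. ennreal (N t w) \<partial>M) = (\<integral>\<^sup>+w. ennreal (indicator A w * N t w) \<partial>M)"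
      by (intro nn_integral_cong) (auto simp: indicator_def)
    also have "\<dots> = ennreal (\<integral>w. indicator A w * N t w \<partial>M)"
      using integrable_mult_indicator[OF AM Nti] N0[OF t]
      by (intro nn_integral_eq_integral) (auto simp: indicator_def elim!: eventually_mono)
    also have "(\<integral>w. indicator A w * N t w \<partial>M) = (\<integral>w\<in>A. cexp t Y w \<partial>M)"
      unfolding set_lebesgue_integral_def using Ne[OF t] measurable_G_in_M[OF Nm[OF t]]
      by (intro integral_cong_AE) (auto elim!: eventually_mono)
    also have "\<dots> = (\<integral>w. indicator A w * Y w \<partial>M)"
      using G.real_cond_exp_intA[OF Yi A] by (simp add: set_lebesgue_integral_def)
    also have "ennreal \<dots> = (\<integral>\<^sup>+w. ennreal (indicator A w * Y w) \<partial>M)"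
      using integrable_mult_indicator[OF AM Yi] Yb
      by (intro nn_integral_eq_integral[symmetric]) (auto simp: indicator_def)
    also have "\<dots> = (\<integral>\<^sup>+w\<in>A. ennreal (Y w) \<partial>M)"
      by (intro nn_integral_cong) (auto simp: indicator_def)
    finally show ?thesis by simp
  qed
  have "(\<integral>\<^sup>+w. ennreal (e (\<rho> w)) \<partial>M)
      \<le> (\<integral>\<^sup>+w\<in>{w\<in>space M. \<rho> w < \<top>}. liminf (\<lambda>n. ennreal (N (grid n (enn2real (\<rho> w))) w)) \<partial>M)"
  \<comment> \<open>At a finite \<open>\<rho>\<close> the gap \<open>X\<close> is at most 0, so
    \<open>e (\<rho> w)\<close> is at most \<open>N\<close> there, and continuity makes
    \<open>N\<close> the limit along the grid; at infinity both sides are 0.\<close>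
  proof (rule nn_integral_mono)
    fix w assume w: "w \<in> space M"
    show "ennreal (e (\<rho> w)) \<le> liminf (\<lambda>n. ennreal (N (grid n (enn2real (\<rho> w))) w)) * indicator {w\<in>space M. \<rho> w < \<top>} w"
    proof (cases "\<rho> w < \<top>")
      case True
      obtain s where s: "0 \<le> s" "\<rho> w = ennreal s" "X s w \<le> 0"
        using hit_attained[of 0 w] True by (auto simp: \<rho>_def)
      have "(\<lambda>n. N (grid n s) w) \<longlonglongrightarrow> N s w"
        using s less_imp_le[OF le_less_trans[OF s(1) grid_greater]]
        by (intro continuous_on_tendsto_compose[OF Nc grid_tendsto]) auto
      then have "(\<lambda>n. ennreal (N (grid n s) w)) \<longlonglongrightarrow> ennreal (N s w)" by (rule tendsto_ennrealI)
      then have "liminf (\<lambda>n. ennreal (N (grid n s) w)) = ennreal (N s w)"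
        by (rule lim_imp_Liminf[OF sequentially_bot])
      moreover have "e (\<rho> w) \<le> N s w" using s by (simp add: e_real X_def)
      ultimately show ?thesis using True w s by (simp add: ennreal_leI)
    qed (simp add: e_def less_top[symmetric])
  qed
  also have "\<dots> \<le> (\<integral>\<^sup>+w\<in>{w\<in>space M. \<rho> w < \<top>}. ennreal (Y w) \<partial>M)"
    by (rule nn_integral_grid_le[OF \<rho> _ _ int_N]) (use measurable_G_in_M[OF Nm] in measurable)
  also have "\<dots> \<le> (\<integral>\<^sup>+w. ennreal (Y w) \<partial>M)"
    by (intro nn_integral_mono) (auto simp: indicator_def)
  finally have "(\<integral>\<^sup>+w. ennreal (e (\<rho> w)) \<partial>M) \<le> (\<integral>\<^sup>+w. ennreal (Y w) \<partial>M)" .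
  moreover have e\<rho>i: "integrable M (\<lambda>w. e (\<rho> w))"
    by (rule integrable_const_bound[where B=1]) (use eb in auto)
  ultimately have "expectation (\<lambda>w. e (\<rho> w)) \<le> expectation Y"
    using Yi eb Yb by (subst (asm) (1 2) nn_integral_eq_integral) (auto simp: ennreal_le_iff Bochner_Integration.integral_nonneg)
  moreover have nn: "AE w in M. 0 \<le> e (\<rho> w) - Y w"
    using \<rho>_le by eventually_elim (simp add: Y_def e_anti)
  moreover have di: "integrable M (\<lambda>w. e (\<rho> w) - Y w)" using e\<rho>i Yi by auto
  ultimately have "expectation (\<lambda>w. e (\<rho> w) - Y w) = 0"
    using integral_nonneg_AE[OF nn] e\<rho>i Yi by simp
  then have "AE w in M. e (\<rho> w) - Y w = 0"
    using integral_nonneg_eq_0_iff_AE[OF di nn] by simp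
  then have \<rho>_eq: "AE w in M. \<rho> w = \<tau> w"
    by eventually_elim (auto simp: Y_def intro: e_inj)
  \<comment> \<open>If the increasing times \<open>S n\<close> have a finite supremum, the gap is at
    most 0 there by continuity, so \<open>\<rho>\<close> is no later.\<close>
  have S_lim: "(\<lambda>n. S n w) \<longlonglongrightarrow> \<rho> w" for w
  proof -
    have "(\<lambda>n. S n w) \<longlonglongrightarrow> (SUP n. S n w)" using S_inc by (rule LIMSEQ_SUP)
    moreover have "(SUP n. S n w) = \<rho> w"
    proof (rule antisym)
      show "(SUP n. S n w) \<le> \<rho> w" by (rule SUP_least) (rule S_le)
      show "\<rho> w \<le> (SUP n. S n w)"
      proof (cases "(SUP n. S n w)")
        case (real s)
        have "S n w < \<top>" for n using SUP_upper[of n UNIV "\<lambda>n. S n w"] real le_less_trans ennreal_less_top by fastforce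
        then have "\<forall>n. \<exists>s\<ge>0. S n w = ennreal s \<and> X s w \<le> 1 / real (Suc n)"
          using hit_attained unfolding S_def by blast
        then obtain s' where s': "\<And>n. 0 \<le> s' n" "\<And>n. S n w = ennreal (s' n)" "\<And>n. X (s' n) w \<le> 1 / real (Suc n)"
          by metis
        have "(\<lambda>n. ennreal (s' n)) \<longlonglongrightarrow> ennreal s"
          using LIMSEQ_SUP[OF S_inc[of w]] real s'(2) by simp
        then have "s' \<longlonglongrightarrow> s" using s' real by (subst (asm) tendsto_ennreal_iff) auto
        then have "(\<lambda>n. X (s' n) w) \<longlonglongrightarrow> X s w"
          using s' real by (intro continuous_on_tendsto_compose[OF Xc]) auto
        moreover have "(\<lambda>n. 1 / real (Suc n)) \<longlonglongrightarrow> 0" by (rule LIMSEQ_Suc[OF lim_1_over_n])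
        ultimately have "X s w \<le> 0" by (rule LIMSEQ_le) (use s'(3) in auto)
        then show ?thesis unfolding real(2) \<rho>_def using real(1) by (intro hit_le)
      next
        case top
        then show ?thesis by (simp only: top_greatest)
      qed
    qed
    ultimately show ?thesis by simp
  qed
  have "AE w in M. incseq (\<lambda>n. S n w) \<and> (\<lambda>n. S n w) \<longlonglongrightarrow> \<tau> w \<and> (\<tau> w > 0 \<longrightarrow> (\<forall>n. S n w < \<tau> w))"
    using \<rho>_eq N_nonneg N_at
  proof eventually_elim
    case (elim w)
    \<comment> \<open>A finite positive \<open>\<tau>\<close> is a zero of the continuous gap, which
      is therefore small already shortly before.\<close>
    have "S n w < \<tau> w" if pos: "\<tau> w > 0" for n
    proof (cases "\<tau> w")
      case (real r)
      then have r: "0 < r" using pos by (simp add: ennreal_zero_less_mult_iff)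
      have X0: "X r w = 0" using elim(3) real by simp
      have "(\<lambda>k. r - r * (1 / real (Suc k))) \<longlonglongrightarrow> r - r * 0"
        by (intro tendsto_diff tendsto_mult tendsto_const LIMSEQ_Suc[OF lim_1_over_n])
      then have lim: "(\<lambda>k. r - r * (1 / real (Suc k))) \<longlonglongrightarrow> r" by simp
      have ge0: "0 \<le> r - r * (1 / real (Suc k))" for k
        using r by (simp add: field_simps)
      have "(\<lambda>k. X (r - r * (1 / real (Suc k))) w) \<longlonglongrightarrow> X r w"
        using ge0 r by (intro continuous_on_tendsto_compose[OF Xc lim]) auto
      then have "\<forall>\<^sub>F k in sequentially. X (r - r * (1 / real (Suc k))) w < 1 / real (Suc n)"
        unfolding X0 by (rule order_tendstoD(2)) simp
      then obtain k where k: "X (r - r * (1 / real (Suc k))) w < 1 / real (Suc n)"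
        using eventually_happens'[OF sequentially_bot] by blast
      have "S n w \<le> ennreal (r - r * (1 / real (Suc k)))"
        unfolding S_def using k ge0 by (intro hit_le) auto
      also have "\<dots> < ennreal r" using r ge0[of k] by (subst ennreal_less_iff) auto
      finally show ?thesis using real by simp
    next
      case top
      \<comment> \<open>For infinite \<open>\<tau>\<close> each level is still reached in finite
        time: \<open>N\<close> is nonnegative, so the gap is at most \<open>exp (- t)\<close>, which
        is \<open>1 / Suc n\<close> at this time.\<close>
      have "0 \<le> ln (real (Suc n))" by simp
      moreover have "X (ln (real (Suc n))) w \<le> 1 / real (Suc n)"
        using elim(2) \<open>0 \<le> ln (real (Suc n))\<close> by (simp add: X_def exp_minus inverse_eq_divide del: of_nat_Suc)
      ultimately have "S n w \<le> ennreal (ln (real (Suc n)))"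
        unfolding S_def by (rule hit_le)
      also have "\<dots> < \<top>" by simp
      finally show ?thesis using top by simp
    qed
    then show ?case using S_inc S_lim[of w] elim(1) by simp
  qed
  note announces = this
  have "{w\<in>space M. S n w \<le> ennreal t} \<in> sets (G (ennreal t))" if "0 \<le> t" for n t
    using hit_stopping[OF that] by (simp only: S_def)
  then show ?thesis by (intro exI[of _ S] conjI allI impI announces)
qed

subsection \<open>Drift to infinity and absence of isolated last minima\<close>

lemma increment_moments:
  assumes "0 \<le> t" "t < u"
  shows "integrable M (\<lambda>w. B u w - B t w)" "expectation (\<lambda>w. B u w - B t w) = 0"
    "integrable M (\<lambda>w. (B u w - B t w)\<^sup>2)" "expectation (\<lambda>w. (B u w - B t w)\<^sup>2) = u - t"
proof -
  note D = normal_increments[OF assms]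
  have pos: "0 < sqrt (u - t)" using assms by simp
  show "integrable M (\<lambda>w. B u w - B t w)"
    using distributed_integrable_var[OF D] integrable_normal_moment_nz_1[OF pos, of 0] by simp
  show E: "expectation (\<lambda>w. B u w - B t w) = 0"
    by (rule normal_distributed_expectation[OF pos D])
  show "integrable M (\<lambda>w. (B u w - B t w)\<^sup>2)"
    using distributed_integrable[OF D, of "\<lambda>x. x\<^sup>2"] integrable_normal_moment[OF pos, of 0 2] by simp
  show "expectation (\<lambda>w. (B u w - B t w)\<^sup>2) = u - t"
    using normal_distributed_variance[OF pos D] E assms by simp
qed

lemma expectation_abs_increment_le:
  assumes "0 \<le> t" "t < u"
  shows "expectation (\<lambda>w. \<bar>B u w - B t w\<bar>) \<le> sqrt (u - t)"
proof -
  note m = increment_moments[OF assms]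
  \<comment> \<open>The standard deviation minimises the expectation of
    \<open>x^2 / (2 * a) + a / 2\<close>, a bound for the modulus of \<open>x\<close> that stands in
    for Cauchy-Schwarz.\<close>
  define a where "a = sqrt (u - t)"
  have a: "0 < a" "a\<^sup>2 = u - t" using assms by (auto simp: a_def)
  have "\<bar>x\<bar> \<le> 1 / (2 * a) * x\<^sup>2 + a / 2" for x :: real
  proof -
    have "0 \<le> (\<bar>x\<bar> - a)\<^sup>2" by simp
    then have "2 * a * \<bar>x\<bar> \<le> x\<^sup>2 + a\<^sup>2" by (simp add: power2_diff algebra_simps)
    then show ?thesis using a(1) by (simp add: field_simps power2_eq_square)
  qed
  then have "expectation (\<lambda>w. \<bar>B u w - B t w\<bar>) \<le> expectation (\<lambda>w. 1 / (2 * a) * (B u w - B t w)\<^sup>2 + a / 2)"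
    using m by (intro integral_mono) auto
  also have "\<dots> = 1 / (2 * a) * (u - t) + a / 2"
    using m by (simp add: prob_space)
  also have "\<dots> = a" using a by (simp add: field_simps power2_eq_square flip: a(2))
  finally show ?thesis by (simp add: a_def)
qed

lemma integrable_B:
  assumes "0 < u"
  shows "integrable M (B u)"
proof (rule integrable_cong_AE_imp[OF increment_moments(1)[OF order_refl assms]])
  show "B u \<in> borel_measurable M" using random_variable_B assms by simp
  show "AE w in M. B u w - B 0 w = B u w" using start_B by eventually_elim simp
qed

lemma cexp_B:
  assumes "0 \<le> t" "t \<le> u" "0 < u"
  shows "AE w in M. B t w = cexp t (B u) w"
proof -
  have m: "B t \<in> borel_measurable (G (ennreal t))" using assms by (intro measurable_completed_natural_filtration) auto
  have i: "integrable M (B t)"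
  proof (cases "t = 0")
    case True
    show ?thesis
      by (rule integrable_cong_AE_imp[of M "\<lambda>_. 0 :: real"])
         (use True start_B measurable_G_in_M[OF m] in \<open>auto elim!: eventually_mono\<close>)
  qed (use integrable_B assms in auto)
  have "AE w in M. cexp t (B u) w = B t w"
  proof (rule G.real_cond_exp_charact[OF _ integrable_B[OF assms(3)] i m])
    fix A assume A: "A \<in> sets (G (ennreal t))"
    have AM: "A \<in> sets M" using sets_G_in_M[OF A] .
    have "(\<integral>w. indicator A w * (B u w - B t w) \<partial>M) = 0"
    proof (cases "t = u")
      case False
      then have tu: "t < u" using assms by simp
      have "indep_var borel (\<lambda>w. indicator A w :: real) borel (\<lambda>w. id (B u w - B t w))"
        by (rule indep_var_increment[OF assms(1,2)]) (use A in auto)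
      then have "(\<integral>w. indicator A w * (B u w - B t w) \<partial>M) = expectation (\<lambda>w. indicator A w) * expectation (\<lambda>w. B u w - B t w)"
        using increment_moments(1)[OF assms(1) tu] AM
        by (intro indep_var_lebesgue_integral integrable_real_indicator) (auto simp: emeasure_eq_measure)
      then show ?thesis using increment_moments(2)[OF assms(1) tu] by simp
    qed simp
    moreover have "(\<integral>w. indicator A w * (B u w - B t w) \<partial>M) = (\<integral>w\<in>A. B u w \<partial>M) - (\<integral>w\<in>A. B t w \<partial>M)"
      using integrable_mult_indicator[OF AM integrable_B[OF assms(3)]] integrable_mult_indicator[OF AM i]
      by (simp add: set_lebesgue_integral_def right_diff_distrib)
    ultimately show "(\<integral>w\<in>A. B u w \<partial>M) = (\<integral>w\<in>A. B t w \<partial>M)" by simp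
  qed
  then show ?thesis by eventually_elim simp
qed

text \<open>The maximal inequality on \<open>[0, 4 ^ Suc n]\<close> at level \<open>(\<mu> / 2) * 4 ^ n\<close> and the Borel--Cantelli lemma.\<close>

lemma AE_drifted_at_top:
  assumes \<mu>: "0 < \<mu>"
  shows "AE w in M. filterlim (\<lambda>t. drifted B \<mu> t w) at_top at_top"
proof -
  \<comment> \<open>Half of the drift at time \<open>4 ^ n\<close>. The expected modulus of B at
    \<open>4 ^ Suc n\<close> is at most \<open>2 * 2 ^ n\<close>, so the failure probabilities are
    at most \<open>(4 / \<mu>) * (1/2) ^ n\<close>.\<close>
  define c where "c n = \<mu> / 2 * 4 ^ n" for n :: nat
  define D where "D n = \<rat> \<inter> {0..4 ^ Suc n :: real}" for n
  define E where "E n = {w\<in>space M. \<exists>q\<in>D n. \<bar>B q w\<bar> > c n}" for n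
  have c0: "0 < c n" for n using \<mu> by (simp add: c_def)
  have D: "countable (D n)" for n unfolding D_def by (rule countable_Rats_Int)
  have EM: "E n \<in> sets M" for n
  proof -
    have "E n = (\<Union>q\<in>D n. {w\<in>space M. \<bar>B q w\<bar> > c n})" by (auto simp: E_def)
    also have "\<dots> \<in> sets M"
    proof (rule sets.countable_UN''[OF D])
      fix q assume "q \<in> D n"
      then have [measurable]: "B q \<in> borel_measurable M" using random_variable_B by (auto simp: D_def)
      show "{w\<in>space M. \<bar>B q w\<bar> > c n} \<in> sets M" by measurable
    qed
    finally show ?thesis .
  qed
  have Ep: "prob (E n) \<le> (4 / \<mu>) * (1/2) ^ n" for n
  proof -
    have "prob (E n) \<le> expectation (\<lambda>w. \<bar>B (4 ^ Suc n) w\<bar>) / c n"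
      unfolding E_def
    proof (rule maximal_inequality[OF _ D _ _ c0])
      show "integrable M (B (4 ^ Suc n))" by (rule integrable_B) simp
      fix t assume t: "t \<in> D n"
      show "B t \<in> borel_measurable (G (ennreal t))"
        using t by (intro measurable_completed_natural_filtration) (auto simp: D_def)
      show "AE w in M. B t w = cexp t (B (4 ^ Suc n)) w"
        using t by (intro cexp_B) (auto simp: D_def)
    qed
    also have "expectation (\<lambda>w. \<bar>B (4 ^ Suc n) w\<bar>) = expectation (\<lambda>w. \<bar>B (4 ^ Suc n) w - B 0 w\<bar>)"
      using start_B random_variable_B[of "4 ^ Suc n"] random_variable_B[of 0]
      by (intro integral_cong_AE) (auto elim!: eventually_mono)
    also have "\<dots> \<le> sqrt (4 ^ Suc n - 0)" by (rule expectation_abs_increment_le) auto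
    also have "sqrt (4 ^ Suc n - 0) = 2 * 2 ^ n"
    proof -
      have "(4::real) ^ Suc n = (2 * 2 ^ n)\<^sup>2" by (induction n) (auto simp: power2_eq_square)
      then show ?thesis by (simp only: diff_zero real_sqrt_abs) simp
    qed
    also have "2 * 2 ^ n / c n = (4 / \<mu>) * (1/2) ^ n"
    proof -
      have "(4::real) ^ n = 2 ^ n * 2 ^ n" by (simp flip: power_mult_distrib)
      then show ?thesis using \<mu> by (simp add: c_def field_simps power_one_over)
    qed
    finally show ?thesis using c0[of n] by (simp add: divide_right_mono)
  qed
  have "AE w in M. eventually (\<lambda>n. w \<in> space M - E n) sequentially"
  proof (rule borel_cantelli_AE1)
    show "summable (\<lambda>n. prob (E n))"
      by (rule summable_comparison_test'[of "\<lambda>n. (4 / \<mu>) * (1/2) ^ n" 0])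
         (use Ep in \<open>auto intro!: summable_mult summable_geometric\<close>)
  qed (use EM in \<open>auto simp: emeasure_eq_measure\<close>)
  with AE_continuous_B show ?thesis
  proof eventually_elim
    case (elim w)
    from elim(2) obtain n0 where n0: "\<And>n. n0 \<le> n \<Longrightarrow> w \<in> space M - E n"
      by (auto simp: eventually_sequentially)
    have bound: "\<bar>B t w\<bar> \<le> c n" if n: "n0 \<le> n" and t: "0 \<le> t" "t < 4 ^ Suc n" for n t
    proof -
      from Rats_sequence_above_continuous[OF continuous_on_continuous_B t(1), of w] obtain q
        where q: "\<And>k. q k \<in> \<rat>" "\<And>k. t < q k" "q \<longlonglongrightarrow> t"
          and lim: "(\<lambda>k. continuous_B (q k) w) \<longlonglongrightarrow> continuous_B t w" by metis
      have q0: "0 \<le> q k" for k using q(2)[of k] t by simp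
      from lim have "(\<lambda>k. \<bar>B (q k) w\<bar>) \<longlonglongrightarrow> \<bar>B t w\<bar>" using elim(1) by (intro tendsto_rabs) simp
      moreover have "\<forall>\<^sub>F k in sequentially. \<bar>B (q k) w\<bar> \<le> c n"
        using order_tendstoD(2)[OF q(3) t(2)]
      proof eventually_elim
        case (elim k)
        then have "q k \<in> D n" using q(1) q0 by (auto simp: D_def)
        then show ?case using n0[OF n] by (auto simp: E_def not_less)
      qed
      ultimately show ?thesis by (rule tendsto_upperbound) simp
    qed
    \<comment> \<open>For \<open>4 ^ n \<le> t < 4 ^ Suc n\<close> the Brownian part is at most half
      of the drift \<open>\<mu> * t\<close> in modulus; the slope \<open>\<mu> / 8\<close> is a
      comfortable weakening.\<close>
    have lower: "\<mu> / 8 * t \<le> drifted B \<mu> t w" if t: "4 ^ n0 \<le> t" for t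
    proof -
      have t0: "0 < t" using t by (rule less_le_trans[rotated]) simp
      obtain m :: nat where "t < 4 ^ m" using real_arch_pow[of 4 t] by auto
      define m where "m = (LEAST m. t < 4 ^ m)"
      have m1: "t < 4 ^ m" unfolding m_def using \<open>t < 4 ^ _\<close> by (rule LeastI)
      have "n0 < m"
      proof (rule ccontr)
        assume "\<not> n0 < m"
        then have "(4::real) ^ m \<le> 4 ^ n0" by (intro power_increasing) auto
        then show False using m1 t by linarith
      qed
      then obtain n where n: "m = Suc n" "n0 \<le> n" by (cases m) auto
      have m2: "4 ^ n \<le> t" using not_less_Least[of n "\<lambda>m. t < 4 ^ m"] n(1) by (simp add: m_def not_less)
      have "- c n \<le> B t w" using bound[OF n(2), of t] m1 n(1) t0 by simp
      moreover have "c n \<le> \<mu> / 2 * t" using m2 \<mu> by (simp add: c_def)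
      moreover have "0 < \<mu> * t" using \<mu> t0 by simp
      ultimately show ?thesis unfolding drifted_def by simp
    qed
    have "filterlim (\<lambda>t. \<mu> / 8 * t) at_top at_top"
      using \<mu> by (intro filterlim_tendsto_pos_mult_at_top[OF tendsto_const _ filterlim_ident]) simp
    then show ?case
      by (rule filterlim_at_top_mono)
         (use lower in \<open>auto simp: eventually_at_top_linorder\<close>)
  qed
qed

section \<open>Immediate descent after an optional time\<close>

lemma prob_standard_increment_le_pos: "0 < prob {w\<in>space M. B 1 w - B 0 w \<le> -2}"
proof -
  have D: "distributed M lborel (\<lambda>w. B 1 w - B 0 w) (normal_density 0 (sqrt (1 - 0)))"
    by (rule normal_increments) auto
  have "emeasure M ((\<lambda>w. B 1 w - B 0 w) -` {..-2} \<inter> space M) \<noteq> 0"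
  proof
    assume "emeasure M ((\<lambda>w. B 1 w - B 0 w) -` {..-2} \<inter> space M) = 0"
    then have "(\<integral>\<^sup>+x. ennreal (normal_density 0 (sqrt (1 - 0)) x) * indicator {..-2} x \<partial>lborel) = 0"
      using distributed_emeasure[OF D, of "{..-2}"] by simp
    then have "AE x in lborel. ennreal (normal_density 0 (sqrt (1 - 0)) x) * indicator {..-2} x = 0"
      by (subst (asm) nn_integral_0_iff_AE) auto
    then have "AE x in lborel. x \<notin> {-3..-2::real}"
    proof eventually_elim
      case (elim x)
      have "0 < normal_density 0 (sqrt (1 - 0)) x" by (rule normal_density_pos) simp
      then show ?case using elim by (auto simp: indicator_def split: if_splits)
    qed
    then have "{-3..-2::real} \<in> null_sets lborel" using Measure_Space.AE_iff_null_sets[of "{-3..-2::real}" lborel] by simp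
    then show False by (auto simp: null_sets_def)
  qed
  moreover have "(\<lambda>w. B 1 w - B 0 w) -` {..-2} \<inter> space M = {w\<in>space M. B 1 w - B 0 w \<le> -2}" by auto
  ultimately show ?thesis by (simp add: emeasure_eq_measure zero_less_measure_iff)
qed

text \<open>By Brownian scaling the chance of not falling by twice the standard deviation is the
  same on all intervals, which gives one bound below 1 valid at every time scale.\<close>

lemma prob_increment_gt:
  assumes "0 \<le> t" "t < u"
  shows "prob {w\<in>space M. B u w - B t w > - (2 * sqrt (u - t))} = 1 - prob {w\<in>space M. B 1 w - B 0 w \<le> -2}"
proof -
  have m[measurable]: "B u \<in> borel_measurable M" "B t \<in> borel_measurable M" "B 1 \<in> borel_measurable M" "B 0 \<in> borel_measurable M"
    using random_variable_B assms by auto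
  let ?v = "sqrt (u - t)"
  have v: "0 < ?v" using assms by simp
  have "prob {w\<in>space M. B u w - B t w > - (2 * ?v)} = measure (distr M borel (\<lambda>w. B u w - B t w)) {- (2 * ?v)<..}"
    by (subst measure_distr) (auto intro!: arg_cong[where f=prob])
  also have "\<dots> = measure (distr M borel (\<lambda>w. ?v * (B 1 w - B 0 w))) {- (2 * ?v)<..}"
    by (simp only: distr_increment_eq[OF assms])
  also have "\<dots> = prob ((\<lambda>w. ?v * (B 1 w - B 0 w)) -` {- (2 * ?v)<..} \<inter> space M)"
    by (subst measure_distr) auto
  also have "(\<lambda>w. ?v * (B 1 w - B 0 w)) -` {- (2 * ?v)<..} \<inter> space M = space M - {w\<in>space M. B 1 w - B 0 w \<le> -2}"
  proof -
    have "- (2 * ?v) < ?v * x \<longleftrightarrow> \<not> x \<le> -2" for x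
      using mult_less_cancel_left_pos[OF v, of "-2" x] by (simp add: mult.commute not_le)
    then show ?thesis by auto
  qed
  also have "prob \<dots> = 1 - prob {w\<in>space M. B 1 w - B 0 w \<le> -2}"
    by (rule prob_compl) measurable
  finally show ?thesis .
qed

lemma prob_increment_ge:
  assumes "0 \<le> t" "t < u" "0 < a"
  shows "prob {w\<in>space M. a < B u w - B t w} \<le> (u - t) / a\<^sup>2"
proof -
  note m = increment_moments[OF assms(1,2)]
  have [measurable]: "B u \<in> borel_measurable M" "B t \<in> borel_measurable M"
    using random_variable_B assms by auto
  have "prob {w\<in>space M. a < B u w - B t w} \<le> prob {w\<in>space M. \<bar>(B u w - B t w) - expectation (\<lambda>w. B u w - B t w)\<bar> \<ge> a}"
    using m(2) by (intro finite_measure_mono) (auto, measurable)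
  also have "\<dots> \<le> variance (\<lambda>w. B u w - B t w) / a\<^sup>2"
    by (rule Chebyshev_inequality) (use m(3) assms in auto)
  finally show ?thesis using m by simp
qed

text \<open>The bounded quantity is an increment of the drifted process. Finitely many lags keep the
  event known at a later fixed time, and the tolerance \<open>\<eta>\<close> absorbs a start
  slightly after the time of interest.\<close>

definition no_drop :: "real \<Rightarrow> real set \<Rightarrow> real \<Rightarrow> real \<Rightarrow> 'a set" where
  "no_drop \<mu> S \<eta> t = {w\<in>space M. \<forall>s\<in>S. - \<eta> \<le> B (t + s) w - B t w + \<mu> * s}"

lemma no_drop_in_G:
  assumes "finite S" "S \<subseteq> {0<..\<delta>}" "0 \<le> t"
  shows "no_drop \<mu> S \<eta> t \<in> sets (G (ennreal (t + \<delta>)))"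
proof -
  have "no_drop \<mu> S \<eta> t = {w\<in>space (G (ennreal (t + \<delta>))). \<forall>s\<in>S. - \<eta> \<le> B (t + s) w - B t w + \<mu> * s}"
    by (simp add: no_drop_def)
  also have "\<dots> \<in> sets (G (ennreal (t + \<delta>)))"
  proof (intro sets.sets_Collect_finite_All assms(1))
    fix s assume "s \<in> S"
    then have s: "0 < s" "s \<le> \<delta>" using assms by auto
    have [measurable]: "B (t + s) \<in> borel_measurable (G (ennreal (t + \<delta>)))" "B t \<in> borel_measurable (G (ennreal (t + \<delta>)))"
      using s assms(3) by (auto intro!: measurable_completed_natural_filtration ennreal_leI)
    show "{w\<in>space (G (ennreal (t + \<delta>))). - \<eta> \<le> B (t + s) w - B t w + \<mu> * s} \<in> sets (G (ennreal (t + \<delta>)))"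
      by measurable
  qed
  finally show ?thesis .
qed

text \<open>Adding one time \<open>s\<close>, much larger than the previous ones, multiplies the probability by \<open>1 - c / 2\<close>:
  the increment over \<open>[t + s', t + s]\<close> is a fresh standard normal up to scale, and the Brownian motion
  has hardly moved on \<open>[t, t + s']\<close>.\<close>

lemma exists_no_drop_small:
  fixes n :: nat
  assumes \<mu>: "0 < \<mu>" and \<delta>: "0 < \<delta>"
  defines "c \<equiv> prob {w\<in>space M. B 1 w - B 0 w \<le> -2}"
  shows "\<exists>S \<eta>. finite S \<and> S \<subseteq> {0<..\<delta>} \<and> 0 < \<eta> \<and>
    (\<forall>t A. 0 \<le> t \<longrightarrow> A \<in> sets (G (ennreal t)) \<longrightarrow> prob (A \<inter> no_drop \<mu> S \<eta> t) \<le> (1 - c / 2) ^ n * prob A)"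
  using \<delta>
proof (induction n arbitrary: \<delta>)
  case 0
  have "prob (A \<inter> no_drop \<mu> {} 1 t) \<le> prob A" if "A \<in> sets (G (ennreal t))" for A t
    using sets_G_in_M[OF that] by (intro finite_measure_mono) auto
  then show ?case by (intro exI[of _ "{}"] exI[of _ 1]) auto
next
  case (Suc n)
  have c: "0 < c" "c \<le> 1" unfolding c_def using prob_standard_increment_le_pos by auto
  define p where "p = (1 - c / 2) ^ n"
  have p: "0 < p" unfolding p_def using c by (intro zero_less_power) simp
  \<comment> \<open>Small enough that the drift over a time \<open>s\<close> is at most a third of
    the standard deviation \<open>sqrt s\<close>.\<close>
  define s where "s = min \<delta> ((1 / (3 * \<mu>))\<^sup>2)"
  have s: "0 < s" "s \<le> \<delta>" "s \<le> (1 / (3 * \<mu>))\<^sup>2" using Suc.prems \<mu> by (auto simp: s_def)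
  have \<mu>s: "\<mu> * s \<le> sqrt s / 3"
  proof -
    have "sqrt s \<le> sqrt ((1 / (3 * \<mu>))\<^sup>2)" using s(3) by (rule real_sqrt_le_mono)
    also have "\<dots> = 1 / (3 * \<mu>)" using \<mu> by (simp only: real_sqrt_abs) simp
    finally have "\<mu> * sqrt s \<le> 1 / 3" using \<mu> by (simp add: field_simps)
    then have "\<mu> * sqrt s * sqrt s \<le> 1 / 3 * sqrt s" using s by (intro mult_right_mono) auto
    then show ?thesis using s by (simp add: mult.assoc)
  qed
  \<comment> \<open>The bound \<open>s / 2\<close> leaves at least half of the variance to the fresh
    increment; \<open>c * p * s / 18\<close> makes the Chebyshev bound \<open>9 * s' / s\<close> at
    most \<open>c * p / 2\<close>.\<close>
  define s' where "s' = min (s / 2) (c * p * s / 18)"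
  have s': "0 < s'" "s' \<le> s / 2" "s' \<le> c * p * s / 18" using s c p by (auto simp: s'_def)
  obtain S \<eta> where S: "finite S" "S \<subseteq> {0<..s'}" "0 < \<eta>"
    and IH: "\<And>t A. 0 \<le> t \<Longrightarrow> A \<in> sets (G (ennreal t)) \<Longrightarrow> prob (A \<inter> no_drop \<mu> S \<eta> t) \<le> p * prob A"
    using Suc.IH[OF s'(1)] unfolding p_def by blast
  define \<eta>' where "\<eta>' = min \<eta> (sqrt s / 3)"
  have "prob (A \<inter> no_drop \<mu> (insert s S) \<eta>' t) \<le> (1 - c / 2) ^ Suc n * prob A"
    if t: "0 \<le> t" and A: "A \<in> sets (G (ennreal t))" for t A
  proof -
    let ?E = "A \<inter> no_drop \<mu> S \<eta> t"
    let ?U = "{w\<in>space M. B (t + s') w - B t w \<in> {sqrt s / 3<..}}"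
    let ?V = "{w\<in>space M. B (t + s) w - B (t + s') w \<in> {- (2 * sqrt (t + s - (t + s')))<..}}"
    have EG: "?E \<in> sets (G (ennreal (t + s')))"
      using s' by (intro sets.Int no_drop_in_G S t sets_G_mono[OF _ A]) (auto intro: ennreal_leI)
    have [measurable]: "B (t + s) \<in> borel_measurable M" "B (t + s') \<in> borel_measurable M" "B t \<in> borel_measurable M"
      using random_variable_B t s s' by auto
    have AM: "A \<in> sets M" "?E \<in> sets M" using sets_G_in_M[OF A] sets_G_in_M[OF EG] by auto
    \<comment> \<open>An early rise, a drift and a tolerance of at most \<open>sqrt s / 3\<close>
      each leave the fresh increment at least \<open>- sqrt s\<close>, which is above minus twice
      its standard deviation.\<close>
    have sub: "A \<inter> no_drop \<mu> (insert s S) \<eta>' t \<subseteq> (A \<inter> ?U) \<union> (?E \<inter> ?V)"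
    proof
      fix w assume w: "w \<in> A \<inter> no_drop \<mu> (insert s S) \<eta>' t"
      then have wM: "w \<in> space M" by (auto simp: no_drop_def)
      have "w \<in> ?E" using w by (auto simp: no_drop_def \<eta>'_def)
      moreover have "w \<in> ?V" if "w \<notin> ?U"
      proof -
        have "B (t + s') w - B t w \<le> sqrt s / 3" using that wM by auto
        moreover have "- (sqrt s / 3) \<le> B (t + s) w - B t w + \<mu> * s"
          using w by (auto simp: no_drop_def \<eta>'_def)
        ultimately have "- sqrt s \<le> B (t + s) w - B (t + s') w" using \<mu>s by linarith
        moreover have "sqrt s < 2 * sqrt (s - s')"
        proof -
          have "s < 4 * (s - s')" using s(1) s'(2) by (simp add: algebra_simps)
          then have "sqrt s < sqrt (4 * (s - s'))" by (rule real_sqrt_less_mono)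
          also have "\<dots> = 2 * sqrt (s - s')" by (simp only: real_sqrt_mult real_sqrt_four)
          finally show ?thesis .
        qed
        ultimately show ?thesis using wM by simp
      qed
      ultimately show "w \<in> (A \<inter> ?U) \<union> (?E \<inter> ?V)" using w by blast
    qed
    have "?U \<in> sets M" "?V \<in> sets M" by measurable
    then have m: "A \<inter> ?U \<in> sets M" "?E \<inter> ?V \<in> sets M" using AM by blast+
    have "prob (A \<inter> no_drop \<mu> (insert s S) \<eta>' t) \<le> prob ((A \<inter> ?U) \<union> (?E \<inter> ?V))"
      by (rule finite_measure_mono[OF sub sets.Un[OF m]])
    also have "\<dots> \<le> prob (A \<inter> ?U) + prob (?E \<inter> ?V)"
      by (rule measure_Un_le[OF m])
    also have "prob (A \<inter> ?U) = prob A * prob ?U"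
      using s' t by (intro prob_Int_increment A) auto
    also have "prob ?U \<le> c * p / 2"
    proof -
      have "prob ?U \<le> (t + s' - t) / (sqrt s / 3)\<^sup>2"
        using prob_increment_ge[of t "t + s'" "sqrt s / 3"] s s' t by simp
      also have "\<dots> = 9 * s' / s" using s by (simp add: power_divide)
      also have "\<dots> \<le> c * p / 2" using s s'(3) by (simp add: field_simps)
      finally show ?thesis .
    qed
    also have "prob (?E \<inter> ?V) = prob ?E * prob ?V"
      using s s' t by (intro prob_Int_increment EG) auto
    also have "prob ?V = 1 - c"
      using prob_increment_gt[of "t + s'" "t + s"] s s' t by (simp add: c_def)
    also have "prob ?E \<le> p * prob A" by (rule IH[OF t A])
    finally have "prob (A \<inter> no_drop \<mu> (insert s S) \<eta>' t) \<le> prob A * (c * p / 2) + p * prob A * (1 - c)"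
      using c by (auto simp: mult_left_mono mult_right_mono)
    also have "\<dots> = (1 - c / 2) ^ Suc n * prob A" by (simp add: p_def algebra_simps)
    finally show ?thesis .
  qed
  moreover have "finite (insert s S)" "insert s S \<subseteq> {0<..\<delta>}" "0 < \<eta>'"
    using S s s' by (auto simp: \<eta>'_def)
  ultimately show ?case by blast
qed

text \<open>If the path stays above its value at \<open>\<tau>\<close>, then by right continuity the
  grid times close after \<open>\<tau>\<close> are followed by no drop of more than
  \<open>\<eta>\<close>. Discretisation bounds the probability of \<open>D\<close> by
  \<open>(1 - c / 2) ^ n\<close> for every \<open>n\<close>.\<close>

lemma optional_time_not_last_minimum:
  assumes \<mu>: "0 < \<mu>" and \<tau>: "optional_time \<tau>" and D: "D \<in> sets M"
    and last: "AE w in M. w \<in> D \<longrightarrow> (\<exists>r\<ge>0. \<tau> w = ennreal r \<and> (\<forall>s>r. drifted B \<mu> r w < drifted B \<mu> s w))"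
  shows "D \<in> null_sets M"
proof -
  define c where "c = prob {w\<in>space M. B 1 w - B 0 w \<le> -2}"
  have c: "0 < c" "c \<le> 1" unfolding c_def using prob_standard_increment_le_pos by auto
  have le: "prob D \<le> (1 - c / 2) ^ n" for n
  proof -
    obtain S \<eta> where S: "finite S" "S \<subseteq> {0<..1}" "0 < \<eta>"
      and small: "\<And>t A. 0 \<le> t \<Longrightarrow> A \<in> sets (G (ennreal t)) \<Longrightarrow> prob (A \<inter> no_drop \<mu> S \<eta> t) \<le> (1 - c / 2) ^ n * prob A"
      using exists_no_drop_small[OF \<mu> zero_less_one, of n] unfolding c_def by blast
    have nM: "no_drop \<mu> S \<eta> t \<in> sets M" if "0 \<le> t" for t
      using sets_G_in_M[OF no_drop_in_G[OF S(1,2) that]] .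
    let ?f = "\<lambda>t. indicator (no_drop \<mu> S \<eta> t) :: 'a \<Rightarrow> ennreal"
    let ?fin = "{w\<in>space M. \<tau> w < \<top>}"
    have "emeasure M D = (\<integral>\<^sup>+w. indicator D w \<partial>M)" using D by simp
    also have "\<dots> \<le> (\<integral>\<^sup>+w\<in>?fin. liminf (\<lambda>k. ?f (grid k (enn2real (\<tau> w))) w) \<partial>M)"
    proof (rule nn_integral_mono_AE)
      show "AE w in M. indicator D w \<le> liminf (\<lambda>k. ?f (grid k (enn2real (\<tau> w))) w) * indicator ?fin w"
        using last AE_continuous_B AE_space
      proof eventually_elim
        case (elim w)
        show ?case
        proof (cases "w \<in> D")
          case True
          then obtain r where r: "0 \<le> r" "\<tau> w = ennreal r" "\<And>s. r < s \<Longrightarrow> drifted B \<mu> r w < drifted B \<mu> s w"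
            using elim(1) by auto
          have "(\<lambda>k. continuous_B (grid k r) w) \<longlonglongrightarrow> continuous_B r w"
            using r less_imp_le[OF le_less_trans[OF r(1) grid_greater]]
            by (intro continuous_on_tendsto_compose[OF continuous_on_continuous_B grid_tendsto]) auto
          then have "(\<lambda>k. drifted B \<mu> (grid k r) w) \<longlonglongrightarrow> drifted B \<mu> r w"
            unfolding drifted_def using elim(2) by (intro tendsto_add tendsto_mult tendsto_const grid_tendsto) simp
          then have "\<forall>\<^sub>F k in sequentially. drifted B \<mu> (grid k r) w < drifted B \<mu> r w + \<eta>"
            by (rule order_tendstoD(2)) (use S in simp)
          then have "\<forall>\<^sub>F k in sequentially. ?f (grid k r) w = 1"
          proof eventually_elim
            case (elim k)
            have "- \<eta> \<le> B (grid k r + s) w - B (grid k r) w + \<mu> * s" if "s \<in> S" for s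
            proof -
              have "r < grid k r + s" using grid_greater[of r k] S(2) that by fastforce
              from r(3)[OF this] show ?thesis using elim by (simp add: drifted_def algebra_simps)
            qed
            then show ?case using \<open>w \<in> space M\<close> by (simp add: no_drop_def)
          qed
          then have "(\<lambda>k. ?f (grid k r) w) \<longlonglongrightarrow> 1" by (rule tendsto_eventually)
          then have "liminf (\<lambda>k. ?f (grid k r) w) = 1" by (rule lim_imp_Liminf[OF sequentially_bot])
          then show ?thesis using True r elim(3) by simp
        qed simp
      qed
    qed
    also have "\<dots> \<le> (\<integral>\<^sup>+w\<in>?fin. ennreal ((1 - c / 2) ^ n) \<partial>M)"
    proof (rule nn_integral_grid_le[OF \<tau>])
      show "?f t \<in> borel_measurable M" if "0 \<le> t" for t using nM[OF that] by measurable
      show "(\<integral>\<^sup>+w\<in>A. ?f t w \<partial>M) \<le> (\<integral>\<^sup>+w\<in>A. ennreal ((1 - c / 2) ^ n) \<partial>M)"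
        if t: "0 \<le> t" and A: "A \<in> sets (G (ennreal t))" for t A
      proof -
        have "(\<integral>\<^sup>+w\<in>A. ?f t w \<partial>M) = (\<integral>\<^sup>+w. indicator (A \<inter> no_drop \<mu> S \<eta> t) w \<partial>M)"
          by (intro nn_integral_cong) (auto simp: indicator_def)
        also have "\<dots> = ennreal (prob (A \<inter> no_drop \<mu> S \<eta> t))"
          using nM[OF t] sets_G_in_M[OF A] by (simp add: emeasure_eq_measure)
        also have "\<dots> \<le> ennreal ((1 - c / 2) ^ n * prob A)"
          using small[OF t A] by (rule ennreal_leI)
        also have "\<dots> = (\<integral>\<^sup>+w\<in>A. ennreal ((1 - c / 2) ^ n) \<partial>M)"
          using sets_G_in_M[OF A] c by (simp add: nn_integral_cmult_indicator emeasure_eq_measure ennreal_mult)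
        finally show ?thesis .
      qed
    qed simp
    also have "\<dots> \<le> (\<integral>\<^sup>+w. ennreal ((1 - c / 2) ^ n) \<partial>M)"
      by (intro nn_integral_mono) (auto simp: indicator_def)
    also have "\<dots> = ennreal ((1 - c / 2) ^ n)" by (simp add: emeasure_space_1)
    finally show ?thesis using c by (simp add: emeasure_eq_measure ennreal_le_iff)
  qed
  have "(\<lambda>n. (1 - c / 2) ^ n) \<longlonglongrightarrow> 0" using c by (intro LIMSEQ_realpow_zero) auto
  then have "prob D \<le> 0" by (rule LIMSEQ_le_const) (use le in auto)
  then have "prob D = 0" using measure_nonneg[of M D] by linarith
  then show ?thesis using D by (simp add: null_sets_def emeasure_eq_measure)
qed

end

subsection \<open>The last passage time\<close>

locale drifted_last_passage = complete_brownian_motion M B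
  for M :: "'a measure" and B :: "real \<Rightarrow> 'a \<Rightarrow> real" +
  fixes \<mu> z :: real
  assumes \<mu>_pos: "0 < \<mu>" and z_pos: "0 < z"
begin

definition \<sigma> :: "'a \<Rightarrow> ennreal" where "\<sigma> = last_passage (drifted B \<mu>) z"
definition \<xi> :: "real \<Rightarrow> 'a \<Rightarrow> real" where "\<xi> = stopped (drifted B \<mu>) \<sigma>"
definition F :: "ennreal \<Rightarrow> 'a measure" where "F = completed_natural_filtration M \<xi>"

definition regular_path :: "'a \<Rightarrow> bool" where
  "regular_path w \<longleftrightarrow> continuous_on {0..} (\<lambda>t. drifted B \<mu> t w) \<and> drifted B \<mu> 0 w = 0 \<and>
     filterlim (\<lambda>t. drifted B \<mu> t w) at_top at_top"

lemma AE_regular_path: "AE w in M. regular_path w"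
  using continuous_paths start_B AE_drifted_at_top[OF \<mu>_pos]
  by eventually_elim (auto simp: regular_path_def drifted_def intro!: continuous_intros)

lemma regular_path_bounded_below:
  assumes "regular_path w"
  obtains T where "0 < T" "\<And>t. T \<le> t \<Longrightarrow> c < drifted B \<mu> t w"
proof -
  have "eventually (\<lambda>t. c < drifted B \<mu> t w) at_top"
    using assms by (auto simp: regular_path_def filterlim_at_top_dense)
  then obtain T where "\<And>t. T \<le> t \<Longrightarrow> c < drifted B \<mu> t w" by (auto simp: eventually_at_top_linorder)
  then show thesis by (intro that[of "max T 1"]) auto
qed

text \<open>The level set is bounded by the drift to infinity, closed, and nonempty by the
  intermediate value theorem, so its supremum is attained. A later value at or below
  \<open>z\<close> would force yet another crossing.\<close>

lemma regular_path_last_passage: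
  assumes w: "regular_path w"
  obtains r where "0 < r" "\<sigma> w = ennreal r" "drifted B \<mu> r w = z" "\<And>s. r < s \<Longrightarrow> z < drifted B \<mu> s w"
proof -
  let ?X = "\<lambda>t. drifted B \<mu> t w"
  have c: "continuous_on {0..} ?X" and X0: "?X 0 = 0" using w by (auto simp: regular_path_def)
  obtain T where T: "0 < T" "\<And>t. T \<le> t \<Longrightarrow> z < ?X t" using regular_path_bounded_below[OF w] by metis
  have hits: "\<exists>s\<ge>a. ?X s = z" if "0 \<le> a" "?X a \<le> z" for a
  proof -
    have "\<exists>s\<ge>a. s \<le> max a T \<and> ?X s = z"
      using that T(2)[of "max a T"]
      by (intro IVT') (auto intro: less_imp_le continuous_on_subset[OF c])
    then show ?thesis by auto
  qed
  define K where "K = {t. 0 \<le> t \<and> ?X t = z}"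
  have ne: "K \<noteq> {}" using hits[of 0] X0 z_pos by (auto simp: K_def)
  have "closed ({0..} \<inter> ?X -` {z})" by (rule continuous_closed_preimage[OF c]) auto
  then have cl: "closed K" by (simp add: K_def Int_def)
  have "t \<le> T" if "t \<in> K" for t using T(2)[of t] that by (auto simp: K_def intro: leI less_imp_le)
  then have bd: "bdd_above K" by (rule bdd_aboveI)
  define r where "r = Sup K"
  have rK: "r \<in> K" unfolding r_def by (rule closed_contains_Sup[OF ne bd cl])
  have r0: "0 < r" using rK X0 z_pos by (cases "r = 0") (auto simp: K_def)
  have upper: "t \<le> r" if "t \<in> K" for t unfolding r_def using that bd by (rule cSup_upper)
  have K_eq: "{ennreal t | t. t > 0 \<and> ?X t = z} = ennreal ` K"
    using X0 z_pos by (auto simp: K_def less_le)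
  have "\<sigma> w = ennreal r"
    unfolding \<sigma>_def last_passage_def K_eq
    using rK upper by (intro antisym Sup_upper Sup_least) (auto intro: ennreal_leI)
  moreover have "z < ?X s" if rs: "r < s" for s
  proof (rule ccontr)
    assume "\<not> z < ?X s"
    then obtain t where "s \<le> t" "?X t = z" using hits[OF less_imp_le[OF less_trans[OF r0 rs]]] by auto
    then show False using upper[of t] rs r0 by (auto simp: K_def)
  qed
  ultimately show thesis using that r0 rK by (auto simp: K_def)
qed

text \<open>The margin \<open>1 / Suc m\<close> excludes a touch of \<open>z\<close> between
  rational times; it exists because a path tending to infinity attains its minimum after
  \<open>t\<close>. Countability of the condition makes \<open>\<sigma>\<close> measurable.\<close>

lemma last_passage_less_iff:
  assumes w: "regular_path w" and t: "0 \<le> t"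
  shows "\<sigma> w < ennreal t \<longleftrightarrow> (\<exists>m. \<forall>q\<in>\<rat> \<inter> {t..}. z + 1 / real (Suc m) \<le> drifted B \<mu> q w)"
proof -
  let ?X = "\<lambda>t. drifted B \<mu> t w"
  have c: "continuous_on {0..} ?X" using w by (auto simp: regular_path_def)
  obtain r where r: "0 < r" "\<sigma> w = ennreal r" "?X r = z" "\<And>s. r < s \<Longrightarrow> z < ?X s"
    using regular_path_last_passage[OF w] by metis
  have "\<sigma> w < ennreal t \<longleftrightarrow> r < t" using r t by (simp add: ennreal_less_iff)
  also have "\<dots> \<longleftrightarrow> (\<exists>m. \<forall>q\<in>\<rat> \<inter> {t..}. z + 1 / real (Suc m) \<le> ?X q)"
  proof
    assume rt: "r < t"
    obtain T where T: "0 < T" "\<And>s. T \<le> s \<Longrightarrow> z + 1 < ?X s" using regular_path_bounded_below[OF w] by metis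
    have "\<exists>s\<in>{t..max t T}. \<forall>y\<in>{t..max t T}. ?X s \<le> ?X y"
      by (rule continuous_attains_inf) (use t in \<open>auto intro: continuous_on_subset[OF c]\<close>)
    then obtain s where s: "t \<le> s" "\<And>y. t \<le> y \<Longrightarrow> y \<le> max t T \<Longrightarrow> ?X s \<le> ?X y" by auto
    have "z < ?X s" using r(4) rt s(1) by simp
    then obtain m where m: "1 / real (Suc m) < ?X s - z"
      using nat_approx_posE[of "?X s - z"] by (auto simp del: of_nat_Suc)
    have "z + 1 / real (Suc m) \<le> ?X q" if "t \<le> q" for q
    proof (cases "q \<le> max t T")
      case True
      then show ?thesis using s(2)[OF that True] m by linarith
    next
      case False
      have "1 / real (Suc m) \<le> 1" by simp
      then show ?thesis using T(2)[of q] False by linarith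
    qed
    then show "\<exists>m. \<forall>q\<in>\<rat> \<inter> {t..}. z + 1 / real (Suc m) \<le> ?X q" by auto
  next
    assume "\<exists>m. \<forall>q\<in>\<rat> \<inter> {t..}. z + 1 / real (Suc m) \<le> ?X q"
    then obtain m where m: "\<And>q. q \<in> \<rat> \<Longrightarrow> t \<le> q \<Longrightarrow> z + 1 / real (Suc m) \<le> ?X q" by auto
    show "r < t"
    proof (rule ccontr)
      assume "\<not> r < t"
      then have tr: "t \<le> r" by simp
      from Rats_sequence_above_continuous[OF c less_imp_le[OF r(1)]] obtain q
        where q: "\<And>k. q k \<in> \<rat>" "\<And>k. r < q k" and "(\<lambda>k. ?X (q k)) \<longlonglongrightarrow> ?X r" by metis
      moreover have "z + 1 / real (Suc m) \<le> ?X (q k)" for k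
        using q(1,2)[of k] tr by (intro m) auto
      ultimately have "z + 1 / real (Suc m) \<le> ?X r" by (intro LIMSEQ_le_const) auto
      moreover have "0 < 1 / real (Suc m)" by simp
      ultimately show False using r(3) by linarith
    qed
  qed
  finally show ?thesis .
qed

lemma measurable_drifted: "0 \<le> t \<Longrightarrow> drifted B \<mu> t \<in> borel_measurable M"
  unfolding drifted_def using random_variable_B[of t] by measurable

lemma measurable_last_passage [measurable]: "\<sigma> \<in> borel_measurable M"
proof -
  have *: "{w\<in>space M. \<sigma> w < ennreal t} \<in> sets M" if t: "0 \<le> t" for t
  proof (rule in_sets_AE)
    let ?A = "\<Union>m. \<Inter>q\<in>\<rat> \<inter> {t..}. {w\<in>space M. z + 1 / real (Suc m) \<le> drifted B \<mu> q w}"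
    have ne: "\<rat> \<inter> {t..} \<noteq> {}" using Rats_dense_in_real[of t "t + 1"] by fastforce
    show "?A \<in> sets M"
    proof (intro sets.countable_UN sets.countable_INT' image_subsetI)
      show "countable (\<rat> \<inter> {t..})" by (rule countable_Rats_Int)
      fix m q assume "q \<in> \<rat> \<inter> {t..}"
      then have [measurable]: "drifted B \<mu> q \<in> borel_measurable M" using t by (intro measurable_drifted) auto
      show "{w\<in>space M. z + 1 / real (Suc m) \<le> drifted B \<mu> q w} \<in> sets M" by measurable
    qed (use ne in auto)
    show "AE w in M. w \<in> ?A \<longleftrightarrow> w \<in> {w\<in>space M. \<sigma> w < ennreal t}"
      using AE_regular_path AE_space
      by eventually_elim (use ne in \<open>auto simp: last_passage_less_iff[OF _ t]\<close>)
  qed auto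
  then show ?thesis by (rule borel_measurable_ennrealI_less)
qed

lemma stopped_before: "0 \<le> s \<Longrightarrow> ennreal s \<le> \<sigma> w \<Longrightarrow> \<xi> s w = drifted B \<mu> s w"
  by (simp add: \<xi>_def stopped_def min_absorb1)

lemma stopped_after: "\<sigma> w \<le> ennreal s \<Longrightarrow> \<xi> s w = drifted B \<mu> (enn2real (\<sigma> w)) w"
  by (simp add: \<xi>_def stopped_def min_absorb2)

lemma measurable_stopped: "0 \<le> s \<Longrightarrow> \<xi> s \<in> borel_measurable M"
proof (rule borel_measurable_AE_cong[where f="\<lambda>w. if \<sigma> w \<le> ennreal s then z else drifted B \<mu> s w"])
  assume s: "0 \<le> s"
  note measurable_drifted[OF s, measurable]
  show "(\<lambda>w. if \<sigma> w \<le> ennreal s then z else drifted B \<mu> s w) \<in> borel_measurable M" by measurable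
  show "AE w in M. (if \<sigma> w \<le> ennreal s then z else drifted B \<mu> s w) = \<xi> s w"
    using AE_regular_path
  proof eventually_elim
    case (elim w)
    from regular_path_last_passage[OF this] obtain r
      where r: "0 < r" "\<sigma> w = ennreal r" "drifted B \<mu> r w = z" by metis
    show ?case
    proof (cases "\<sigma> w \<le> ennreal s")
      case True
      then show ?thesis using stopped_after[OF True] r by simp
    next
      case False
      then show ?thesis using stopped_before[OF s, of w] by simp
    qed
  qed
qed

section \<open>Comparing the stopped filtration with the Brownian one\<close>

lemma sets_F_in_M: "A \<in> sets (F t) \<Longrightarrow> A \<in> sets M"
  using completed_natural_filtration_subset[of t \<xi> M] measurable_stopped by (auto simp: F_def)

lemma space_F [simp]: "space (F t) = space M"
  by (simp add: F_def)

lemma sets_F_mono: "s \<le> t \<Longrightarrow> sets (F s) \<subseteq> sets (F t)"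
  unfolding F_def by (rule completed_natural_filtration_mono)

lemma AE_drifted_neq:
  assumes "0 \<le> t"
  shows "AE w in M. drifted B \<mu> t w \<noteq> z"
proof (cases "t = 0")
  case True
  from AE_regular_path show ?thesis
    by eventually_elim (use True z_pos in \<open>auto simp: regular_path_def\<close>)
next
  case False
  then have "distributed M lborel (\<lambda>w. B t w - B 0 w) (normal_density 0 (sqrt (t - 0)))"
    using assms by (intro normal_increments) auto
  from distributed_AE2[OF this, of "\<lambda>x. x \<noteq> z - \<mu> * t"] AE_lborel_singleton[of "z - \<mu> * t"]
  have "AE w in M. B t w - B 0 w \<noteq> z - \<mu> * t" by auto
  with start_B show ?thesis by eventually_elim (simp add: drifted_def)
qed

text \<open>At a finite time, \<open>\<sigma> \<le> t\<close> almost surely means that the stopped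
  process is at \<open>z\<close>: once stopped it rests there, and before that the drifted motion
  avoids \<open>z\<close> at a fixed time.\<close>

lemma last_passage_le_in_F: "{w\<in>space M. \<sigma> w \<le> t} \<in> sets (F t)"
proof (cases t)
  case (real r)
  have m: "\<xi> r \<in> borel_measurable (completed_natural_filtration M \<xi> t)"
    using real by (intro measurable_completed_natural_filtration) auto
  show ?thesis unfolding F_def
  proof (rule completed_natural_filtration_AE_cong)
    show "\<xi> r -` {z} \<inter> space (completed_natural_filtration M \<xi> t) \<in> sets (completed_natural_filtration M \<xi> t)"
      by (rule measurable_sets[OF m]) auto
    show "AE w in M. w \<in> \<xi> r -` {z} \<inter> space (completed_natural_filtration M \<xi> t) \<longleftrightarrow> w \<in> {w\<in>space M. \<sigma> w \<le> t}"
      using AE_regular_path AE_drifted_neq[OF real(1)] AE_space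
    proof eventually_elim
      case (elim w)
      from regular_path_last_passage[OF elim(1)] obtain v
        where v: "0 < v" "\<sigma> w = ennreal v" "drifted B \<mu> v w = z" by metis
      show ?case
      proof (cases "\<sigma> w \<le> t")
        case True
        then show ?thesis using stopped_after[of w r] v elim real by auto
      next
        case False
        then show ?thesis using stopped_before[OF real(1), of w] v elim real by auto
      qed
    qed
  qed auto
next
  case top
  then have "{w\<in>space M. \<sigma> w \<le> t} = space (F t)" by auto
  then show ?thesis by (simp only: sets.top)
qed

lemma last_passage_gt_in_F: "{w\<in>space M. t < \<sigma> w} \<in> sets (F t)"
proof -
  have "{w\<in>space M. t < \<sigma> w} = space (F t) - {w\<in>space M. \<sigma> w \<le> t}" by auto
  then show ?thesis using last_passage_le_in_F[of t] by (metis sets.compl_sets)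
qed

text \<open>On \<open>\<sigma> \<le> t\<close> the stopped path does not move after
  \<open>t\<close>, so \<open>\<xi> s\<close> may be replaced by \<open>\<xi> (min s t)\<close>, for
  \<open>s\<close> as large as desired.\<close>

lemma F_frozen_after_last_passage:
  assumes "A \<in> sets (F u)" and t: "0 \<le> t"
  shows "A \<inter> {w\<in>space M. \<sigma> w \<le> ennreal t} \<in> sets (F (ennreal t))"
proof -
  let ?S = "{w\<in>space M. \<sigma> w \<le> ennreal t}"
  have S: "?S \<in> sets (F (ennreal t))" by (rule last_passage_le_in_F)
  from assms(1) show ?thesis unfolding F_def
  proof (induction rule: completed_natural_filtration_induct)
    case (process s U)
    define v where "v = min s t"
    have v: "0 \<le> v" "ennreal v \<le> ennreal t" using process t by (auto simp: v_def intro: ennreal_leI)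
    have "\<xi> s w = \<xi> v w" if "\<sigma> w \<le> ennreal t" for w
    proof (cases "s \<le> t")
      case False
      then have "\<sigma> w \<le> ennreal s" using order_trans[OF that ennreal_leI, of s] by simp
      then show ?thesis using stopped_after[of w s] stopped_after[of w t] that False by (simp add: v_def)
    qed (simp add: v_def)
    then have "\<xi> s -` U \<inter> space M \<inter> ?S = (\<xi> v -` U \<inter> space M) \<inter> ?S" by auto
    moreover have "\<xi> v -` U \<inter> space M \<in> sets (completed_natural_filtration M \<xi> (ennreal t))"
      using measurable_sets[OF measurable_completed_natural_filtration[of v "ennreal t" \<xi> M, OF v] process(3)] by simp
    ultimately show ?case using S by (auto simp: F_def)
  next
    case (null N)
    have "N \<inter> ?S \<in> null_sets M" using null by (intro null_set_Int2) measurable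
    then show ?case by (rule null_sets_completed_natural_filtration)
  next
    case (compl A)
    have "(space M - A) \<inter> ?S = ?S - A \<inter> ?S" by auto
    then show ?case using compl(2) S by (auto simp: F_def)
  next
    case (union A)
    have "(\<Union>i. A i) \<inter> ?S = (\<Union>i. A i \<inter> ?S)" by auto
    moreover have "(\<Union>i. A i \<inter> ?S) \<in> sets (completed_natural_filtration M \<xi> (ennreal t))"
      by (rule sets.countable_nat_UN) (use union(2) in blast)
    ultimately show ?case by (simp only:)
  qed
qed

text \<open>On \<open>t < \<sigma>\<close> the stopped path up to \<open>t\<close> is the drifted
  Brownian path. A matching set \<open>A'\<close> is given instead of an intersection, because
  \<open>t < \<sigma>\<close> depends on the Brownian future.\<close>

lemma F_trace_G:
  assumes "A \<in> sets (F t)"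
  shows "\<exists>A'\<in>sets (G t). \<forall>w\<in>space M. t < \<sigma> w \<longrightarrow> (w \<in> A \<longleftrightarrow> w \<in> A')"
  using assms unfolding F_def
proof (induction rule: completed_natural_filtration_induct)
  case (process s U)
  have m: "(\<lambda>w. drifted B \<mu> s w) \<in> borel_measurable (G t)"
    unfolding drifted_def using measurable_completed_natural_filtration[of s t B M, OF process(1,2)] by measurable
  have "drifted B \<mu> s -` U \<inter> space M \<in> sets (G t)" using measurable_sets[OF m process(3)] by simp
  moreover have "\<xi> s w = drifted B \<mu> s w" if "t < \<sigma> w" for w
    using process(2) that by (intro stopped_before process(1)) auto
  ultimately show ?case by (intro bexI[of _ "drifted B \<mu> s -` U \<inter> space M"]) auto
next
  case (null N)
  then show ?case using null_sets_completed_natural_filtration by blast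
next
  case (compl A)
  then obtain A' where "A' \<in> sets (G t)" "\<And>w. w \<in> space M \<Longrightarrow> t < \<sigma> w \<Longrightarrow> w \<in> A \<longleftrightarrow> w \<in> A'" by blast
  then show ?case using sets.compl_sets[of A' "G t"] by (intro bexI[of _ "space M - A'"]) auto
next
  case (union A)
  then obtain A' where "\<And>i. A' i \<in> sets (G t)" "\<And>i w. w \<in> space M \<Longrightarrow> t < \<sigma> w \<Longrightarrow> w \<in> A i \<longleftrightarrow> w \<in> A' i" by metis
  then show ?case by (intro bexI[of _ "\<Union>i. A' i"]) auto
qed

text \<open>In this direction one may intersect, since \<open>t < \<sigma>\<close> is observable in
  \<open>F\<close>.\<close>

lemma G_trace_F:
  assumes "A \<in> sets (G t)"
  shows "A \<inter> {w\<in>space M. t < \<sigma> w} \<in> sets (F t)"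
proof -
  let ?S = "{w\<in>space M. t < \<sigma> w}"
  have S: "?S \<in> sets (F t)" by (rule last_passage_gt_in_F)
  from assms show ?thesis
  proof (induction rule: completed_natural_filtration_induct)
    case (process s U)
    have m: "(\<lambda>w. \<xi> s w - \<mu> * s) \<in> borel_measurable (F t)"
      unfolding F_def using measurable_completed_natural_filtration[of s t \<xi> M, OF process(1,2)] by measurable
    have "B s w = \<xi> s w - \<mu> * s" if "t < \<sigma> w" for w
      using stopped_before[OF process(1), of w] process(2) that by (simp add: drifted_def)
    then have "(B s -` U \<inter> space M) \<inter> ?S = ((\<lambda>w. \<xi> s w - \<mu> * s) -` U \<inter> space (F t)) \<inter> ?S" by auto
    then show ?case using measurable_sets[OF m process(3)] S by auto
  next
    case (null N)
    have "N \<inter> ?S \<in> null_sets M" using null by (intro null_set_Int2) measurable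
    then show ?case unfolding F_def by (rule null_sets_completed_natural_filtration)
  next
    case (compl A)
    have "(space M - A) \<inter> ?S = ?S - A \<inter> ?S" by auto
    then show ?case using compl(2) S by auto
  next
    case (union A)
    have "(\<Union>i. A i) \<inter> ?S = (\<Union>i. A i \<inter> ?S)" by auto
    moreover have "(\<Union>i. A i \<inter> ?S) \<in> sets (F t)"
      by (rule sets.countable_nat_UN) (use union(2) in blast)
    ultimately show ?case by (simp only:)
  qed
qed

text \<open>Before \<open>\<sigma>\<close> the sets \<open>A q\<close> decide whether
  \<open>T \<le> q\<close>, and \<open>\<tau>\<close> is the infimum of the rational times at which
  they say so. If \<open>\<sigma> \<le> T\<close>, none of them does before \<open>\<sigma>\<close>,
  whence the last bound.\<close>

lemma stopping_time_imp_optional_time: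
  assumes T: "stopping_time F T"
  obtains \<tau> where "optional_time \<tau>" "\<And>w. w \<in> space M \<Longrightarrow> T w < \<sigma> w \<Longrightarrow> \<tau> w = T w"
    "\<And>w. w \<in> space M \<Longrightarrow> \<sigma> w \<le> T w \<Longrightarrow> \<sigma> w \<le> \<tau> w"
proof -
  have "{w\<in>space M. T w \<le> ennreal q} \<in> sets (F (ennreal q))" for q
    using stopping_timeD[OF T, of "ennreal q"] by (simp add: pred_def)
  from F_trace_G[OF this] obtain A where A: "\<And>q. A q \<in> sets (G (ennreal q))"
    "\<And>q w. w \<in> space M \<Longrightarrow> ennreal q < \<sigma> w \<Longrightarrow> T w \<le> ennreal q \<longleftrightarrow> w \<in> A q" by simp metis
  define \<tau> where "\<tau> w = Inf {ennreal q | q. q \<in> \<rat> \<and> 0 \<le> q \<and> w \<in> A q}" for w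
  have "optional_time \<tau>"
    unfolding optional_time_def
  proof
    fix t :: real
    have "{w\<in>space M. \<tau> w < ennreal t} = (\<Union>q\<in>\<rat> \<inter> {0..<t}. A q)"
    proof (intro equalityI subsetI)
      fix w assume "w \<in> {w\<in>space M. \<tau> w < ennreal t}"
      then show "w \<in> (\<Union>q\<in>\<rat> \<inter> {0..<t}. A q)" by (auto simp: \<tau>_def Inf_less_iff ennreal_less_iff)
    next
      fix w assume "w \<in> (\<Union>q\<in>\<rat> \<inter> {0..<t}. A q)"
      then obtain q where q: "q \<in> \<rat>" "0 \<le> q" "q < t" "w \<in> A q" by auto
      then show "w \<in> {w\<in>space M. \<tau> w < ennreal t}"
        using sets.sets_into_space[OF A(1)[of q]] by (auto simp: \<tau>_def Inf_less_iff ennreal_less_iff)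
    qed
    also have "\<dots> \<in> sets (G (ennreal t))"
    proof (rule sets.countable_UN'')
      show "countable (\<rat> \<inter> {0..<t})" by (rule countable_Rats_Int)
      fix q assume "q \<in> \<rat> \<inter> {0..<t}"
      then show "A q \<in> sets (G (ennreal t))"
        by (intro sets_G_mono[OF _ A(1)]) (auto intro: ennreal_leI)
    qed
    finally show "{w\<in>space M. \<tau> w < ennreal t} \<in> sets (G (ennreal t))" .
  qed
  moreover have "\<tau> w = T w" if w: "w \<in> space M" "T w < \<sigma> w" for w
  proof (rule antisym)
    show "\<tau> w \<le> T w"
    proof (rule ccontr)
      assume "\<not> \<tau> w \<le> T w"
      then have "T w < min (\<tau> w) (\<sigma> w)" using w by auto
      from ennreal_dense_Rats[OF this] obtain q
        where q: "q \<in> \<rat>" "0 \<le> q" "T w < ennreal q" "ennreal q < min (\<tau> w) (\<sigma> w)" .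
      then have "w \<in> A q" using A(2)[OF w(1), of q] by auto
      then have "\<tau> w \<le> ennreal q" unfolding \<tau>_def using q by (intro Inf_lower) auto
      then show False using q by auto
    qed
    show "T w \<le> \<tau> w"
      unfolding \<tau>_def
    proof (rule Inf_greatest, safe)
      fix q assume "w \<in> A q"
      then show "T w \<le> ennreal q" using A(2)[OF w(1), of q] w(2) by (cases "ennreal q < \<sigma> w") auto
    qed
  qed
  moreover have "\<sigma> w \<le> \<tau> w" if w: "w \<in> space M" "\<sigma> w \<le> T w" for w
    unfolding \<tau>_def
  proof (rule Inf_greatest, safe)
    fix q assume "w \<in> A q"
    then show "\<sigma> w \<le> ennreal q" using A(2)[OF w(1), of q] w(2) by (cases "ennreal q < \<sigma> w") auto
  qed
  ultimately show thesis by (rule that)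
qed

section \<open>Predictable times and the last passage time\<close>

lemma AE_optional_time_neq:
  assumes \<tau>: "optional_time \<tau>"
  shows "AE w in M. \<tau> w \<noteq> \<sigma> w"
proof -
  have [measurable]: "\<tau> \<in> borel_measurable M" by (rule measurable_G_in_M[OF measurable_optional_time[OF \<tau>]])
  have "{w\<in>space M. \<tau> w = \<sigma> w} \<in> null_sets M"
  proof (rule optional_time_not_last_minimum[OF \<mu>_pos \<tau>])
    show "AE w in M. w \<in> {w\<in>space M. \<tau> w = \<sigma> w} \<longrightarrow>
        (\<exists>r\<ge>0. \<tau> w = ennreal r \<and> (\<forall>s>r. drifted B \<mu> r w < drifted B \<mu> s w))"
      using AE_regular_path
    proof eventually_elim
      case (elim w)
      from regular_path_last_passage[OF elim] obtain r where "0 < r" "\<sigma> w = ennreal r"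
        "drifted B \<mu> r w = z" "\<And>s. r < s \<Longrightarrow> z < drifted B \<mu> s w" by metis
      then show ?case by (auto intro!: exI[of _ r])
    qed
  qed measurable
  from AE_not_in[OF this] AE_space show ?thesis by eventually_elim auto
qed

lemma AE_predictable_time_neq:
  assumes "predictable_time M F S"
  shows "AE w in M. S w \<noteq> \<sigma> w"
proof -
  obtain R :: "nat \<Rightarrow> 'a \<Rightarrow> ennreal" where R: "\<And>n. stopping_time F (R n)"
    and ann: "AE w in M. incseq (\<lambda>n. R n w) \<and> (\<lambda>n. R n w) \<longlonglongrightarrow> S w \<and> (S w > 0 \<longrightarrow> (\<forall>n. R n w < S w))"
    using assms unfolding predictable_time_def by blast
  have "\<forall>n. \<exists>\<tau>. optional_time \<tau> \<and> (\<forall>w\<in>space M. R n w < \<sigma> w \<longrightarrow> \<tau> w = R n w)"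
    using stopping_time_imp_optional_time[OF R] by metis
  then obtain \<tau> where \<tau>: "\<And>n. optional_time (\<tau> n)" "\<And>n w. w \<in> space M \<Longrightarrow> R n w < \<sigma> w \<Longrightarrow> \<tau> n w = R n w"
    by metis
  have "optional_time (\<lambda>w. SUP n. \<tau> n w)"
    unfolding optional_time_def
  proof
    fix t :: real
    have "{w\<in>space M. (SUP n. \<tau> n w) < ennreal t} = (\<Union>q\<in>\<rat> \<inter> {0..<t}. \<Inter>n. {w\<in>space M. \<tau> n w < ennreal q})"
    proof (intro equalityI subsetI)
      fix w assume "w \<in> {w\<in>space M. (SUP n. \<tau> n w) < ennreal t}"
      then have w: "w \<in> space M" "(SUP n. \<tau> n w) < ennreal t" by auto
      from ennreal_dense_Rats[OF w(2)] obtain q where q: "q \<in> \<rat>" "0 \<le> q" "(SUP n. \<tau> n w) < ennreal q" "ennreal q < ennreal t" .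
      then have "q < t" by (simp add: ennreal_less_iff)
      moreover have "\<tau> n w < ennreal q" for n using SUP_upper[of n UNIV "\<lambda>n. \<tau> n w"] q(3) by (simp add: le_less_trans)
      ultimately show "w \<in> (\<Union>q\<in>\<rat> \<inter> {0..<t}. \<Inter>n. {w\<in>space M. \<tau> n w < ennreal q})" using q w by (auto intro!: bexI[of _ q])
    next
      fix w assume "w \<in> (\<Union>q\<in>\<rat> \<inter> {0..<t}. \<Inter>n. {w\<in>space M. \<tau> n w < ennreal q})"
      then obtain q where q: "0 \<le> q" "q < t" "w \<in> space M" "\<And>n. \<tau> n w < ennreal q" by auto
      have "(SUP n. \<tau> n w) \<le> ennreal q" using q(4) by (intro SUP_least less_imp_le)
      also have "\<dots> < ennreal t" using q by (simp add: ennreal_less_iff)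
      finally show "w \<in> {w\<in>space M. (SUP n. \<tau> n w) < ennreal t}" using q by simp
    qed
    also have "\<dots> \<in> sets (G (ennreal t))"
    proof (rule sets.countable_UN'')
      show "countable (\<rat> \<inter> {0..<t})" by (rule countable_Rats_Int)
      fix q assume "q \<in> \<rat> \<inter> {0..<t}"
      then show "(\<Inter>n. {w\<in>space M. \<tau> n w < ennreal q}) \<in> sets (G (ennreal t))"
        by (intro sets.countable_INT image_subsetI optional_timeD'[OF \<tau>(1)]) (auto intro: ennreal_leI)
    qed
    finally show "{w\<in>space M. (SUP n. \<tau> n w) < ennreal t} \<in> sets (G (ennreal t))" .
  qed
  from AE_optional_time_neq[OF this] ann AE_regular_path AE_space show ?thesis
  proof eventually_elim
    case (elim w)
    show ?case
    proof
      assume eq: "S w = \<sigma> w"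
      \<comment> \<open>Positivity of \<open>\<sigma>\<close> makes the announcement strict, so
        every \<open>R n\<close> lies before \<open>\<sigma>\<close> and is copied by
        \<open>\<tau> n\<close>.\<close>
      from regular_path_last_passage[OF elim(3)] have "0 < \<sigma> w" by (metis ennreal_less_zero_iff)
      then have "R n w < \<sigma> w" for n using elim(2) eq by auto
      then have "\<tau> n w = R n w" for n using \<tau>(2) elim(4) by blast
      moreover have "(SUP n. R n w) = S w"
        using elim(2) LIMSEQ_SUP[of "\<lambda>n. R n w"] LIMSEQ_unique by blast
      ultimately show False using elim(1) eq by simp
    qed
  qed
qed

lemma stopping_time_last_passage: "stopping_time F \<sigma>"
  using last_passage_le_in_F by (intro stopping_timeI) (simp add: pred_def)

lemma totally_inaccessible_last_passage: "totally_inaccessible M F \<sigma>"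
  unfolding totally_inaccessible_def
proof (intro conjI allI impI stopping_time_last_passage)
  fix S assume "predictable_time M F S"
  from AE_predictable_time_neq[OF this]
  have "AE w in M. w \<notin> {w\<in>space M. \<sigma> w = S w \<and> S w < \<infinity>}"
    by eventually_elim auto
  then have "{w\<in>space M. \<sigma> w = S w \<and> S w < \<infinity>} \<in> null_sets M"
    by (rule AE_imp_null_set) auto
  then show "\<P>(w in M. \<sigma> w = S w \<and> S w < \<infinity>) = 0" by (rule measure_eq_0_null_sets)
qed

lemma measurable_stopping_time_F:
  assumes "stopping_time F T"
  shows "T \<in> borel_measurable (F \<top>)"
  using assms by (rule measurable_stopping_time) (use sets_F_mono[OF top_greatest] in auto)

text \<open>Before \<open>\<sigma>\<close> the time is optional for the Brownian filtration and is announced there; after \<open>\<sigma>\<close>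
  everything is known, so \<open>T - 1 / Suc n\<close> may be used.\<close>

lemma predictable_time_if_AE_neq:
  assumes T: "stopping_time F T" and neq: "AE w in M. T w \<noteq> \<sigma> w"
  shows "predictable_time M F T"
proof -
  obtain \<tau> where \<tau>: "optional_time \<tau>" "\<And>w. w \<in> space M \<Longrightarrow> T w < \<sigma> w \<Longrightarrow> \<tau> w = T w"
    "\<And>w. w \<in> space M \<Longrightarrow> \<sigma> w \<le> T w \<Longrightarrow> \<sigma> w \<le> \<tau> w"
    using stopping_time_imp_optional_time[OF T] by metis
  obtain R :: "nat \<Rightarrow> 'a \<Rightarrow> ennreal"
    where R: "\<And>n t. 0 \<le> t \<Longrightarrow> {w\<in>space M. R n w \<le> ennreal t} \<in> sets (G (ennreal t))"
      and ann: "AE w in M. incseq (\<lambda>n. R n w) \<and> (\<lambda>n. R n w) \<longlonglongrightarrow> \<tau> w \<and> (\<tau> w > 0 \<longrightarrow> (\<forall>n. R n w < \<tau> w))"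
    using optional_time_announced[OF \<tau>(1)] by blast
  \<comment> \<open>Truncation by \<open>n\<close> announces an infinite \<open>T\<close>;
    subtraction in \<open>ennreal\<close> stops at 0.\<close>
  define U where "U n w = min (of_nat n) (T w - ennreal (1 / real (Suc n)))" for n w
  \<comment> \<open>The maximum with \<open>\<sigma>\<close> keeps the sequence increasing at the
    switch and makes \<open>S n w \<le> t\<close> in the second case imply
    \<open>\<sigma> w \<le> t\<close>, when \<open>U n\<close> is fully known.\<close>
  define S where "S n w = (if R n w < \<sigma> w then R n w else max (\<sigma> w) (U n w))" for n w
  have Um: "U n \<in> borel_measurable (F \<top>)" for n
    unfolding U_def using measurable_stopping_time_F[OF T] by measurable
  have "stopping_time F (S n)" for n
  proof (rule stopping_timeI)
    fix t :: ennreal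
    show "Measurable.pred (F t) (\<lambda>w. S n w \<le> t)"
    proof (cases t)
      case top
      then show ?thesis by simp
    next
      case (real r)
      let ?late = "{w\<in>space M. \<sigma> w \<le> t}"
      let ?A = "{w\<in>space M. R n w \<le> t} \<inter> {w\<in>space M. t < \<sigma> w}"
      let ?C = "{w\<in>space M. U n w \<le> t} \<inter> ?late"
      let ?D = "\<Union>q\<in>\<rat> \<inter> {0..r}. ({w\<in>space M. R n w \<le> ennreal q} \<inter> {w\<in>space M. ennreal q < \<sigma> w}) \<inter> ?late"
      \<comment> \<open>Whether \<open>R n\<close> came before \<open>\<sigma>\<close> is tested at
        a separating rational time, where \<open>G_trace_F\<close> applies.\<close>
      have D: "{w\<in>space M. R n w < \<sigma> w} \<inter> ?late = ?D"
      proof (intro equalityI subsetI)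
        fix w assume w: "w \<in> {w\<in>space M. R n w < \<sigma> w} \<inter> ?late"
        then have "R n w < \<sigma> w" by auto
        from ennreal_dense_Rats[OF this] obtain q where q: "q \<in> \<rat>" "0 \<le> q" "R n w < ennreal q" "ennreal q < \<sigma> w" .
        then have "ennreal q < ennreal r" using w real by auto
        then have "q \<le> r" using q by (simp add: ennreal_less_iff)
        then show "w \<in> ?D" using q w by (auto intro!: bexI[of _ q])
      qed auto
      have late: "?late \<in> sets (F t)" by (rule last_passage_le_in_F)
      have "?A \<in> sets (F t)" using R[OF real(1), of n] unfolding real(2) by (rule G_trace_F)
      moreover have "?C \<in> sets (F t)"
      proof -
        have "{w\<in>space (F \<top>). U n w \<le> t} \<in> sets (F \<top>)" using Um by measurable
        then show ?thesis using F_frozen_after_last_passage[OF _ real(1)] real(2) by simp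
      qed
      moreover have "?D \<in> sets (F t)"
      proof (rule sets.countable_UN'')
        show "countable (\<rat> \<inter> {0..r})" by (rule countable_Rats_Int)
        fix q assume q: "q \<in> \<rat> \<inter> {0..r}"
        then have "{w\<in>space M. R n w \<le> ennreal q} \<inter> {w\<in>space M. ennreal q < \<sigma> w} \<in> sets (F (ennreal q))"
          by (intro G_trace_F R) auto
        moreover have "sets (F (ennreal q)) \<subseteq> sets (F t)"
          using q real by (intro sets_F_mono) (auto intro: ennreal_leI)
        ultimately show "({w\<in>space M. R n w \<le> ennreal q} \<inter> {w\<in>space M. ennreal q < \<sigma> w}) \<inter> ?late \<in> sets (F t)"
          using late by blast
      qed
      moreover have "{w\<in>space (F t). S n w \<le> t} = ?A \<union> (?D \<union> ?C)"
      proof (intro equalityI subsetI)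
        fix w assume w: "w \<in> {w\<in>space (F t). S n w \<le> t}"
        show "w \<in> ?A \<union> (?D \<union> ?C)"
        proof (cases "R n w < \<sigma> w")
          case True
          then have "R n w \<le> t" using w by (simp add: S_def)
          then show ?thesis unfolding D[symmetric] using w True by (cases "\<sigma> w \<le> t") auto
        qed (use w in \<open>auto simp: S_def\<close>)
      next
        fix w assume "w \<in> ?A \<union> (?D \<union> ?C)"
        then show "w \<in> {w\<in>space (F t). S n w \<le> t}"
          unfolding D[symmetric] by (auto simp: S_def)
      qed
      ultimately have "{w\<in>space (F t). S n w \<le> t} \<in> sets (F t)" by (simp only: sets.Un)
      then show ?thesis by (simp add: pred_def)
    qed
  qed
  moreover have "AE w in M. incseq (\<lambda>n. S n w) \<and> (\<lambda>n. S n w) \<longlonglongrightarrow> T w \<and> (T w > 0 \<longrightarrow> (\<forall>n. S n w < T w))"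
    using neq ann AE_optional_time_neq[OF \<tau>(1)] AE_regular_path AE_space
  proof eventually_elim
    case (elim w)
    then have inc: "incseq (\<lambda>n. R n w)" and lim: "(\<lambda>n. R n w) \<longlonglongrightarrow> \<tau> w"
      and less: "\<And>n. 0 < \<tau> w \<Longrightarrow> R n w < \<tau> w" by auto
    show ?case
    proof (cases "T w < \<sigma> w")
      case True
      then have eq: "\<tau> w = T w" using \<tau>(2) elim by blast
      have "R n w \<le> T w" for n using incseq_le[OF inc lim] eq by simp
      then have "R n w < \<sigma> w" for n using True by (rule le_less_trans)
      then have "S n w = R n w" for n by (simp add: S_def)
      then show ?thesis using inc lim less eq by simp
    next
      case False
      then have T\<sigma>: "\<sigma> w < T w" using elim(1) by auto
      \<comment> \<open>Here \<open>\<tau>\<close> is at least \<open>\<sigma>\<close> and almost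
        surely differs from it, so \<open>R n\<close> eventually passes \<open>\<sigma>\<close> and
        the second case of \<open>S\<close> takes over.\<close>
      then have "\<sigma> w < \<tau> w" using \<tau>(3)[OF elim(5)] elim(3) by (auto simp: order.order_iff_strict)
      from order_tendstoD(1)[OF lim this] have ev: "\<forall>\<^sub>F n in sequentially. S n w = max (\<sigma> w) (U n w)"
        by eventually_elim (auto simp: S_def)
      obtain r where r: "0 < r" "\<sigma> w = ennreal r" using regular_path_last_passage[OF elim(4)] by metis
      have T0: "0 < T w" using T\<sigma> by (rule le_less_trans[rotated]) simp
      have U_less: "U n w < T w" for n
      proof (cases "T w")
        case (real v)
        then have v: "0 < v" using T0 by simp
        have "U n w \<le> ennreal v - ennreal (1 / real (Suc n))" by (simp add: U_def real)
        also have "\<dots> = ennreal (v - 1 / real (Suc n))" by (rule ennreal_minus) simp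
        also have "\<dots> < ennreal v" using v by (intro ennreal_lessI) auto
        finally show ?thesis by (simp add: real)
      next
        case top
        have "U n w \<le> of_nat n" by (simp add: U_def)
        also have "\<dots> < \<top>" by (simp add: ennreal_of_nat_eq_real_of_nat)
        finally show ?thesis by (simp add: top)
      qed
      have U_inc: "U n w \<le> U (Suc n) w" for n
        unfolding U_def
        by (intro min.mono ennreal_minus_mono order_refl ennreal_leI) (auto simp: frac_le)
      have U_lim: "(\<lambda>n. U n w) \<longlonglongrightarrow> T w"
      proof (cases "T w")
        case (real v)
        then have v: "0 < v" using T0 by simp
        obtain n0 :: nat where n0: "v \<le> real n0" using real_arch_simple by blast
        have "\<forall>\<^sub>F n in sequentially. ennreal (v - 1 / real (Suc n)) = U n w"
        proof (rule eventually_sequentiallyI)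
          fix n assume "n0 \<le> n"
          then have "v \<le> real n" using n0 by linarith
          moreover have "0 \<le> 1 / real (Suc n)" by simp
          ultimately have "v - 1 / real (Suc n) \<le> real n" by linarith
          then have "ennreal (v - 1 / real (Suc n)) \<le> of_nat n"
            by (simp add: ennreal_of_nat_eq_real_of_nat ennreal_leI del: of_nat_Suc)
          moreover have "ennreal v - ennreal (1 / real (Suc n)) = ennreal (v - 1 / real (Suc n))"
            by (rule ennreal_minus) simp
          ultimately show "ennreal (v - 1 / real (Suc n)) = U n w"
            by (simp add: U_def real min_absorb2 del: of_nat_Suc)
        qed
        moreover have "(\<lambda>n. ennreal (v - 1 / real (Suc n))) \<longlonglongrightarrow> ennreal (v - 0)"
          by (intro tendsto_ennrealI tendsto_diff tendsto_const LIMSEQ_Suc[OF lim_1_over_n])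
        ultimately have "(\<lambda>n. U n w) \<longlonglongrightarrow> ennreal (v - 0)" by (rule Lim_transform_eventually[rotated])
        then show ?thesis by (simp add: real)
      next
        case top
        then have "U n w = of_nat n" for n by (simp add: U_def)
        moreover have "(of_nat :: nat \<Rightarrow> ennreal) \<longlonglongrightarrow> \<top>" by (rule of_nat_tendsto_top_ennreal)
        ultimately show ?thesis by (simp add: top)
      qed
      have "incseq (\<lambda>n. S n w)"
      proof (rule incseq_SucI)
        fix n
        have RR: "R n w \<le> R (Suc n) w" using inc by (rule incseq_SucD)
        show "S n w \<le> S (Suc n) w"
        proof (cases "R (Suc n) w < \<sigma> w")
          case True
          then show ?thesis using RR le_less_trans[OF RR True] by (simp add: S_def)
        next
          case False
          have "max (\<sigma> w) (U n w) \<le> max (\<sigma> w) (U (Suc n) w)" by (intro max.mono U_inc order_refl)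
          then show ?thesis using False by (auto simp: S_def intro: less_imp_le le_max_iff_disj[THEN iffD2])
        qed
      qed
      moreover have "(\<lambda>n. S n w) \<longlonglongrightarrow> T w"
      proof -
        have "(\<lambda>n. max (\<sigma> w) (U n w)) \<longlonglongrightarrow> max (\<sigma> w) (T w)"
          by (intro tendsto_max tendsto_const U_lim)
        then have "(\<lambda>n. max (\<sigma> w) (U n w)) \<longlonglongrightarrow> T w" using T\<sigma> by (simp add: max_absorb2 less_imp_le)
        then show ?thesis using ev by (subst tendsto_cong) auto
      qed
      moreover have "S n w < T w" for n
        using T\<sigma> U_less[of n] by (auto simp: S_def intro: less_trans)
      ultimately show ?thesis by simp
    qed
  qed
  ultimately show ?thesis using T unfolding predictable_time_def by blast
qed

lemma prob_eq_last_passage_eq_0_iff: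
  assumes T: "stopping_time F T"
  shows "\<P>(w in M. T w = \<sigma> w) = 0 \<longleftrightarrow> predictable_time M F T"
proof -
  have [measurable]: "T \<in> borel_measurable M"
    using T by (rule measurable_stopping_time) (auto intro: sets_F_in_M)
  have "{w\<in>space M. T w = \<sigma> w} \<in> sets M" by measurable
  then have "\<P>(w in M. T w = \<sigma> w) = 0 \<longleftrightarrow> (AE w in M. T w \<noteq> \<sigma> w)"
    by (rule prob_Collect_eq_0)
  then show ?thesis
    using predictable_time_if_AE_neq[OF T] AE_predictable_time_neq[of T] by blast
qed

end

theorem theorem5p4:
  fixes M :: "'a measure" and B :: "real \<Rightarrow> 'a \<Rightarrow> real" and \<mu> z :: real
  assumes "brownian_motion M B" and "complete_measure M"
    and "\<mu> > 0" and "z > 0"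
  defines "\<sigma> \<equiv> last_passage (drifted B \<mu>) z"
  defines "\<xi> \<equiv> stopped (drifted B \<mu>) \<sigma>"
  defines "F \<equiv> completed_natural_filtration M \<xi>"
  shows "totally_inaccessible M F \<sigma> \<and>
    (\<forall>T. stopping_time F T \<longrightarrow> (\<P>(\<omega> in M. T \<omega> = \<sigma> \<omega>) = 0 \<longleftrightarrow> predictable_time M F T))"
proof -
  interpret P: drifted_last_passage M B \<mu> z
    using assms by (simp add: drifted_last_passage_def complete_brownian_motion_def
        drifted_last_passage_axioms_def)
  have "P.\<sigma> = \<sigma>" by (simp add: P.\<sigma>_def \<sigma>_def)
  moreover have "P.F = F" by (simp add: P.F_def F_def P.\<xi>_def \<xi>_def \<open>P.\<sigma> = \<sigma>\<close>)
  ultimately show ?thesis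
    using P.totally_inaccessible_last_passage P.prob_eq_last_passage_eq_0_iff by simp
qed

end
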